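(* Let $\mathfrak A$ be a countable finitely homogeneous Ramsey structure and let $\mathfrak C$ be a reduct of $\mathfrak A$. Let $\mathscr C$ be the clone of all polymorphisms of $\mathfrak C$ that are canonical over $\mathfrak A$ and let $\zeta\colon\mathscr C\to\operatorname{Proj}$ be an $\overline{\operatorname{Aut}(\mathfrak A)}$-invariant minor-preserving map. Then for every pair $(\mathfrak A_1,\mathfrak A_2)$ of independent elementary substructures of $\mathfrak A$ (with domains $A_1,A_2$) the following are equivalent. (1) $\zeta$ has the unique interpolation property (UIP) with respect to $\operatorname{Pol}(\mathfrak C)$ over $\mathfrak A$. (2) For all binary $f\in\operatorname{Pol}(\mathfrak C)$ and $u_1,u_2\in\overline{\operatorname{Aut}(\mathfrak A)}$ with $u_1(A)\subseteq A_1$ and $u_2(A)\subseteq A_2$, if $f(\operatorname{id},u_1)$ and $f(\operatorname{id},u_2)$ are canonical over $\mathfrak A$, then $\zeta(f(\operatorname{id},u_1))=\zeta(f(\operatorname{id},u_2))$.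
   Context: All structures are relational. A structure is homogeneous if every isomorphism between finite substructures extends to an automorphism; finitely homogeneous means homogeneous with a finite relational signature. For structures $\mathfrak X,\mathfrak Y$ in the same signature, $\binom{\mathfrak Y}{\mathfrak X}$ is the set of embeddings of $\mathfrak X$ into $\mathfrak Y$; $\mathfrak Z\to(\mathfrak Y)^{\mathfrak X}_r$ means that for every $\chi\colon\binom{\mathfrak Z}{\mathfrak X}\to\{1,\dots,r\}$ there is $e\in\binom{\mathfrak Z}{\mathfrak Y}$ such that $\chi$ is constant on $\{e\circ f: f\in\binom{\mathfrak Y}{\mathfrak X}\}$. A homogeneous structure is Ramsey if its age $\mathcal K$ (the class of finite structures embedding into it) satisfies: for all $\mathfrak X,\mathfrak Y\in\mathcal K$, $r\in\mathbb N$ there is $\mathfrak Z\in\mathcal K$ with $\mathfrak Z\to(\mathfrak Y)^{\mathfrak X}_r$. $\operatorname{typ}^{\mathfrak A}(a)$ is the set of first-order formulas satisfied by the tuple $a$ in $\mathfrak A$; $\operatorname{typ}^{\mathfrak A}(a/B)$ is the set of first-order formulas with parameters from $B\subseteq A$ satisfied by $a$. For $X,Y\subseteq A$, $X$ is independent from $Y$ in $\mathfrak A$ if for all $n$ and $\bar a,\bar b\in X^n$, $\operatorname{typ}^{\mathfrak A}(\bar a)=\operatorname{typ}^{\mathfrak A}(\bar b)$ implies $\operatorname{typ}^{\mathfrak A}(\bar a/Y)=\operatorname{typ}^{\mathfrak A}(\bar b/Y)$. Two substructures are independent if the domain of each is independent from the domain of the other in $\mathfrak A$. A substructure is elementary if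 its inclusion map preserves all first-order formulas. $\operatorname{Pol}(\mathfrak C)$ is the clone of all homomorphisms from finite direct powers $\mathfrak C^k$ to $\mathfrak C$. $\operatorname{Proj}$ is the clone of all projections on $\{0,1\}$. An operation $f\colon A^k\to A$ is canonical over $\mathfrak A$ if for all $n$ and $a_1,\dots,a_k,b_1,\dots,b_k\in A^n$ with $\operatorname{typ}^{\mathfrak A}(a_i)=\operatorname{typ}^{\mathfrak A}(b_i)$ for all $i$ we have $\operatorname{typ}^{\mathfrak A}(f(a_1,\dots,a_k))=\operatorname{typ}^{\mathfrak A}(f(b_1,\dots,b_k))$ (componentwise application). $\overline{\operatorname{Aut}(\mathfrak A)}$ is the closure of $\operatorname{Aut}(\mathfrak A)$ in the set of maps $A\to A$ with respect to pointwise convergence. For unary $v_1,\dots,v_k$, $f(v_1,\dots,v_k)$ denotes $(a_1,\dots,a_k)\mapsto f(v_1(a_1),\dots,v_k(a_k))$. For a set $\mathscr M$ of unary operations, $\zeta$ defined on $\mathscr C$ is $\mathscr M$-invariant if $\zeta(f)=\zeta(u(f(v_1,\dots,v_k)))$ for all $k$-ary $f\in\mathscr C$ and $u,v_1,\dots,v_k\in\mathscr M$. For $f$ of arity $n$ and $\alpha\colon\{1,\dots,n\}\to\{1,\dots,k\}$ let $f_\alpha(x_1,\dots,x_k)=f(x_{\alpha(1)},\dots,x_{\alpha(n)})$. An arity-preserving map $\zeta$ between clones is minor-preserving if $\zeta(f_\alpha)=\zeta(f)_\alpha$ for all such $f,\alpha$. $f\colon A^k\to A$ interpolates $g\colon A^k\to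 A$ over $\mathscr M$ if for every finite $F\subseteq A$ there are $u,v_1,\dots,v_k\in\mathscr M$ with $g(a_1,\dots,a_k)=u(f(v_1(a_1),\dots,v_k(a_k)))$ for all $a_1,\dots,a_k\in F$. For a clone $\mathscr P$ containing $\operatorname{Aut}(\mathfrak A)$, a function $\zeta$ defined on $\mathscr D\subseteq\mathscr P$ has the UIP with respect to $\mathscr P$ over $\mathfrak A$ if $\zeta(g)=\zeta(h)$ for all $g,h\in\mathscr D$ that are interpolated by the same operation $f\in\mathscr P$ over $\operatorname{Aut}(\mathfrak A)$. *)

theory Defs
  imports "HOL-Analysis.Function_Topology" "HOL-Library.Countable_Set"
begin

section \<open>Relational structures\<close>

text \<open>A relational signature is a partial map from symbols to arities; its symbols are the
  elements of its domain. Structures over it interpret every other symbol by the empty relation.\<close>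

type_synonym 'r signature = "'r \<Rightarrow> nat option"

record ('r, 'a) struct =
  univ :: "'a set"
  rel :: "'r \<Rightarrow> 'a list set"

definition tuples :: "'a set \<Rightarrow> nat \<Rightarrow> 'a list set" where
  "tuples D n = {t. length t = n \<and> set t \<subseteq> D}"

definition is_structure :: "'r signature \<Rightarrow> ('r, 'a) struct \<Rightarrow> bool" where
  "is_structure \<sigma> M \<longleftrightarrow>
     (\<forall>R. \<forall>t \<in> rel M R. \<exists>n. \<sigma> R = Some n \<and> t \<in> tuples (univ M) n)"

definition substructure :: "('r, 'a) struct \<Rightarrow> ('r, 'a) struct \<Rightarrow> bool" where
  "substructure B A \<longleftrightarrow>
     univ B \<subseteq> univ A \<and> (\<forall>R. rel B R = rel A R \<inter> lists (univ B))"

text \<open>Maps between structures are extensional outside the domain of the source, so that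
  equality of functions in HOL is equality of maps between the domains.\<close>

definition homomorphisms :: "('r, 'a) struct \<Rightarrow> ('r, 'b) struct \<Rightarrow> ('a \<Rightarrow> 'b) set" where
  "homomorphisms X Y = {f \<in> univ X \<rightarrow>\<^sub>E univ Y. \<forall>R. \<forall>t \<in> rel X R. map f t \<in> rel Y R}"

definition embeddings :: "('r, 'a) struct \<Rightarrow> ('r, 'b) struct \<Rightarrow> ('a \<Rightarrow> 'b) set" where
  "embeddings X Y = {f \<in> univ X \<rightarrow>\<^sub>E univ Y. inj_on f (univ X) \<and>
     (\<forall>R. \<forall>t \<in> lists (univ X). t \<in> rel X R \<longleftrightarrow> map f t \<in> rel Y R)}"

definition isomorphisms :: "('r, 'a) struct \<Rightarrow> ('r, 'b) struct \<Rightarrow> ('a \<Rightarrow> 'b) set" where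
  "isomorphisms X Y = {f \<in> embeddings X Y. f ` univ X = univ Y}"

definition Aut :: "('r, 'a) struct \<Rightarrow> ('a \<Rightarrow> 'a) set" where
  "Aut A = isomorphisms A A"

definition Aut_closure :: "('r, 'a) struct \<Rightarrow> ('a \<Rightarrow> 'a) set" where
  "Aut_closure A =
     product_topology (\<lambda>_. discrete_topology (univ A)) (univ A) closure_of Aut A"

definition homogeneous :: "('r, 'a) struct \<Rightarrow> bool" where
  "homogeneous A \<longleftrightarrow>
     (\<forall>X Y f. substructure X A \<and> finite (univ X) \<and> substructure Y A \<and> finite (univ Y) \<and>
        f \<in> isomorphisms X Y \<longrightarrow> (\<exists>g \<in> Aut A. \<forall>x \<in> univ X. g x = f x))"

definition finitely_homogeneous :: "'r signature \<Rightarrow> ('r, 'a) struct \<Rightarrow> bool" where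
  "finitely_homogeneous \<sigma> A \<longleftrightarrow> finite (dom \<sigma>) \<and> is_structure \<sigma> A \<and> homogeneous A"

section \<open>The Ramsey property\<close>

definition arrows ::
  "('r, 'c) struct \<Rightarrow> ('r, 'b) struct \<Rightarrow> ('r, 'a) struct \<Rightarrow> nat \<Rightarrow> bool" where
  "arrows Z Y X r \<longleftrightarrow>
     (\<forall>\<chi> \<in> embeddings X Z \<rightarrow> {1..r}. \<exists>e \<in> embeddings Y Z. \<exists>c.
        \<forall>f \<in> embeddings X Y. \<chi> (compose (univ X) e f) = c)"

text \<open>The age is a proper class of finite structures, closed under isomorphism; it is
  represented by its members with domain a set of natural numbers.\<close>

definition age :: "'r signature \<Rightarrow> ('r, 'a) struct \<Rightarrow> ('r, nat) struct set" where
  "age \<sigma> A = {X. is_structure \<sigma> X \<and> finite (univ X) \<and> embeddings X A \<noteq> {}}"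

definition ramsey :: "'r signature \<Rightarrow> ('r, 'a) struct \<Rightarrow> bool" where
  "ramsey \<sigma> A \<longleftrightarrow>
     (\<forall>X \<in> age \<sigma> A. \<forall>Y \<in> age \<sigma> A. \<forall>r. \<exists>Z \<in> age \<sigma> A. arrows Z Y X r)"

section \<open>First-order formulas and types\<close>

datatype 'c trm = Var nat | Par 'c

datatype ('r, 'c) fm =
    Atom 'r "'c trm list"
  | Equal "'c trm" "'c trm"
  | Neg "('r, 'c) fm"
  | Conj "('r, 'c) fm" "('r, 'c) fm"
  | Exists nat "('r, 'c) fm"

primrec trm_vars :: "'c trm \<Rightarrow> nat set" where
  "trm_vars (Var i) = {i}"
| "trm_vars (Par c) = {}"

primrec trm_pars :: "'c trm \<Rightarrow> 'c set" where
  "trm_pars (Var i) = {}"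
| "trm_pars (Par c) = {c}"

primrec trm_val :: "(nat \<Rightarrow> 'a) \<Rightarrow> 'a trm \<Rightarrow> 'a" where
  "trm_val e (Var i) = e i"
| "trm_val e (Par c) = c"

primrec free_vars :: "('r, 'c) fm \<Rightarrow> nat set" where
  "free_vars (Atom R ts) = (\<Union>t \<in> set ts. trm_vars t)"
| "free_vars (Equal s t) = trm_vars s \<union> trm_vars t"
| "free_vars (Neg \<phi>) = free_vars \<phi>"
| "free_vars (Conj \<phi> \<psi>) = free_vars \<phi> \<union> free_vars \<psi>"
| "free_vars (Exists i \<phi>) = free_vars \<phi> - {i}"

primrec parameters :: "('r, 'c) fm \<Rightarrow> 'c set" where
  "parameters (Atom R ts) = (\<Union>t \<in> set ts. trm_pars t)"
| "parameters (Equal s t) = trm_pars s \<union> trm_pars t"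
| "parameters (Neg \<phi>) = parameters \<phi>"
| "parameters (Conj \<phi> \<psi>) = parameters \<phi> \<union> parameters \<psi>"
| "parameters (Exists i \<phi>) = parameters \<phi>"

text \<open>Atoms with a symbol outside the signature or with the wrong number of arguments are
  not excluded syntactically; they are false in every structure over the signature.\<close>

primrec sat :: "('r, 'a) struct \<Rightarrow> (nat \<Rightarrow> 'a) \<Rightarrow> ('r, 'a) fm \<Rightarrow> bool" where
  "sat M e (Atom R ts) \<longleftrightarrow> map (trm_val e) ts \<in> rel M R"
| "sat M e (Equal s t) \<longleftrightarrow> trm_val e s = trm_val e t"
| "sat M e (Neg \<phi>) \<longleftrightarrow> \<not> sat M e \<phi>"
| "sat M e (Conj \<phi> \<psi>) \<longleftrightarrow> sat M e \<phi> \<and> sat M e \<psi>"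
| "sat M e (Exists i \<phi>) \<longleftrightarrow> (\<exists>x \<in> univ M. sat M (e(i := x)) \<phi>)"

text \<open>The free variables of the formulas in the type of an \<open>n\<close>-tuple are among \<open>0, \<dots>, n - 1\<close>.\<close>

definition tp_over :: "('r, 'a) struct \<Rightarrow> 'a list \<Rightarrow> 'a set \<Rightarrow> ('r, 'a) fm set" where
  "tp_over A a B =
     {\<phi>. free_vars \<phi> \<subseteq> {..<length a} \<and> parameters \<phi> \<subseteq> B \<and> sat A (\<lambda>i. a ! i) \<phi>}"

definition tp :: "('r, 'a) struct \<Rightarrow> 'a list \<Rightarrow> ('r, 'a) fm set" where
  "tp A a = tp_over A a {}"

definition elementary_substructure :: "('r, 'a) struct \<Rightarrow> ('r, 'a) struct \<Rightarrow> bool" where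
  "elementary_substructure B A \<longleftrightarrow> substructure B A \<and>
     (\<forall>\<phi> e. parameters \<phi> = {} \<and> e ` free_vars \<phi> \<subseteq> univ B \<and> sat B e \<phi> \<longrightarrow> sat A e \<phi>)"

definition independent_from :: "('r, 'a) struct \<Rightarrow> 'a set \<Rightarrow> 'a set \<Rightarrow> bool" where
  "independent_from A X Y \<longleftrightarrow>
     (\<forall>n. \<forall>a \<in> tuples X n. \<forall>b \<in> tuples X n.
        tp A a = tp A b \<longrightarrow> tp_over A a Y = tp_over A b Y)"

definition independent_substructures ::
  "('r, 'a) struct \<Rightarrow> ('r, 'a) struct \<Rightarrow> ('r, 'a) struct \<Rightarrow> bool" where
  "independent_substructures A B1 B2 \<longleftrightarrow>
     independent_from A (univ B1) (univ B2) \<and> independent_from A (univ B2) (univ B1)"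

text \<open>Reducts are first-order reducts: same domain, and all relations first-order definable
  without parameters. This includes the structures obtained by dropping relations.\<close>

definition reduct :: "'s signature \<Rightarrow> ('s, 'a) struct \<Rightarrow> ('r, 'a) struct \<Rightarrow> bool" where
  "reduct \<tau> C A \<longleftrightarrow> is_structure \<tau> C \<and> univ C = univ A \<and>
     (\<forall>R n. \<tau> R = Some n \<longrightarrow>
        (\<exists>\<phi> :: ('r, 'a) fm. parameters \<phi> = {} \<and> free_vars \<phi> \<subseteq> {..<n} \<and>
           rel C R = {t \<in> tuples (univ A) n. sat A (\<lambda>i. t ! i) \<phi>}))"

section \<open>Operations and clones\<close>

text \<open>A \<open>k\<close>-ary operation on \<open>D\<close> is an element of \<open>tuples D k \<rightarrow>\<^sub>E D\<close>. Such a function does not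
  determine its arity, so a set of operations is given as the family of its \<open>k\<close>-ary parts, and
  an arity-preserving map between such sets as a family of maps. Clones have no operations of
  arity \<open>0\<close>.\<close>

type_synonym 'a opn = "'a list \<Rightarrow> 'a"
type_synonym 'a opns = "nat \<Rightarrow> 'a opn set"

definition power_struct :: "('r, 'a) struct \<Rightarrow> nat \<Rightarrow> ('r, 'a list) struct" where
  "power_struct C k = \<lparr>univ = tuples (univ C) k,
     rel = \<lambda>R. {T \<in> lists (tuples (univ C) k). \<forall>i<k. map (\<lambda>t. t ! i) T \<in> rel C R}\<rparr>"

definition Pol :: "('r, 'a) struct \<Rightarrow> 'a opns" where
  "Pol C k = (if k = 0 then {} else homomorphisms (power_struct C k) C)"

definition projections :: "'a set \<Rightarrow> 'a opns" where
  "projections D k = {(\<lambda>x \<in> tuples D k. x ! i) | i. i < k}"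

definition Proj :: "nat opns" where
  "Proj = projections {0, 1}"

text \<open>For a list \<open>as = [a1, \<dots>, ak]\<close> of \<open>n\<close>-tuples, the \<open>n\<close>-tuple \<open>f(a1, \<dots>, ak)\<close>.\<close>

definition componentwise :: "'a opn \<Rightarrow> nat \<Rightarrow> 'a list list \<Rightarrow> 'a list" where
  "componentwise f n as = map (\<lambda>j. f (map (\<lambda>a. a ! j) as)) [0..<n]"

definition canonical :: "('r, 'a) struct \<Rightarrow> nat \<Rightarrow> 'a opn \<Rightarrow> bool" where
  "canonical A k f \<longleftrightarrow>
     (\<forall>n. \<forall>as \<in> tuples (tuples (univ A) n) k. \<forall>bs \<in> tuples (tuples (univ A) n) k.
        (\<forall>i<k. tp A (as ! i) = tp A (bs ! i)) \<longrightarrow>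
        tp A (componentwise f n as) = tp A (componentwise f n bs))"

definition canonical_Pol :: "('s, 'a) struct \<Rightarrow> ('r, 'a) struct \<Rightarrow> 'a opns" where
  "canonical_Pol C A k = {f \<in> Pol C k. canonical A k f}"

text \<open>The operation \<open>f(v1, \<dots>, vk)\<close> on \<open>D\<close>, for \<open>vs = [v1, \<dots>, vk]\<close>.\<close>

definition subst_unary :: "'a set \<Rightarrow> 'a opn \<Rightarrow> ('a \<Rightarrow> 'a) list \<Rightarrow> 'a opn" where
  "subst_unary D f vs = (\<lambda>x \<in> tuples D (length vs). f (map2 (\<lambda>v y. v y) vs x))"

definition invariant ::
  "'a set \<Rightarrow> ('a \<Rightarrow> 'a) set \<Rightarrow> 'a opns \<Rightarrow> (nat \<Rightarrow> 'a opn \<Rightarrow> 'b opn) \<Rightarrow> bool" where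
  "invariant D M \<C> \<zeta> \<longleftrightarrow>
     (\<forall>k. \<forall>f \<in> \<C> k. \<forall>u \<in> M. \<forall>vs \<in> tuples M k.
        \<zeta> k f = \<zeta> k (compose (tuples D k) u (subst_unary D f vs)))"

text \<open>The minor \<open>(x_1, \<dots>, x_k) \<mapsto> f(x_{\<alpha>(1)}, \<dots>, x_{\<alpha>(n)})\<close> of an \<open>n\<close>-ary operation \<open>f\<close> on \<open>D\<close>,
  with indices starting at \<open>0\<close>.\<close>

definition minor :: "'a set \<Rightarrow> nat \<Rightarrow> nat \<Rightarrow> (nat \<Rightarrow> nat) \<Rightarrow> 'a opn \<Rightarrow> 'a opn" where
  "minor D n k \<alpha> f = (\<lambda>x \<in> tuples D k. f (map (\<lambda>i. x ! \<alpha> i) [0..<n]))"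

definition minor_preserving ::
  "'a set \<Rightarrow> 'a opns \<Rightarrow> 'b set \<Rightarrow> 'b opns \<Rightarrow> (nat \<Rightarrow> 'a opn \<Rightarrow> 'b opn) \<Rightarrow> bool" where
  "minor_preserving D \<C> E \<D> \<zeta> \<longleftrightarrow>
     (\<forall>k. \<zeta> k \<in> \<C> k \<rightarrow> \<D> k) \<and>
     (\<forall>n k. \<forall>f \<in> \<C> n. \<forall>\<alpha> \<in> {..<n} \<rightarrow> {..<k}.
        \<zeta> k (minor D n k \<alpha> f) = minor E n k \<alpha> (\<zeta> n f))"

definition interpolates ::
  "'a set \<Rightarrow> ('a \<Rightarrow> 'a) set \<Rightarrow> nat \<Rightarrow> 'a opn \<Rightarrow> 'a opn \<Rightarrow> bool" where
  "interpolates D M k f g \<longleftrightarrow>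
     (\<forall>F. finite F \<and> F \<subseteq> D \<longrightarrow>
        (\<exists>u \<in> M. \<exists>vs \<in> tuples M k. \<forall>x \<in> tuples F k. g x = u (subst_unary D f vs x)))"

text \<open>UIP of a map \<open>\<zeta>\<close> defined on \<open>\<D>\<close>, with respect to \<open>\<P>\<close> over \<open>A\<close>.\<close>

definition UIP ::
  "('r, 'a) struct \<Rightarrow> 'a opns \<Rightarrow> 'a opns \<Rightarrow> (nat \<Rightarrow> 'a opn \<Rightarrow> 'b opn) \<Rightarrow> bool" where
  "UIP A \<P> \<D> \<zeta> \<longleftrightarrow>
     (\<forall>k. \<forall>g \<in> \<D> k. \<forall>h \<in> \<D> k. \<forall>f \<in> \<P> k.
        interpolates (univ A) (Aut A) k f g \<and> interpolates (univ A) (Aut A) k f h \<longrightarrow>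
        \<zeta> k g = \<zeta> k h)"

end

theory Submission
  imports Defs
begin

text \<open>If \<open>\<zeta>\<close> has the UIP, then it satisfies the condition on binary operations, because
  \<open>f(id, u)\<close> is interpolated by \<open>f\<close>: on every finite set, \<open>u\<close> agrees with an automorphism.

  For the converse let \<open>f\<close> interpolate the canonical operations \<open>g\<close> and \<open>h\<close>. By elementarity there are
  limits \<open>u1\<close>, \<open>u2\<close> of automorphisms with values in \<open>A1\<close> and \<open>A2\<close>. The structure is homogeneous in a
  finite signature, so types of tuples are orbits of automorphisms and there are finitely many of them
  for each length; independence therefore means that finite parts of \<open>A1\<close> and of \<open>A2\<close> can be moved
  separately by one automorphism (\<open>independent_move\<close>), and sequences of operations have limits modulo
  automorphisms (\<open>limit\<close>). The Ramsey property, first for one orbit of tuples and then for products,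
  yields canonical operations (\<open>canonize\<close>).

  The arguments where \<open>f\<close> looks like \<open>g\<close> need not be independent from those where it looks like \<open>h\<close>.
  The two operations are therefore compared with a third one, \<open>r\<close>, which \<open>f\<close> shows at arguments that
  are independent from both in each coordinate (\<open>common_partner\<close>). It remains to prove that \<open>g\<close> and
  \<open>r\<close> have the same image, and likewise \<open>h\<close> and \<open>r\<close>. By independence there is a polymorphism \<open>p\<close> such that
  \<open>p(u1, \<dots>, u1)\<close> behaves like \<open>g\<close> and \<open>p(u2, \<dots>, u2)\<close> behaves like \<open>r\<close>, and canonisation also makes one
  operation with mixed inner maps canonical (\<open>mixed_canonical\<close>). If the images of \<open>g\<close> and \<open>r\<close> were
  different projections, then the image of the mixed operation would differ from one of them, and
  identification of variables would give a binary operation that violates the condition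
  (\<open>image_eq_if_realized\<close>).\<close>

section \<open>Types and orbits\<close>

lemma sat_cong:
  assumes "\<And>i. i \<in> free_vars \<phi> \<Longrightarrow> e i = e' i"
  shows "sat M e \<phi> \<longleftrightarrow> sat M e' \<phi>"
  using assms
proof (induction \<phi> arbitrary: e e')
  case (Atom R ts)
  have "trm_val e t = trm_val e' t" if "t \<in> set ts" for t
  proof (cases t)
    case (Var i)
    then have "i \<in> free_vars (Atom R ts)" using that by force
    then show ?thesis using Atom Var by simp
  qed simp
  then have "map (trm_val e) ts = map (trm_val e') ts" by simp
  then show ?case by (simp only: sat.simps)
next
  case (Equal s t)
  have "trm_val e s = trm_val e' s" using Equal by (cases s) auto
  moreover have "trm_val e t = trm_val e' t" using Equal by (cases t) auto
  ultimately show ?case by simp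
next
  case (Exists i \<phi>)
  have "sat M (e(i := x)) \<phi> \<longleftrightarrow> sat M (e'(i := x)) \<phi>" for x
    by (rule Exists.IH) (use Exists.prems in auto)
  then show ?case by simp
next
  case (Neg \<phi>)
  then show ?case by (metis free_vars.simps(3) sat.simps(3))
next
  case (Conj \<phi> \<psi>)
  then show ?case by (metis UnCI free_vars.simps(4) sat.simps(4))
qed

lemma AutD:
  assumes "g \<in> Aut A"
  shows "g \<in> univ A \<rightarrow>\<^sub>E univ A" "inj_on g (univ A)" "g ` univ A = univ A"
    "\<And>R t. t \<in> lists (univ A) \<Longrightarrow> t \<in> rel A R \<longleftrightarrow> map g t \<in> rel A R"
  using assms by (auto simp: Aut_def isomorphisms_def embeddings_def)

lemma Aut_in: "g \<in> Aut A \<Longrightarrow> x \<in> univ A \<Longrightarrow> g x \<in> univ A"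
  using AutD(1) by (metis PiE_mem)

lemma Aut_id: "(\<lambda>x\<in>univ A. x) \<in> Aut A"
proof -
  have *: "map (\<lambda>x\<in>univ A. x) t = t" if "t \<in> lists (univ A)" for t
    using that by (auto intro!: map_idI)
  show ?thesis
    by (auto simp: Aut_def isomorphisms_def embeddings_def inj_on_def *)
qed

lemma sat_automorphism:
  assumes g: "g \<in> Aut A"
  assumes "parameters \<phi> = {}" "e ` free_vars \<phi> \<subseteq> univ A"
  shows "sat A (g \<circ> e) \<phi> \<longleftrightarrow> sat A e \<phi>"
  using assms(2,3)
proof (induction \<phi> arbitrary: e)
  case (Atom R ts)
  have *: "trm_val (g \<circ> e) t = g (trm_val e t) \<and> trm_val e t \<in> univ A" if "t \<in> set ts" for t
  proof (cases t)
    case (Var i)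
    then have "i \<in> free_vars (Atom R ts)" using that by force
    then have "e i \<in> univ A" using Atom.prems(2) by blast
    then show ?thesis using Var by simp
  next
    case (Par c)
    then have "c \<in> parameters (Atom R ts)" using that by force
    then show ?thesis using Atom.prems(1) by blast
  qed
  then have "map (trm_val (g \<circ> e)) ts = map g (map (trm_val e) ts)" by simp
  moreover have "map (trm_val e) ts \<in> lists (univ A)" using * by auto
  ultimately show ?case using AutD(4)[OF g] by (metis sat.simps(1))
next
  case (Equal s t)
  have *: "trm_val (g \<circ> e) s = g (trm_val e s) \<and> trm_val e s \<in> univ A"
    using Equal by (cases s) auto
  have **: "trm_val (g \<circ> e) t = g (trm_val e t) \<and> trm_val e t \<in> univ A"
    using Equal by (cases t) auto
  show ?case unfolding sat.simps using * ** inj_on_eq_iff[OF AutD(2)[OF g]] by metis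
next
  case (Exists i \<phi>)
  have IH: "sat A (g \<circ> (e(i := x))) \<phi> \<longleftrightarrow> sat A (e(i := x)) \<phi>" if "x \<in> univ A" for x
    by (rule Exists.IH) (use Exists.prems that in auto)
  have upd: "g \<circ> (e(i := x)) = (g \<circ> e)(i := g x)" for x by auto
  have "sat A (g \<circ> e) (Exists i \<phi>) \<longleftrightarrow> (\<exists>y\<in>g ` univ A. sat A ((g \<circ> e)(i := y)) \<phi>)"
    using AutD(3)[OF g] by simp
  also have "\<dots> \<longleftrightarrow> (\<exists>x\<in>univ A. sat A (e(i := x)) \<phi>)"
    using IH upd by auto
  finally show ?case by (simp only: sat.simps)
qed auto

lemma tp_length: "tp A a = tp A b \<Longrightarrow> length a = length b"
proof -
  assume eq: "tp A a = tp A b"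
  have *: "Equal (Var i) (Var i) \<in> tp A c \<longleftrightarrow> i < length c" for i c
    by (auto simp: tp_def tp_over_def)
  have "i < length a \<longleftrightarrow> i < length b" for i using *[of i a] *[of i b] eq by simp
  then show ?thesis by (metis linorder_neqE_nat nat_neq_iff)
qed

lemma tp_automorphism:
  assumes g: "g \<in> Aut A" and a: "a \<in> lists (univ A)"
  shows "tp A (map g a) = tp A a"
proof -
  have "sat A (\<lambda>i. map g a ! i) \<phi> \<longleftrightarrow> sat A (\<lambda>i. a ! i) \<phi>"
    if "free_vars \<phi> \<subseteq> {..<length a}" "parameters \<phi> = {}" for \<phi> :: "('b, 'a) fm"
  proof -
    have "sat A (\<lambda>i. map g a ! i) \<phi> \<longleftrightarrow> sat A (g \<circ> (\<lambda>i. a ! i)) \<phi>"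
      by (rule sat_cong) (use that in auto)
    also have "\<dots> \<longleftrightarrow> sat A (\<lambda>i. a ! i) \<phi>"
      by (rule sat_automorphism[OF g that(2)]) (use that a in \<open>auto simp: in_lists_conv_set\<close>)
    finally show ?thesis .
  qed
  then show ?thesis by (auto simp: tp_def tp_over_def)
qed

lemma in_lists_iff: "t \<in> lists D \<longleftrightarrow> set t \<subseteq> D" by auto

text \<open>Homogeneity speaks of isomorphisms between finite substructures; for tuples, possibly with
  repeated entries, it says that two tuples with the same quantifier-free diagram lie in one orbit.\<close>

lemma homogeneous_extend:
  assumes hom: "homogeneous A" and a: "a \<in> lists (univ A)" and b: "b \<in> lists (univ A)"
    and len: "length a = length b"
    and eq: "\<And>i j. i < length a \<Longrightarrow> j < length a \<Longrightarrow> a ! i = a ! j \<longleftrightarrow> b ! i = b ! j"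
    and rel: "\<And>R is. set is \<subseteq> {..<length a} \<Longrightarrow>
      map ((!) a) is \<in> rel A R \<longleftrightarrow> map ((!) b) is \<in> rel A R"
  shows "\<exists>g\<in>Aut A. map g a = b"
proof -
  define idx where "idx x = (SOME i. i < length a \<and> a ! i = x)" for x
  have idx: "idx x < length a \<and> a ! idx x = x" if "x \<in> set a" for x
    unfolding idx_def by (rule someI_ex) (use that in \<open>auto simp: in_set_conv_nth\<close>)
  define f where "f = (\<lambda>x\<in>set a. b ! idx x)"
  have fa: "f (a ! i) = b ! i" if "i < length a" for i
    using idx[of "a ! i"] eq[of "idx (a ! i)" i] that by (auto simp: f_def)
  have fx: "f x = b ! idx x" if "x \<in> set a" for x using that by (simp add: f_def)
  define X where "X = \<lparr>univ = set a, rel = \<lambda>R. rel A R \<inter> lists (set a)\<rparr>"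
  define Y where "Y = \<lparr>univ = set b, rel = \<lambda>R. rel A R \<inter> lists (set b)\<rparr>"
  have img: "f ` set a = set b"
  proof -
    have "f ` set a = f ` ((!) a ` {..<length a})"
      by (auto simp: set_conv_nth)
    also have "\<dots> = (!) b ` {..<length b}" unfolding image_image using fa len by auto
    also have "\<dots> = set b" by (auto simp: set_conv_nth)
    finally show ?thesis .
  qed
  have inj: "inj_on f (set a)"
    by (rule inj_onI) (metis fx idx eq)
  have r: "t \<in> rel A R \<longleftrightarrow> map f t \<in> rel A R" if t: "t \<in> lists (set a)" for t R
  proof -
    have "map ((!) a) (map idx t) = t" using t idx by (auto intro!: map_idI simp: in_lists_iff)
    moreover have "map ((!) b) (map idx t) = map f t" using t fx by (simp add: in_lists_iff subset_iff)
    moreover have "set (map idx t) \<subseteq> {..<length a}" using t idx by (auto simp: in_lists_iff)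
    ultimately show ?thesis using rel[of "map idx t" R] by metis
  qed
  have "map f t \<in> lists (set b)" if "t \<in> lists (set a)" for t
    using that img by (auto simp: in_lists_iff)
  moreover have "f \<in> set a \<rightarrow>\<^sub>E set b" using img by (auto simp: f_def)
  ultimately have "f \<in> isomorphisms X Y"
    using img inj r by (simp add: isomorphisms_def embeddings_def X_def Y_def)
  moreover have "substructure X A" "substructure Y A"
    using a b by (auto simp: substructure_def X_def Y_def)
  ultimately obtain g where g: "g \<in> Aut A" "\<forall>x\<in>univ X. g x = f x"
    using hom[unfolded homogeneous_def, rule_format, of X Y f]
    by (auto simp: X_def Y_def)
  have "map g a = b"
    by (rule nth_equalityI) (use len fa g in \<open>auto simp: X_def\<close>)
  then show ?thesis using g by blast
qed

lemma tp_atom_iff: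
  assumes "set is \<subseteq> {..<length a}"
  shows "Atom R (map Var is) \<in> tp A a \<longleftrightarrow> map ((!) a) is \<in> rel A R"
proof -
  have "map (trm_val ((!) a)) (map Var is) = map ((!) a) is" by simp
  then have "sat A ((!) a) (Atom R (map Var is)) \<longleftrightarrow> map ((!) a) is \<in> rel A R"
    by (simp only: sat.simps)
  then show ?thesis using assms by (auto simp: tp_def tp_over_def simp del: sat.simps)
qed

lemma tp_eq_iff:
  assumes "i < length a" "j < length a"
  shows "Equal (Var i) (Var j) \<in> tp A a \<longleftrightarrow> a ! i = a ! j"
  using assms by (auto simp: tp_def tp_over_def)

text \<open>Equality of diagrams is part of equality of types, and automorphisms preserve types. Hence
  types and orbits are the same thing, and equations between types can stand in for automorphisms.\<close>

lemma tp_eqE: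
  assumes hom: "homogeneous A" and a: "a \<in> lists (univ A)" and b: "b \<in> lists (univ A)"
    and eq: "tp A a = tp A b"
  obtains g where "g \<in> Aut A" "map g a = b"
proof -
  have len: "length a = length b" using tp_length[OF eq] .
  have "\<exists>g\<in>Aut A. map g a = b"
    by (rule homogeneous_extend[OF hom a b len])
      (metis tp_atom_iff tp_eq_iff len eq)+
  then show ?thesis using that by blast
qed

lemma tp_neg: 
  assumes "free_vars \<phi> \<subseteq> {..<length a}" "parameters \<phi> = {}"
  shows "Neg \<phi> \<in> tp A a \<longleftrightarrow> \<phi> \<notin> tp A a"
  using assms by (auto simp: tp_def tp_over_def)

lemma tp_subset_eq:
  assumes "tp A a \<subseteq> tp A b" "length a = length b"
  shows "tp A a = tp A b"
proof (rule antisym[OF assms(1)], rule subsetI, rule ccontr)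
  fix \<phi> assume \<phi>: "\<phi> \<in> tp A b" "\<phi> \<notin> tp A a"
  then have "free_vars \<phi> \<subseteq> {..<length b}" "parameters \<phi> = {}"
    by (auto simp: tp_def tp_over_def)
  then show False using \<phi> assms tp_neg[of \<phi> a A] tp_neg[of \<phi> b A] by auto
qed

locale fin_homogeneous =
  fixes \<sigma> :: "'r signature" and A :: "('r, 'a) struct"
  assumes countable: "countable (univ A)"
    and fin_hom: "finitely_homogeneous \<sigma> A"
begin

abbreviation "D \<equiv> univ A"
abbreviation "G \<equiv> Aut A"

lemma hom: "homogeneous A" using fin_hom by (simp add: finitely_homogeneous_def)

lemma rel_arity: "t \<in> rel A R \<Longrightarrow> R \<in> dom \<sigma> \<and> length t = the (\<sigma> R)"
  using fin_hom by (force simp: finitely_homogeneous_def is_structure_def tuples_def)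

lemma tp_map:
  assumes "tp A a = tp A b" "a \<in> lists D" "b \<in> lists D" "set is \<subseteq> {..<length a}"
  shows "tp A (map ((!) a) is) = tp A (map ((!) b) is)"
proof -
  obtain g where g: "g \<in> G" "map g a = b" using tp_eqE[OF hom assms(2,3,1)] by blast
  have "map ((!) b) is = map g (map ((!) a) is)" using g(2)[symmetric] assms(4) by auto
  moreover have "map ((!) a) is \<in> lists D"
    using assms(2,4) nth_mem[of _ a] by (auto simp: in_lists_iff subset_iff simp del: nth_mem)
  ultimately show ?thesis using tp_automorphism[OF g(1)] by metis
qed

text \<open>A type is determined by the equalities and atoms that hold between the entries of the
  tuple, and a finite signature has only finitely many atoms in \<open>n\<close> variables.\<close>

lemma finite_types: "finite (tp A ` tuples D n)"
proof -
  define I where "I = (\<Union>R\<in>dom \<sigma>. {R} \<times> {is. set is \<subseteq> {..<n} \<and> length is = the (\<sigma> R)})"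
  have finI: "finite I"
    using fin_hom by (auto simp: I_def finitely_homogeneous_def finite_lists_length_eq)
  define diagram where "diagram a = ({(i, j) \<in> {..<n} \<times> {..<n}. a ! i = a ! j},
      {(R, is) \<in> I. map ((!) a) is \<in> rel A R})" for a
  have "diagram ` tuples D n \<subseteq> Pow ({..<n} \<times> {..<n}) \<times> Pow I"
    by (auto simp: diagram_def)
  then have fin: "finite (diagram ` tuples D n)"
    by (rule finite_subset) (use finI in auto)
  have "tp A a = tp A b" if ab: "a \<in> tuples D n" "b \<in> tuples D n" "diagram a = diagram b" for a b
  proof -
    have len: "length a = n" "length b = n" "a \<in> lists D" "b \<in> lists D"
      using ab by (auto simp: tuples_def in_lists_iff)
    have 1: "a ! i = a ! j \<longleftrightarrow> b ! i = b ! j" if "i < n" "j < n" for i j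
      using ab(3) that unfolding diagram_def by auto
    have 2: "map ((!) a) is \<in> rel A R \<longleftrightarrow> map ((!) b) is \<in> rel A R" if "set is \<subseteq> {..<n}" for R "is"
    proof (cases "(R, is) \<in> I")
      case True
      then show ?thesis using ab(3) unfolding diagram_def by auto
    next
      case False
      then show ?thesis using rel_arity[of "map ((!) a) is" R] rel_arity[of "map ((!) b) is" R] that
        by (auto simp: I_def)
    qed
    obtain g where "g \<in> G" "map g a = b"
      using homogeneous_extend[OF hom len(3,4), simplified len, OF _ 1 2] by auto
    then show ?thesis using tp_automorphism len by metis
  qed
  note same = this
  define h where "h c = tp A (SOME a. a \<in> tuples D n \<and> diagram a = c)" for c
  have "tp A a = h (diagram a)" if "a \<in> tuples D n" for a
  proof -
    define b where "b = (SOME b. b \<in> tuples D n \<and> diagram b = diagram a)"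
    have "b \<in> tuples D n \<and> diagram b = diagram a"
      unfolding b_def by (rule someI[of _ a]) (use that in simp)
    then have "tp A a = tp A b" using same[of a b] that by metis
    then show ?thesis unfolding h_def b_def .
  qed
  then have "tp A ` tuples D n = h ` diagram ` tuples D n" by (simp add: image_image cong: image_cong)
  then show ?thesis using fin by simp
qed

text \<open>A finite conjunction is enough to separate one type from the finitely many others.\<close>

lemma isolating_formula:
  assumes a: "a \<in> tuples D n"
  obtains \<phi> where "\<phi> \<in> tp A a" "\<And>b. b \<in> tuples D n \<Longrightarrow> \<phi> \<in> tp A b \<Longrightarrow> tp A b = tp A a"
proof -
  have "\<exists>\<phi>\<in>tp A a. \<forall>\<theta>\<in>T. \<phi> \<in> \<theta> \<longrightarrow> \<theta> = tp A a"
    if "finite T" "T \<subseteq> tp A ` tuples D n" for T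
    using that
  proof (induction T)
    case empty
    \<comment> \<open>The empty conjunction: a valid formula without free variables.\<close>
    have "Neg (Exists 0 (Neg (Equal (Var 0) (Var 0)))) \<in> tp A a"
      by (auto simp: tp_def tp_over_def)
    then show ?case by auto
  next
    case (insert \<theta> T)
    then obtain \<phi> where \<phi>: "\<phi> \<in> tp A a" "\<forall>\<theta>\<in>T. \<phi> \<in> \<theta> \<longrightarrow> \<theta> = tp A a" by auto
    obtain b where b: "b \<in> tuples D n" "\<theta> = tp A b" using insert.prems by auto
    show ?case
    proof (cases "\<theta> = tp A a")
      case True
      then show ?thesis using \<phi> by auto
    next
      case False
      then obtain \<psi> where \<psi>: "\<psi> \<in> tp A a" "\<psi> \<notin> \<theta>"
        using tp_subset_eq[of A a b] a b by (auto simp: tuples_def)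
      have "Conj \<phi> \<psi> \<in> tp A a" using \<phi>(1) \<psi>(1) by (auto simp: tp_def tp_over_def)
      moreover have conj: "Conj \<phi> \<psi> \<in> tp A c \<Longrightarrow> \<phi> \<in> tp A c \<and> \<psi> \<in> tp A c" for c
        by (auto simp: tp_def tp_over_def)
      have "\<theta>' = tp A a" if \<theta>': "\<theta>' \<in> insert \<theta> T" "Conj \<phi> \<psi> \<in> \<theta>'" for \<theta>'
      proof -
        obtain c where "\<theta>' = tp A c" using subsetD[OF insert.prems \<theta>'(1)] by (rule imageE)
        then have "\<phi> \<in> \<theta>'" "\<psi> \<in> \<theta>'" using conj \<theta>'(2) by blast+
        then show ?thesis using \<theta>'(1) \<phi>(2) \<psi>(2) by blast
      qed
      ultimately show ?thesis by blast
    qed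
  qed
  from this[OF finite_types subset_refl] show ?thesis using that by blast
qed

text \<open>Elementarity is stated as preservation only; negation gives reflection.\<close>

lemma elementary_iff:
  assumes B: "elementary_substructure B A" and "parameters \<phi> = {}" "e ` free_vars \<phi> \<subseteq> univ B"
  shows "sat B e \<phi> \<longleftrightarrow> sat A e \<phi>"
proof -
  have *: "sat B e \<psi> \<Longrightarrow> sat A e \<psi>" if "parameters \<psi> = {}" "e ` free_vars \<psi> \<subseteq> univ B" for \<psi>
    using B that unfolding elementary_substructure_def by blast
  from *[of \<phi>] *[of "Neg \<phi>"] show ?thesis using assms by auto
qed

lemma elementary_subset: "elementary_substructure B A \<Longrightarrow> univ B \<subseteq> D"
  by (auto simp: elementary_substructure_def substructure_def)

text \<open>The formula that isolates the type of \<open>(a, c)\<close>, quantified existentially in its last variable,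
  passes from \<open>a\<close> to \<open>b\<close> because the types agree, and from \<open>A\<close> to \<open>B\<close> by elementarity; a witness in
  \<open>B\<close> is the required element.\<close>

lemma elementary_extend:
  assumes B: "elementary_substructure B A" and a: "a \<in> lists D" and c: "c \<in> D"
    and b: "b \<in> lists (univ B)" and eq: "tp A a = tp A b"
  shows "\<exists>d\<in>univ B. tp A (a @ [c]) = tp A (b @ [d])"
proof -
  define n where "n = length a"
  have len: "length b = n" using tp_length[OF eq] by (simp add: n_def)
  have ac: "a @ [c] \<in> tuples D (Suc n)" using a c by (auto simp: tuples_def n_def)
  obtain \<phi> where \<phi>: "\<phi> \<in> tp A (a @ [c])"
    "\<And>b. b \<in> tuples D (Suc n) \<Longrightarrow> \<phi> \<in> tp A b \<Longrightarrow> tp A b = tp A (a @ [c])"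
    using isolating_formula[OF ac] by blast
  have fv: "free_vars \<phi> \<subseteq> {..<Suc n}" "parameters \<phi> = {}"
    using \<phi>(1) by (auto simp: tp_def tp_over_def n_def)
  have snoc: "sat M ((!) (z @ [x])) \<phi> \<longleftrightarrow> sat M (((!) z)(n := x)) \<phi>" if "length z = n" for z x M
    by (rule sat_cong) (use fv that in \<open>auto simp: nth_append\<close>)
  have "Exists n \<phi> \<in> tp A a"
    using \<phi>(1) fv snoc[of a A c] c by (auto simp: tp_def tp_over_def n_def)
  then have "Exists n \<phi> \<in> tp A b" using eq by simp
  then have "sat A ((!) b) (Exists n \<phi>)" unfolding tp_def tp_over_def by blast
  moreover have bB: "b ! i \<in> univ B" if "i < n" for i
    using b len that by (auto simp: in_lists_conv_set)
  have "(!) b ` free_vars (Exists n \<phi>) \<subseteq> univ B"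
    using fv bB by (force simp: less_Suc_eq)
  ultimately have "sat B ((!) b) (Exists n \<phi>)"
    using elementary_iff[OF B, of "Exists n \<phi>" "(!) b"] fv by simp
  then obtain d where d: "d \<in> univ B" "sat B (((!) b)(n := d)) \<phi>" by auto
  have "(((!) b)(n := d)) ` free_vars \<phi> \<subseteq> univ B"
    using fv bB d by (force simp: less_Suc_eq)
  then have "sat A (((!) b)(n := d)) \<phi>" using elementary_iff[OF B fv(2)] d(2) by simp
  then have "\<phi> \<in> tp A (b @ [d])" using snoc[OF len] fv len by (auto simp: tp_def tp_over_def)
  moreover have "b @ [d] \<in> tuples D (Suc n)"
    using b d elementary_subset[OF B] len by (auto simp: tuples_def)
  ultimately show ?thesis using \<phi>(2) d by metis
qed

lemma elementary_realizes:
  assumes B: "elementary_substructure B A" and a: "a \<in> lists D"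
  shows "\<exists>b\<in>lists (univ B). tp A b = tp A a"
  using a
proof (induction a rule: rev_induct)
  case Nil
  show ?case by (rule bexI[of _ "[]"]) simp_all
next
  case (snoc c a)
  have ac: "a \<in> lists D" "c \<in> D" using snoc.prems by simp_all
  obtain b where b: "b \<in> lists (univ B)" "tp A a = tp A b"
    using snoc.IH[OF ac(1)] by metis
  obtain d where d: "d \<in> univ B" "tp A (a @ [c]) = tp A (b @ [d])"
    using elementary_extend[OF B ac b] by metis
  show ?case by (rule bexI[of _ "b @ [d]"]) (use b d in simp_all)
qed

end

lemma dependent_list_choice:
  assumes "P []" "\<And>bs. P bs \<Longrightarrow> \<exists>b. P (bs @ [b])"
  obtains b where "\<And>n. P (map b [0..<n])"
proof -
  have "\<exists>f. \<forall>n. (P (f n) \<and> length (f n) = n) \<and> (\<exists>b. f (Suc n) = f n @ [b])"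
  proof (rule dependent_nat_choice)
    show "\<exists>x. P x \<and> length x = 0" using assms(1) by simp
    show "\<exists>y. (P y \<and> length y = Suc n) \<and> (\<exists>b. y = x @ [b])" if "P x \<and> length x = n" for x n
      using assms(2)[of x] that by auto
  qed
  then obtain f where f: "\<And>n. P (f n)" "\<And>n. length (f n) = n"
    "\<And>n. \<exists>b. f (Suc n) = f n @ [b]" by auto
  from f(3) obtain b where b: "\<And>n. f (Suc n) = f n @ [b n]" by metis
  have "f n = map b [0..<n]" for n
  proof (induction n)
    case 0
    then show ?case using f(2)[of 0] by simp
  qed (simp add: b)
  then show ?thesis using that f(1) by metis
qed


section \<open>Limits of maps modulo automorphisms\<close>

lemma finite_subset_enum:
  assumes "countable X" "finite H" "H \<subseteq> X"
  obtains N where "\<And>n. N \<le> n \<Longrightarrow> H \<subseteq> from_nat_into X ` {..<n}"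
proof -
  obtain N where N: "to_nat_on X ` H \<subseteq> {..<N}"
    using finite_nat_iff_bounded[of "to_nat_on X ` H"] assms by auto
  have "x \<in> from_nat_into X ` {..<n}" if "N \<le> n" "x \<in> H" for x n
  proof (rule image_eqI)
    show "x = from_nat_into X (to_nat_on X x)" using assms that by auto
    show "to_nat_on X x \<in> {..<n}" using N that by auto
  qed
  then show ?thesis using that by blast
qed

context fin_homogeneous
begin

text \<open>Compactness of the set of maps \<open>X \<rightarrow> D\<close> modulo composition with automorphisms on the left.
  The values of the limit are chosen one after another. The invariant \<open>P\<close> below says that the values
  chosen so far have the type of the values of \<open>q n\<close> for infinitely many \<open>n\<close>; it can be maintained
  because one more value leaves only finitely many types.\<close>

lemma limit:
  fixes q :: "nat \<Rightarrow> 'b \<Rightarrow> 'a"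
  assumes X: "countable X" and q: "\<And>n. q n \<in> X \<rightarrow> D"
  shows "\<exists>p\<in>X \<rightarrow>\<^sub>E D. \<forall>H m. finite H \<longrightarrow> H \<subseteq> X \<longrightarrow>
    (\<exists>n\<ge>m. \<forall>xs\<in>lists H. tp A (map p xs) = tp A (map (q n) xs))"
proof (cases "X = {}")
  case True
  then show ?thesis by (intro bexI[of _ "\<lambda>_. undefined"]) auto
next
  case False
  define d where "d = from_nat_into X"
  have d: "d i \<in> X" for i using from_nat_into[OF False] by (simp add: d_def)
  define f where "f n m = map (\<lambda>i. q n (d i)) [0..<m]" for n m
  have qd: "q n (d i) \<in> D" for n i using q[of n] d[of i] by blast
  have fD: "f n m \<in> lists D" for n m using qd by (auto simp: f_def)
  define P where "P bs \<longleftrightarrow> bs \<in> lists D \<and> infinite {n. tp A (f n (length bs)) = tp A bs}" for bs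
  have "P []" by (simp add: P_def f_def)
  moreover have "\<exists>b. P (bs @ [b])" if "P bs" for bs
  proof -
    define m where "m = length bs"
    define S where "S = {n. tp A (f n m) = tp A bs}"
    have bs: "bs \<in> lists D" "infinite S" using that by (simp_all add: P_def S_def m_def)
    have "(\<lambda>n. tp A (f n (Suc m))) ` S \<subseteq> tp A ` tuples D (Suc m)"
      using fD by (intro image_subsetI imageI) (simp add: tuples_def in_lists_iff f_def del: upt_Suc)
    then have "finite ((\<lambda>n. tp A (f n (Suc m))) ` S)" using finite_types finite_subset by blast
    from pigeonhole_infinite[OF bs(2) this] obtain a where a: "a \<in> S"
      and inf: "infinite {n \<in> S. tp A (f n (Suc m)) = tp A (f a (Suc m))}" by blast
    obtain u where u: "u \<in> G" "map u (f a m) = bs"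
      using tp_eqE[OF hom fD bs(1)] a by (auto simp: S_def)
    define b where "b = u (q a (d m))"
    have b: "b \<in> D" using Aut_in[OF u(1)] qd by (simp add: b_def)
    have "map u (f a (Suc m)) = bs @ [b]" using u(2) by (simp add: f_def b_def)
    then have "tp A (bs @ [b]) = tp A (f a (Suc m))" using tp_automorphism[OF u(1) fD] by metis
    then have "infinite {n. tp A (f n (Suc m)) = tp A (bs @ [b])}"
      using inf by (metis (mono_tags, lifting) Collect_mono_iff infinite_super)
    then show ?thesis using bs b by (intro exI[of _ b]) (simp add: P_def m_def)
  qed
  ultimately obtain b where b: "\<And>n. P (map b [0..<n])"
    using dependent_list_choice[of P] by blast
  have bD: "b i \<in> D" for i using b[of "Suc i"] by (simp add: P_def)
  define p where "p = (\<lambda>x\<in>X. b (to_nat_on X x))"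
  have "p \<in> X \<rightarrow>\<^sub>E D" using bD by (simp add: p_def)
  moreover have "\<exists>n\<ge>m. \<forall>xs\<in>lists H. tp A (map p xs) = tp A (map (q n) xs)"
    if H: "finite H" "H \<subseteq> X" for H m
  proof -
    obtain N where N: "to_nat_on X ` H \<subseteq> {..<N}"
      using finite_nat_iff_bounded[of "to_nat_on X ` H"] H by auto
    have "infinite {n. tp A (f n N) = tp A (map b [0..<N])}" using b[of N] by (simp add: P_def)
    then obtain n where n: "n \<ge> m" "tp A (f n N) = tp A (map b [0..<N])"
      unfolding infinite_nat_iff_unbounded_le by auto
    have "tp A (map p xs) = tp A (map (q n) xs)" if xs: "xs \<in> lists H" for xs
    proof -
      define "is" where "is = map (to_nat_on X) xs"
      have "is": "set is \<subseteq> {..<length (f n N)}" using xs N by (auto simp: is_def f_def)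
      have mem: "x \<in> X" "to_nat_on X x < N" "d (to_nat_on X x) = x" if "x \<in> set xs" for x
        using that xs H N X by (auto simp: d_def)
      have "map ((!) (map b [0..<N])) is = map p xs" "map ((!) (f n N)) is = map (q n) xs"
        using mem by (auto simp: is_def p_def f_def)
      moreover have "tp A (map ((!) (f n N)) is) = tp A (map ((!) (map b [0..<N])) is)"
        by (rule tp_map[OF n(2) fD _ "is"]) (use bD in auto)
      ultimately show ?thesis by metis
    qed
    then show ?thesis using n(1) by blast
  qed
  ultimately show ?thesis by blast
qed

text \<open>The basic open neighbourhoods of a map, for the product of discrete topologies, fix its values
  on a finite set.\<close>

lemma Aut_closure_iff:
  "u \<in> Aut_closure A \<longleftrightarrow>
    u \<in> D \<rightarrow>\<^sub>E D \<and> (\<forall>F. finite F \<longrightarrow> F \<subseteq> D \<longrightarrow> (\<exists>g\<in>G. \<forall>x\<in>F. g x = u x))"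
proof
  assume u: "u \<in> Aut_closure A"
  then have uD: "u \<in> D \<rightarrow>\<^sub>E D"
    using closure_of_subset_topspace[of "product_topology (\<lambda>_. discrete_topology D) D" G]
    by (auto simp: Aut_closure_def)
  have "\<exists>g\<in>G. \<forall>x\<in>F. g x = u x" if F: "finite F" "F \<subseteq> D" for F
  proof -
    define T where "T = Pi\<^sub>E D (\<lambda>i. if i \<in> F then {u i} else D)"
    have "finite {i \<in> D. (if i \<in> F then {u i} else D) \<noteq> D}"
      by (rule finite_subset[OF _ F(1)]) (auto split: if_splits)
    then have "openin (product_topology (\<lambda>_. discrete_topology D) D) T"
      unfolding T_def openin_PiE_gen using uD F by (auto split: if_splits)
    moreover have "u \<in> T" using uD by (auto simp: T_def)
    ultimately obtain g where "g \<in> G" "g \<in> T"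
      using u unfolding Aut_closure_def in_closure_of by blast
    then show ?thesis using F by (intro bexI[of _ g]) (force simp: T_def PiE_iff)+
  qed
  then show "u \<in> D \<rightarrow>\<^sub>E D \<and> (\<forall>F. finite F \<longrightarrow> F \<subseteq> D \<longrightarrow> (\<exists>g\<in>G. \<forall>x\<in>F. g x = u x))"
    using uD by blast
next
  assume u: "u \<in> D \<rightarrow>\<^sub>E D \<and> (\<forall>F. finite F \<longrightarrow> F \<subseteq> D \<longrightarrow> (\<exists>g\<in>G. \<forall>x\<in>F. g x = u x))"
  have "\<exists>g. g \<in> G \<and> g \<in> T" if T: "u \<in> T" "openin (product_topology (\<lambda>_. discrete_topology D) D) T" for T
  proof -
    obtain U where U: "finite {i\<in>D. U i \<noteq> D}" "u \<in> Pi\<^sub>E D U" "Pi\<^sub>E D U \<subseteq> T"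
      using T unfolding openin_product_topology_alt topspace_discrete_topology by blast
    obtain g where g: "g \<in> G" "\<forall>x\<in>{i\<in>D. U i \<noteq> D}. g x = u x"
      using u[THEN conjunct2, rule_format, OF U(1)] by auto
    have "g x \<in> U x" if "x \<in> D" for x
      using g U(2) that Aut_in[OF g(1) that] by (cases "U x = D") (auto simp: PiE_iff)
    then have "g \<in> Pi\<^sub>E D U" using AutD(1)[OF g(1)] by (auto simp: PiE_iff)
    then show ?thesis using g(1) U(3) by blast
  qed
  then show "u \<in> Aut_closure A"
    using u by (simp add: Aut_closure_def in_closure_of)
qed

lemma closure_in: "u \<in> Aut_closure A \<Longrightarrow> x \<in> D \<Longrightarrow> u x \<in> D"
  by (auto simp: Aut_closure_iff)

lemma Aut_subset_closure: "g \<in> G \<Longrightarrow> g \<in> Aut_closure A"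
  using AutD(1) by (auto simp: Aut_closure_iff)

lemma map_in_lists: "xs \<in> lists X \<Longrightarrow> (\<And>x. x \<in> X \<Longrightarrow> f x \<in> Y) \<Longrightarrow> map f xs \<in> lists Y"
  by auto

lemma tp_closure:
  assumes u: "u \<in> Aut_closure A" and a: "a \<in> lists D"
  shows "tp A (map u a) = tp A a"
proof -
  have "finite (set a)" "set a \<subseteq> D" using a by auto
  then obtain g where g: "g \<in> G" "\<forall>x\<in>set a. g x = u x"
    using u unfolding Aut_closure_iff by blast
  then have "map u a = map g a" by auto
  then show ?thesis using tp_automorphism[OF g(1) a] by metis
qed

lemma closureI:
  assumes u: "u \<in> D \<rightarrow>\<^sub>E D" and tp: "\<And>a. a \<in> lists D \<Longrightarrow> tp A (map u a) = tp A a"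
  shows "u \<in> Aut_closure A"
proof -
  have "\<exists>g\<in>G. \<forall>x\<in>F. g x = u x" if F: "finite F" "F \<subseteq> D" for F
  proof -
    obtain a where a: "set a = F" using finite_list[OF F(1)] by blast
    have aD: "a \<in> lists D" "map u a \<in> lists D"
      using a F u by (auto simp: subset_iff Pi_iff PiE_iff)
    obtain g where "g \<in> G" "map g a = map u a"
      using tp_eqE[OF hom aD tp[OF aD(1), symmetric]] by blast
    then show ?thesis using a by (metis map_eq_conv)
  qed
  then show ?thesis using u by (simp add: Aut_closure_iff)
qed

text \<open>Repeated extension by one point maps an enumeration of \<open>A\<close> to a sequence in \<open>B\<close> of the same
  type, and type-preserving self-maps of \<open>A\<close> are limits of automorphisms.\<close>

lemma elementary_embedding:
  assumes B: "elementary_substructure B A"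
  shows "\<exists>u\<in>Aut_closure A. u ` D \<subseteq> univ B"
proof (cases "D = {}")
  case True
  then show ?thesis using Aut_subset_closure[OF Aut_id] by auto
next
  case False
  define d where "d = from_nat_into D"
  have d: "d i \<in> D" for i using from_nat_into[OF False] by (simp add: d_def)
  define P where "P bs \<longleftrightarrow> bs \<in> lists (univ B) \<and> tp A (map d [0..<length bs]) = tp A bs" for bs
  have "P []" by (simp add: P_def)
  moreover have "\<exists>b. P (bs @ [b])" if "P bs" for bs
  proof -
    have "map d [0..<length bs] \<in> lists D" using d by auto
    from elementary_extend[OF B this, of "d (length bs)" bs] d that
    obtain b where "b \<in> univ B" "tp A (map d [0..<length bs] @ [d (length bs)]) = tp A (bs @ [b])"
      by (auto simp: P_def)
    then show ?thesis using that by (intro exI[of _ b]) (simp add: P_def)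
  qed
  ultimately obtain b where b: "\<And>n. P (map b [0..<n])"
    using dependent_list_choice[of P] by blast
  have bB: "b i \<in> univ B" for i using b[of "Suc i"] by (simp add: P_def)
  have bD: "b i \<in> D" for i using bB elementary_subset[OF B] by blast
  define u where "u = (\<lambda>x\<in>D. b (to_nat_on D x))"
  have "u \<in> Aut_closure A"
  proof (rule closureI)
    show "u \<in> D \<rightarrow>\<^sub>E D" using bD by (simp add: u_def)
    fix a assume a: "a \<in> lists D"
    obtain N where N: "to_nat_on D ` set a \<subseteq> {..<N}"
      using finite_nat_iff_bounded[of "to_nat_on D ` set a"] by auto
    have eq: "tp A (map d [0..<N]) = tp A (map b [0..<N])" using b[of N] by (simp add: P_def)
    define "is" where "is = map (to_nat_on D) a"
    have "is": "set is \<subseteq> {..<length (map d [0..<N])}" using N by (auto simp: is_def)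
    have mem: "x \<in> D" "to_nat_on D x < N" "d (to_nat_on D x) = x" if "x \<in> set a" for x
      using that a N countable by (auto simp: d_def)
    have "map ((!) (map b [0..<N])) is = map u a"
      using mem by (auto simp: is_def u_def)
    moreover have "map ((!) (map d [0..<N])) is = a"
      using mem by (auto simp: is_def intro!: map_idI)
    moreover have "tp A (map ((!) (map d [0..<N])) is) = tp A (map ((!) (map b [0..<N])) is)"
      by (rule tp_map[OF eq _ _ "is"]) (use bD d in auto)
    ultimately show "tp A (map u a) = tp A a" by metis
  qed
  moreover have "u ` D \<subseteq> univ B" using bB by (auto simp: u_def)
  ultimately show ?thesis by blast
qed

text \<open>On finite sets \<open>q\<close> is the composition of \<open>p\<close> with an automorphism \<open>u n\<close>, but the \<open>u n\<close> need not
  converge to a map of \<open>D\<close>. Up to automorphisms the pairs \<open>(u n, id)\<close>, as maps from two copies of \<open>D\<close>,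
  do have a limit \<open>(e, e')\<close>, and an equality between values of the two components survives in it.\<close>

lemma amalgamate:
  fixes p q :: "'b \<Rightarrow> 'a"
  assumes X: "countable X" and p: "p \<in> X \<rightarrow> D" and q: "q \<in> X \<rightarrow> D"
    and pq: "\<And>xs. xs \<in> lists X \<Longrightarrow> tp A (map p xs) = tp A (map q xs)"
  shows "\<exists>e\<in>Aut_closure A. \<exists>e'\<in>Aut_closure A. \<forall>x\<in>X. e (p x) = e' (q x)"
proof -
  have "\<exists>u\<in>G. \<forall>x\<in>H. u (p x) = q x" if H: "finite H" "H \<subseteq> X" for H
  proof -
    obtain xs where xs: "set xs = H" using finite_list[OF H(1)] by blast
    have "map p xs \<in> lists D" "map q xs \<in> lists D" "xs \<in> lists X" using xs H p q by (auto simp: subset_iff Pi_iff)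
    then obtain u where "u \<in> G" "map u (map p xs) = map q xs"
      using tp_eqE[OF hom _ _ pq] by metis
    then show ?thesis using xs by auto
  qed
  moreover have "finite (from_nat_into X ` {..<n} \<inter> X)" for n :: nat by simp
  ultimately have "\<forall>n. \<exists>u\<in>G. \<forall>x\<in>from_nat_into X ` {..<n} \<inter> X. u (p x) = q x" by blast
  then obtain u where u: "\<And>n. u n \<in> G"
    "\<And>n x. x \<in> from_nat_into X ` {..<n} \<inter> X \<Longrightarrow> u n (p x) = q x" by metis
  define w where "w n = case_sum (u n) (\<lambda>x. x)" for n
  have "w n \<in> D <+> D \<rightarrow> D" for n using Aut_in[OF u(1)] by (auto simp: w_def)
  moreover have "countable (D <+> D)" using countable by simp
  ultimately obtain E where E: "E \<in> (D <+> D) \<rightarrow>\<^sub>E D"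
    and lim: "\<And>H m. finite H \<Longrightarrow> H \<subseteq> D <+> D \<Longrightarrow>
      \<exists>n\<ge>m. \<forall>xs\<in>lists H. tp A (map E xs) = tp A (map (w n) xs)"
    using limit[of "D <+> D" w] by blast
  define e where "e = (\<lambda>x\<in>D. E (Inl x))"
  define e' where "e' = (\<lambda>x\<in>D. E (Inr x))"
  have "e \<in> Aut_closure A"
  proof (rule closureI)
    show "e \<in> D \<rightarrow>\<^sub>E D" using E by (auto simp: e_def)
    fix a assume a: "a \<in> lists D"
    have "Inl ` set a \<subseteq> D <+> D" using a by auto
    then obtain n where "\<forall>xs\<in>lists (Inl ` set a). tp A (map E xs) = tp A (map (w n) xs)"
      using lim[of "Inl ` set a" 0] by blast
    then have "tp A (map E (map Inl a)) = tp A (map (w n) (map Inl a))" by (rule bspec) (auto simp: in_lists_iff)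
    moreover have "map E (map Inl a) = map e a" "map (w n) (map Inl a) = map (u n) a"
      using a by (auto simp: e_def w_def)
    ultimately show "tp A (map e a) = tp A a" using tp_automorphism[OF u(1) a] by metis
  qed
  moreover have "e' \<in> Aut_closure A"
  proof (rule closureI)
    show "e' \<in> D \<rightarrow>\<^sub>E D" using E by (auto simp: e'_def)
    fix a assume a: "a \<in> lists D"
    have "Inr ` set a \<subseteq> D <+> D" using a by auto
    then obtain n where "\<forall>xs\<in>lists (Inr ` set a). tp A (map E xs) = tp A (map (w n) xs)"
      using lim[of "Inr ` set a" 0] by blast
    then have "tp A (map E (map Inr a)) = tp A (map (w n) (map Inr a))" by (rule bspec) (auto simp: in_lists_iff)
    moreover have "map E (map Inr a) = map e' a" "map (w n) (map Inr a) = a"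
      using a by (auto simp: e'_def w_def intro!: map_idI)
    ultimately show "tp A (map e' a) = tp A a" by metis
  qed
  moreover have "e (p x) = e' (q x)" if x: "x \<in> X" for x
  proof -
    have pqD: "p x \<in> D" "q x \<in> D" using x p q by auto
    obtain N where N: "\<And>n. N \<le> n \<Longrightarrow> {x} \<subseteq> from_nat_into X ` {..<n}"
      using finite_subset_enum[OF X, of "{x}"] x by blast
    obtain n where n: "n \<ge> N"
      "\<forall>xs\<in>lists {Inl (p x), Inr (q x)}. tp A (map E xs) = tp A (map (w n) xs)"
      using lim[of "{Inl (p x), Inr (q x)}" N] pqD by blast
    have "tp A (map E [Inl (p x), Inr (q x)]) = tp A (map (w n) [Inl (p x), Inr (q x)])"
      using n(2) by (rule bspec) (auto simp: in_lists_iff)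
    moreover have "map (w n) [Inl (p x), Inr (q x)] = [q x, q x]"
      using u(2)[of x n] N[OF n(1)] x by (simp add: w_def)
    moreover have "map E [Inl (p x), Inr (q x)] = [e (p x), e' (q x)]"
      using pqD by (simp add: e_def e'_def)
    ultimately have "tp A [e (p x), e' (q x)] = tp A [q x, q x]" by simp
    then show ?thesis
      using tp_eq_iff[of 0 "[e (p x), e' (q x)]" 1 A] tp_eq_iff[of 0 "[q x, q x]" 1 A] by simp
  qed
  ultimately show ?thesis by blast
qed

section \<open>Independence\<close>

lemma tp_append_swap:
  assumes "tp A (a @ b) = tp A (a' @ b')" "a @ b \<in> lists D" "a' @ b' \<in> lists D"
    and len: "length a = length a'"
  shows "tp A (b @ a) = tp A (b' @ a')"
proof -
  obtain g where g: "g \<in> G" "map g (a @ b) = a' @ b'" using tp_eqE[OF hom assms(2,3,1)] by blast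
  then have "map g (b @ a) = b' @ a'" using len by (auto simp: append_eq_append_conv)
  moreover have "b @ a \<in> lists D" using assms(2) by auto
  ultimately show ?thesis using tp_automorphism[OF g(1)] by metis
qed

text \<open>Independence concerns formulas with parameters in \<open>y\<close>. By homogeneity it suffices to compare
  atomic formulas, where a variable can be replaced by a parameter without care for bound variables.\<close>

lemma independent_append:
  assumes ind: "independent_from A X Y" and XY: "X \<subseteq> D" "Y \<subseteq> D"
    and x: "x \<in> lists X" "x' \<in> lists X" "tp A x = tp A x'" and y: "y \<in> lists Y"
  shows "tp A (x @ y) = tp A (x' @ y)"
proof -
  define n where "n = length x"
  have len: "length x' = n" using tp_length[OF x(3)] by (simp add: n_def)
  have tpo: "tp_over A x Y = tp_over A x' Y"
  proof (rule ind[unfolded independent_from_def, rule_format])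
    show "x \<in> tuples X n" "x' \<in> tuples X n"
      using x len by (auto simp: tuples_def n_def)
  qed (rule x(3))
  define t where "t i = (if i < n then Var i else Par (y ! (i - n)))" for i
  have val: "trm_val ((!) z) (t i) = (z @ y) ! i" if "length z = n" for z i
    using that by (simp add: t_def nth_append)
  have t: "trm_vars (t i) \<subseteq> {..<n}" "trm_pars (t i) \<subseteq> Y" if "i < n + length y" for i
    using that y by (auto simp: t_def in_lists_conv_set)
  have eqn: "(z @ y) ! i = (z @ y) ! j \<longleftrightarrow> Equal (t i) (t j) \<in> tp_over A z Y"
    if "length z = n" "i < n + length y" "j < n + length y" for z i j
    using that val t(1)[of i] t(1)[of j] t(2)[of i] t(2)[of j] by (auto simp: tp_over_def)
  have atom: "map ((!) (z @ y)) is \<in> rel A R \<longleftrightarrow> Atom R (map t is) \<in> tp_over A z Y"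
    if "length z = n" "set is \<subseteq> {..<n + length y}" for z "is" R
  proof -
    have "map (trm_val ((!) z)) (map t is) = map ((!) (z @ y)) is" using val that by simp
    then have "map ((!) (z @ y)) is \<in> rel A R \<longleftrightarrow> sat A ((!) z) (Atom R (map t is))"
      by (simp only: sat.simps)
    moreover have "free_vars (Atom R (map t is)) \<subseteq> {..<n}" "parameters (Atom R (map t is)) \<subseteq> Y"
      using that t by force+
    ultimately show ?thesis using that(1) by (simp add: tp_over_def del: sat.simps)
  qed
  have "\<exists>g\<in>G. map g (x @ y) = x' @ y"
  proof (rule homogeneous_extend[OF hom])
    show "x @ y \<in> lists D" "x' @ y \<in> lists D" using x y XY by auto
    show "length (x @ y) = length (x' @ y)" using len by (simp add: n_def)
  next
    fix i j assume "i < length (x @ y)" "j < length (x @ y)"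
    then show "(x @ y) ! i = (x @ y) ! j \<longleftrightarrow> (x' @ y) ! i = (x' @ y) ! j"
      using eqn[of x i j] eqn[of x' i j] len tpo by (simp add: n_def)
  next
    fix R "is" assume "set is \<subseteq> {..<length (x @ y)}"
    then show "map ((!) (x @ y)) is \<in> rel A R \<longleftrightarrow> map ((!) (x' @ y)) is \<in> rel A R"
      using atom[of x "is" R] atom[of x' "is" R] len tpo by (simp add: n_def)
  qed
  then obtain g where "g \<in> G" "map g (x @ y) = x' @ y" by blast
  moreover have "x @ y \<in> lists D" using x y XY by auto
  ultimately show ?thesis using tp_automorphism by metis
qed

lemma independent_tp:
  assumes ind: "independent_from A X Y" "independent_from A Y X" and XY: "X \<subseteq> D" "Y \<subseteq> D"
    and x: "x \<in> lists X" "x' \<in> lists X" "tp A x = tp A x'"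
    and y: "y \<in> lists Y" "y' \<in> lists Y" "tp A y = tp A y'"
  shows "tp A (x @ y) = tp A (x' @ y')"
proof -
  have "tp A (y @ x') = tp A (y' @ x')"
    by (rule independent_append[OF ind(2) XY(2,1) y x(2)])
  then have "tp A (x' @ y) = tp A (x' @ y')"
    by (rule tp_append_swap) (use x y XY tp_length[OF y(3)] in auto)
  then show ?thesis using independent_append[OF ind(1) XY x y(1)] by simp
qed

end


section \<open>Product Ramsey theorem for tuples\<close>

text \<open>Used to recognise the relations of an isomorphic copy along an injection.\<close>

lemma map_in_image_iff:
  assumes "inj_on h D" "F \<subseteq> D" "t \<in> lists F" "B \<subseteq> lists D"
  shows "map h t \<in> map h ` (B \<inter> lists F) \<longleftrightarrow> t \<in> B"
proof
  assume "map h t \<in> map h ` (B \<inter> lists F)"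
  then obtain s where s: "map h t = map h s" "s \<in> B" "s \<in> lists F" by blast
  have "inj_on h (set s \<union> set t)"
    by (rule inj_on_subset[OF assms(1)]) (use s assms in auto)
  then have "s = t" using map_inj_on[OF s(1)] by (simp add: Un_commute)
  then show "t \<in> B" using s by simp
qed (use assms in auto)

lemma Aut_compose:
  assumes "f \<in> Aut A" "g \<in> Aut A"
  shows "compose (univ A) f g \<in> Aut A"
proof -
  have m: "map (compose (univ A) f g) t = map f (map g t)" if "t \<in> lists (univ A)" for t
    using that by (auto simp: compose_def)
  have "map g t \<in> lists (univ A)" if "t \<in> lists (univ A)" for t
    using that Aut_in[OF assms(2)] by auto
  then have r: "t \<in> rel A R \<longleftrightarrow> map (compose (univ A) f g) t \<in> rel A R"
    if "t \<in> lists (univ A)" for t R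
    using m[OF that] AutD(4)[OF assms(1)] AutD(4)[OF assms(2)] that by metis
  have "bij_betw (compose (univ A) f g) (univ A) (univ A)"
    by (rule bij_betw_compose[of _ _ "univ A"])
      (use AutD[OF assms(1)] AutD[OF assms(2)] in \<open>auto simp: bij_betw_def\<close>)
  then show ?thesis
    using r by (auto simp: Aut_def isomorphisms_def embeddings_def bij_betw_def compose_def)
qed

context fin_homogeneous
begin

text \<open>The Ramsey property concerns structures on sets of natural numbers. An enumeration of \<open>D\<close>
  represents each finite subset of \<open>D\<close> by such a structure.\<close>

definition index_of :: "'a \<Rightarrow> nat" where "index_of = to_nat_on D"

definition nat_copy :: "'a set \<Rightarrow> ('r, nat) struct" where
  "nat_copy F = \<lparr>univ = index_of ` F, rel = \<lambda>R. map index_of ` (rel A R \<inter> lists F)\<rparr>"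

lemma inj_index_of: "inj_on index_of D" using countable by (simp add: index_of_def inj_on_to_nat_on)

lemma rel_subset: "rel A R \<subseteq> lists D"
  using fin_hom by (force simp: finitely_homogeneous_def is_structure_def tuples_def)

lemma univ_nat_copy: "univ (nat_copy F) = index_of ` F" by (simp add: nat_copy_def)

lemma rel_nat_copy:
  assumes "F \<subseteq> D" "t \<in> lists F"
  shows "map index_of t \<in> rel (nat_copy F) R \<longleftrightarrow> t \<in> rel A R"
  using map_in_image_iff[OF inj_index_of assms rel_subset] by (simp add: nat_copy_def)

lemma nat_copy_in_age:
  assumes "finite F" "F \<subseteq> D"
  shows "nat_copy F \<in> age \<sigma> A"
proof -
  define f where "f = (\<lambda>x\<in>index_of ` F. from_nat_into D x)"
  have f: "f (index_of x) = x" if "x \<in> F" for x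
    using that assms countable by (auto simp: f_def index_of_def)
  have inv: "map f (map index_of t) = t" if "t \<in> lists F" for t
    using that f by (auto intro!: map_idI)
  have "f \<in> embeddings (nat_copy F) A"
    unfolding embeddings_def mem_Collect_eq
  proof (intro conjI allI ballI)
    show "f \<in> univ (nat_copy F) \<rightarrow>\<^sub>E D" using f assms by (auto simp: univ_nat_copy f_def)
    show "inj_on f (univ (nat_copy F))" by (auto simp: univ_nat_copy inj_on_def f)
    fix R t assume "t \<in> lists (univ (nat_copy F))"
    then obtain s where "s \<in> lists F" "t = map index_of s" by (auto simp: univ_nat_copy lists_image)
    then show "t \<in> rel (nat_copy F) R \<longleftrightarrow> map f t \<in> rel A R"
      using rel_nat_copy[OF assms(2)] inv by metis
  qed
  moreover have "is_structure \<sigma> (nat_copy F)"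
    using rel_arity by (fastforce simp: is_structure_def nat_copy_def tuples_def)
  ultimately show ?thesis using assms by (auto simp: age_def univ_nat_copy)
qed

lemma nat_copy_embedding:
  assumes "\<alpha> \<in> G" "\<alpha> ` E \<subseteq> F" "E \<subseteq> D" "F \<subseteq> D"
  obtains f where "f \<in> embeddings (nat_copy E) (nat_copy F)" "\<And>x. x \<in> E \<Longrightarrow> f (index_of x) = index_of (\<alpha> x)"
proof -
  define f where "f = (\<lambda>x\<in>index_of ` E. index_of (\<alpha> (from_nat_into D x)))"
  have f: "f (index_of x) = index_of (\<alpha> x)" if "x \<in> E" for x
    using that assms(3) countable by (auto simp: f_def index_of_def)
  have mf: "map f (map index_of s) = map index_of (map \<alpha> s)" if "s \<in> lists E" for s
    using that f by auto
  have "f \<in> embeddings (nat_copy E) (nat_copy F)"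
    unfolding embeddings_def mem_Collect_eq
  proof (intro conjI allI ballI)
    show "f \<in> univ (nat_copy E) \<rightarrow>\<^sub>E univ (nat_copy F)"
      using f assms by (auto simp: univ_nat_copy f_def)
    have "inj_on (index_of \<circ> \<alpha>) E"
      by (rule comp_inj_on)
        (use inj_on_subset[OF AutD(2)[OF assms(1)] assms(3)] inj_on_subset[OF inj_index_of] assms in auto)
    then show "inj_on f (univ (nat_copy E))" by (auto simp: univ_nat_copy inj_on_def f)
    fix R t assume "t \<in> lists (univ (nat_copy E))"
    then obtain s where s: "s \<in> lists E" "t = map index_of s" by (auto simp: univ_nat_copy lists_image)
    have "map \<alpha> s \<in> lists F" "s \<in> lists D" using s assms by (auto simp: image_subset_iff)
    then show "t \<in> rel (nat_copy E) R \<longleftrightarrow> map f t \<in> rel (nat_copy F) R"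
      using rel_nat_copy[OF assms(3) s(1)] rel_nat_copy[OF assms(4)] mf[OF s(1)] s(2) AutD(4)[OF assms(1)]
      by metis
  qed
  then show ?thesis using f that by blast
qed

end

locale ramsey_structure = fin_homogeneous \<sigma> A
  for \<sigma> :: "'r signature" and A :: "('r, 'a) struct" +
  assumes ramsey: "ramsey \<sigma> A"
begin

text \<open>The Ramsey property inside \<open>A\<close>: embeddings of the structure induced on \<open>x\<close> correspond to the
  tuples in the orbit of \<open>x\<close>, and by homogeneity an embedding of \<open>F\<close> into the Ramsey witness, which
  itself sits in \<open>A\<close>, is the restriction of an automorphism.\<close>

lemma orbit_ramsey:
  fixes S :: "'c set"
  assumes x: "x \<in> lists D" and F: "finite F" "F \<subseteq> D" and S: "finite S"
  shows "\<exists>F'. finite F' \<and> F' \<subseteq> D \<and> (\<forall>\<chi>. (\<forall>y. \<chi> y \<in> S) \<longrightarrow>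
    (\<exists>\<alpha>\<in>G. \<alpha> ` F \<subseteq> F' \<and> (\<exists>c. \<forall>y\<in>lists F. tp A y = tp A x \<longrightarrow> \<chi> (map \<alpha> y) = c)))"
proof -
  have xD: "set x \<subseteq> D" using x by auto
  obtain Z where Z: "Z \<in> age \<sigma> A" "arrows Z (nat_copy F) (nat_copy (set x)) (card S)"
    using ramsey nat_copy_in_age[OF F] nat_copy_in_age[OF _ xD] unfolding ramsey_def by blast
  obtain z where z: "z \<in> embeddings Z A" using Z(1) by (auto simp: age_def)
  obtain h where h: "bij_betw h {1..card S} S" using ex_bij_betw_nat_finite_1[OF S] by blast
  define b where "b = inv_into {1..card S} h"
  have b: "b s \<in> {1..card S}" "h (b s) = s" if "s \<in> S" for s
    using that h by (auto simp: b_def bij_betw_def inv_into_into f_inv_into_f simp del: atLeastAtMost_iff)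
  define F' where "F' = z ` univ Z"
  have "\<exists>\<alpha>\<in>G. \<alpha> ` F \<subseteq> F' \<and> (\<exists>c. \<forall>y\<in>lists F. tp A y = tp A x \<longrightarrow> \<chi> (map \<alpha> y) = c)"
    if \<chi>: "\<And>y. \<chi> y \<in> S" for \<chi>
  proof -
    define \<kappa> where "\<kappa> e = b (\<chi> (map z (map e (map index_of x))))" for e
    have "\<kappa> \<in> embeddings (nat_copy (set x)) Z \<rightarrow> {1..card S}"
      using b(1)[OF \<chi>] by (auto simp: \<kappa>_def simp del: atLeastAtMost_iff)
    then obtain e c where e: "e \<in> embeddings (nat_copy F) Z"
      and c: "\<And>f. f \<in> embeddings (nat_copy (set x)) (nat_copy F) \<Longrightarrow> \<kappa> (compose (index_of ` set x) e f) = c"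
      using Z(2) unfolding arrows_def univ_nat_copy by blast
    define \<beta> where "\<beta> = (\<lambda>x. z (e (index_of x)))"
    have e_in: "e (index_of y) \<in> univ Z" if "y \<in> F" for y
      using e that by (auto simp: embeddings_def univ_nat_copy)
    have \<beta>F: "\<beta> y \<in> F'" if "y \<in> F" for y using e_in[OF that] by (simp add: \<beta>_def F'_def)
    have zD: "z y \<in> D" if "y \<in> univ Z" for y using z that by (auto simp: embeddings_def)
    have inj\<beta>: "inj_on \<beta> F"
    proof (rule inj_onI)
      fix y y' assume y: "y \<in> F" "y' \<in> F" "\<beta> y = \<beta> y'"
      then have "e (index_of y) = e (index_of y')"
        using z e_in[OF y(1)] e_in[OF y(2)] by (auto simp: embeddings_def \<beta>_def dest: inj_onD)
      then have "index_of y = index_of y'"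
        using e y by (auto simp: embeddings_def univ_nat_copy dest: inj_onD)
      then show "y = y'" using inj_index_of F y by (auto dest: inj_onD)
    qed
    have rel\<beta>: "t \<in> rel A R \<longleftrightarrow> map \<beta> t \<in> rel A R" if t: "t \<in> lists F" for t R
    proof -
      have "map index_of t \<in> lists (univ (nat_copy F))" using t by (auto simp: univ_nat_copy)
      then have 1: "map index_of t \<in> rel (nat_copy F) R \<longleftrightarrow> map e (map index_of t) \<in> rel Z R"
        using e by (simp add: embeddings_def)
      have "map e (map index_of t) \<in> lists (univ Z)" using t e_in by auto
      then have 2: "map e (map index_of t) \<in> rel Z R \<longleftrightarrow> map z (map e (map index_of t)) \<in> rel A R"
        using z by (simp add: embeddings_def)
      have "map z (map e (map index_of t)) = map \<beta> t" by (simp add: \<beta>_def)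
      then show ?thesis using 1 2 rel_nat_copy[OF F(2) t] by metis
    qed
    obtain l where l: "set l = F" using finite_list[OF F(1)] by blast
    have "\<exists>\<alpha>\<in>G. map \<alpha> l = map \<beta> l"
    proof (rule homogeneous_extend[OF hom])
      show "l \<in> lists D" using l F by auto
      show "map \<beta> l \<in> lists D" using l e_in zD by (auto simp: \<beta>_def)
      show "length l = length (map \<beta> l)" by simp
      show "l ! i = l ! j \<longleftrightarrow> map \<beta> l ! i = map \<beta> l ! j" if "i < length l" "j < length l" for i j
        using that l inj\<beta> by (auto dest: inj_onD)
      fix R "is" assume "is": "set is \<subseteq> {..<length l}"
      then have "map ((!) (map \<beta> l)) is = map \<beta> (map ((!) l) is)" by auto
      moreover have "map ((!) l) is \<in> lists F"
        using "is" l by (auto simp: in_lists_iff subset_iff)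
      ultimately show "map ((!) l) is \<in> rel A R \<longleftrightarrow> map ((!) (map \<beta> l)) is \<in> rel A R"
        using rel\<beta> by metis
    qed
    then obtain \<alpha> where \<alpha>: "\<alpha> \<in> G" "\<And>y. y \<in> F \<Longrightarrow> \<alpha> y = \<beta> y" using l by auto
    have "\<chi> (map \<alpha> y) = h c" if y: "y \<in> lists F" "tp A y = tp A x" for y
    proof -
      have yD: "y \<in> lists D" using y F by auto
      obtain g where g: "g \<in> G" "map g x = y" using tp_eqE[OF hom x yD y(2)[symmetric]] by blast
      have "g ` set x \<subseteq> F" using g y by auto
      then obtain f where f: "f \<in> embeddings (nat_copy (set x)) (nat_copy F)"
        "\<And>v. v \<in> set x \<Longrightarrow> f (index_of v) = index_of (g v)"
        using nat_copy_embedding[OF g(1) _ xD F(2)] by blast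
      have "map (compose (index_of ` set x) e f) (map index_of x) = map e (map index_of y)"
        using f(2) g(2) by (auto simp: compose_def)
      then have "map z (map (compose (index_of ` set x) e f) (map index_of x)) = map \<beta> y"
        by (simp add: \<beta>_def)
      moreover have "map \<beta> y = map \<alpha> y" using \<alpha>(2) y by auto
      ultimately have "b (\<chi> (map \<alpha> y)) = c" using c[OF f(1)] by (simp only: \<kappa>_def)
      then show ?thesis using b(2)[OF \<chi>] by metis
    qed
    moreover have "\<alpha> ` F \<subseteq> F'" using \<alpha> \<beta>F by auto
    ultimately show ?thesis using \<alpha>(1) by blast
  qed
  moreover have "finite F'" "F' \<subseteq> D" using Z(1) z by (auto simp: F'_def age_def embeddings_def)
  ultimately show ?thesis by blast
qed

definition matches :: "'a set \<Rightarrow> 'a list list \<Rightarrow> 'a list list \<Rightarrow> bool" where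
  "matches F ys xs \<longleftrightarrow> list_all2 (\<lambda>y x. y \<in> lists F \<and> tp A y = tp A x) ys xs"

lemma matches_map2:
  assumes m: "matches F ys xs" and \<alpha>: "\<alpha>s \<in> tuples G (length xs)" "\<And>\<alpha>. \<alpha> \<in> set \<alpha>s \<Longrightarrow> \<alpha> ` F \<subseteq> F'"
    and F: "F \<subseteq> D"
  shows "matches F' (map2 map \<alpha>s ys) xs"
  unfolding matches_def
proof (rule list_all2_all_nthI)
  have len: "length ys = length xs" using m by (simp add: matches_def list_all2_lengthD)
  then show "length (map2 map \<alpha>s ys) = length xs" using \<alpha> by (simp add: tuples_def)
  fix i assume "i < length (map2 map \<alpha>s ys)"
  then have i: "i < length \<alpha>s" "i < length ys" by simp_all
  have y: "ys ! i \<in> lists F" "tp A (ys ! i) = tp A (xs ! i)"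
    using list_all2_nthD[OF m[unfolded matches_def] i(2)] by blast+
  have g: "\<alpha>s ! i \<in> G" using \<alpha>(1) i by (auto simp: tuples_def)
  have "\<alpha>s ! i ` F \<subseteq> F'" using \<alpha>(2) i by simp
  then have "map (\<alpha>s ! i) (ys ! i) \<in> lists F'"
    using y(1) by (auto simp: image_subset_iff)
  moreover have "tp A (map (\<alpha>s ! i) (ys ! i)) = tp A (xs ! i)"
    using tp_automorphism[OF g] y F by (metis in_lists_iff subset_trans)
  ultimately show "map2 map \<alpha>s ys ! i \<in> lists F' \<and> tp A (map2 map \<alpha>s ys ! i) = tp A (xs ! i)"
    using i by simp
qed

text \<open>The product version follows by induction on the number of factors. Let \<open>F1\<close> be a witness for
  the tail. The colour of a tuple \<open>y\<close> in the first factor is taken to be the whole map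
  \<open>zs \<mapsto> \<chi> (y # zs)\<close> on the finite set \<open>W\<close> of tails within \<open>F1\<close>. Once this map no longer depends on
  \<open>y\<close>, the tail can be treated with one fixed \<open>y0\<close> in front.\<close>

lemma product_ramsey:
  fixes S :: "'c set"
  assumes xs: "xs \<in> lists (lists D)" and F: "finite F" "F \<subseteq> D" and S: "finite S"
  shows "\<exists>F'. finite F' \<and> F' \<subseteq> D \<and> (\<forall>\<chi>. (\<forall>ys. \<chi> ys \<in> S) \<longrightarrow>
    (\<exists>\<alpha>s\<in>tuples G (length xs). (\<forall>\<alpha>\<in>set \<alpha>s. \<alpha> ` F \<subseteq> F') \<and>
      (\<exists>c. \<forall>ys. matches F ys xs \<longrightarrow> \<chi> (map2 map \<alpha>s ys) = c)))"
  using xs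
proof (induction xs)
  case Nil
  show ?case
    by (rule exI[of _ "{}"]) (auto simp: matches_def tuples_def)
next
  case (Cons x xs)
  note x = Cons.hyps
  obtain F1 where F1: "finite F1" "F1 \<subseteq> D"
    and hom1: "\<And>\<chi>. (\<And>ys. \<chi> ys \<in> S) \<Longrightarrow> \<exists>\<alpha>s\<in>tuples G (length xs). (\<forall>\<alpha>\<in>set \<alpha>s. \<alpha> ` F \<subseteq> F1) \<and>
      (\<exists>c. \<forall>ys. matches F ys xs \<longrightarrow> \<chi> (map2 map \<alpha>s ys) = c)"
    using Cons.IH by (elim exE conjE) (rule that, assumption+, blast)
  define W where "W = {zs. matches F1 zs xs}"
  have "W \<subseteq> {zs. set zs \<subseteq> {z. set z \<subseteq> F1 \<and> length z \<le> sum_list (map length xs)} \<and>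
      length zs = length xs}"
  proof
    fix zs assume "zs \<in> W"
    then have zs: "list_all2 (\<lambda>y x. y \<in> lists F1 \<and> tp A y = tp A x) zs xs"
      by (simp add: W_def matches_def)
    note len = list_all2_lengthD[OF zs]
    have el: "set (zs ! i) \<subseteq> F1 \<and> length (zs ! i) = length (xs ! i)" if "i < length xs" for i
      using list_all2_nthD2[OF zs that] tp_length by (metis in_lists_iff)
    have "set z \<subseteq> F1 \<and> length z \<le> sum_list (map length xs)" if z: "z \<in> set zs" for z
    proof -
      obtain i where "i < length xs" "z = zs ! i" using z len by (auto simp: in_set_conv_nth)
      then show ?thesis using el[of i] member_le_sum_list[of "length (xs ! i)" "map length xs"] by auto
    qed
    then show "zs \<in> {zs. set zs \<subseteq> {z. set z \<subseteq> F1 \<and> length z \<le> sum_list (map length xs)} \<and>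
      length zs = length xs}" using len by auto
  qed
  then have finW: "finite W"
    by (rule finite_subset) (intro finite_lists_length_eq finite_lists_length_le F1)
  have finT: "finite (W \<rightarrow>\<^sub>E S)" using finW S by (intro finite_PiE) auto
  obtain F2 where F2: "finite F2" "F2 \<subseteq> D"
    and hom2: "\<And>\<chi>. (\<And>y. \<chi> y \<in> W \<rightarrow>\<^sub>E S) \<Longrightarrow>
      \<exists>\<alpha>\<in>G. \<alpha> ` F \<subseteq> F2 \<and> (\<exists>c. \<forall>y\<in>lists F. tp A y = tp A x \<longrightarrow> \<chi> (map \<alpha> y) = c)"
    using orbit_ramsey[OF x(1) F finT] by (elim exE conjE) (rule that, assumption+, blast)
  have "\<exists>\<alpha>s\<in>tuples G (length (x # xs)). (\<forall>\<alpha>\<in>set \<alpha>s. \<alpha> ` F \<subseteq> F1 \<union> F2) \<and>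
      (\<exists>c. \<forall>ys. matches F ys (x # xs) \<longrightarrow> \<chi> (map2 map \<alpha>s ys) = c)"
    if \<chi>: "\<And>ys. \<chi> ys \<in> S" for \<chi>
  proof -
    have "(\<lambda>zs\<in>W. \<chi> (y # zs)) \<in> W \<rightarrow>\<^sub>E S" for y using \<chi> by auto
    note hom2 = hom2[of "\<lambda>y. \<lambda>zs\<in>W. \<chi> (y # zs)", OF this]
    obtain \<alpha> c1 where \<alpha>: "\<alpha> \<in> G" "\<alpha> ` F \<subseteq> F2"
      and c1: "\<And>y. y \<in> lists F \<Longrightarrow> tp A y = tp A x \<Longrightarrow> (\<lambda>zs\<in>W. \<chi> (map \<alpha> y # zs)) = c1"
      using hom2 by (elim bexE exE conjE) (rule that, assumption, assumption, drule bspec, assumption, erule mp)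
    \<comment> \<open>If \<open>F\<close> contains no tuple of this type, then the claim is vacuous and \<open>y0\<close> is arbitrary.\<close>
    define y0 where "y0 = (SOME y. y \<in> lists F \<and> tp A y = tp A x)"
    obtain \<alpha>s c where \<alpha>s: "\<alpha>s \<in> tuples G (length xs)" "\<And>\<alpha>. \<alpha> \<in> set \<alpha>s \<Longrightarrow> \<alpha> ` F \<subseteq> F1"
      and c: "\<And>ys. matches F ys xs \<Longrightarrow> \<chi> (map \<alpha> y0 # map2 map \<alpha>s ys) = c"
      using hom1[of "\<lambda>zs. \<chi> (map \<alpha> y0 # zs)", OF \<chi>]
      by (elim bexE exE conjE) (rule that, assumption, erule bspec, assumption, elim allE impE)
    have "\<chi> (map2 map (\<alpha> # \<alpha>s) ys) = c" if ys: "matches F ys (x # xs)" for ys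
    proof -
      obtain y ys' where y: "ys = y # ys'" "y \<in> lists F" "tp A y = tp A x" "matches F ys' xs"
        using ys by (auto simp: matches_def list_all2_Cons2)
      have y0: "y0 \<in> lists F" "tp A y0 = tp A x"
        using someI_ex[of "\<lambda>y. y \<in> lists F \<and> tp A y = tp A x"] y(2,3) unfolding y0_def by blast+
      have "map2 map \<alpha>s ys' \<in> W" using matches_map2[OF y(4) \<alpha>s F(2)] by (simp add: W_def)
      then have "\<chi> (map \<alpha> y # map2 map \<alpha>s ys') = \<chi> (map \<alpha> y0 # map2 map \<alpha>s ys')"
        using c1[OF y(2,3)] c1[OF y0] by (metis restrict_apply')
      then show ?thesis using c[OF y(4)] y(1) by simp
    qed
    moreover have "\<alpha> # \<alpha>s \<in> tuples G (length (x # xs))" using \<alpha> \<alpha>s by (auto simp: tuples_def)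
    moreover have "\<forall>\<beta>\<in>set (\<alpha> # \<alpha>s). \<beta> ` F \<subseteq> F1 \<union> F2" using \<alpha>(2) \<alpha>s(2) by auto
    ultimately show ?thesis by blast
  qed
  moreover have "finite (F1 \<union> F2)" "F1 \<union> F2 \<subseteq> D" using F1 F2 by auto
  ultimately show ?case by blast
qed

text \<open>A set that is homogeneous for one family of types, if large enough, contains a subset that is
  homogeneous for the other families as well; \<open>matches_map2\<close> says that moving tuples does not change
  the family to which they belong.\<close>

lemma simultaneous_ramsey:
  fixes S :: "'c set"
  assumes T: "finite T" "T \<subseteq> tuples (lists D) k" and F: "finite F" "F \<subseteq> D" and S: "finite S"
  shows "\<exists>F'. finite F' \<and> F' \<subseteq> D \<and> (\<forall>\<chi>. (\<forall>ys. \<chi> ys \<in> S) \<longrightarrow>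
    (\<exists>\<alpha>s\<in>tuples G k. (\<forall>\<alpha>\<in>set \<alpha>s. \<alpha> ` F \<subseteq> F') \<and>
      (\<forall>xs\<in>T. \<exists>c. \<forall>ys. matches F ys xs \<longrightarrow> \<chi> (map2 map \<alpha>s ys) = c)))"
  using T
proof (induction T)
  case empty
  have "replicate k (\<lambda>x\<in>D. x) \<in> tuples G k" using Aut_id by (auto simp: tuples_def)
  moreover have "\<forall>\<alpha>\<in>set (replicate k (\<lambda>x\<in>D. x)). \<alpha> ` F \<subseteq> F" using F by auto
  ultimately show ?case using F by blast
next
  case (insert xs T)
  obtain F1 where F1: "finite F1" "F1 \<subseteq> D"
    and hom1: "\<And>\<chi>. (\<And>ys. \<chi> ys \<in> S) \<Longrightarrow> \<exists>\<alpha>s\<in>tuples G k. (\<forall>\<alpha>\<in>set \<alpha>s. \<alpha> ` F \<subseteq> F1) \<and>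
      (\<forall>xs\<in>T. \<exists>c. \<forall>ys. matches F ys xs \<longrightarrow> \<chi> (map2 map \<alpha>s ys) = c)"
    using insert.IH[OF subset_trans[OF subset_insertI insert.prems]] by (elim exE conjE) (rule that, assumption+, blast)
  have xs: "xs \<in> lists (lists D)" "length xs = k" using insert.prems by (auto simp: tuples_def)
  obtain F2 where F2: "finite F2" "F2 \<subseteq> D"
    and hom2: "\<And>\<chi>. (\<And>ys. \<chi> ys \<in> S) \<Longrightarrow> \<exists>\<alpha>s\<in>tuples G k. (\<forall>\<alpha>\<in>set \<alpha>s. \<alpha> ` F1 \<subseteq> F2) \<and>
      (\<exists>c. \<forall>ys. matches F1 ys xs \<longrightarrow> \<chi> (map2 map \<alpha>s ys) = c)"
    using product_ramsey[OF xs(1) F1 S] unfolding xs(2)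
    by (elim exE conjE) (rule that, assumption+, blast)
  have "\<exists>\<gamma>s\<in>tuples G k. (\<forall>\<gamma>\<in>set \<gamma>s. \<gamma> ` F \<subseteq> F2) \<and>
      (\<forall>xs\<in>insert xs T. \<exists>c. \<forall>ys. matches F ys xs \<longrightarrow> \<chi> (map2 map \<gamma>s ys) = c)"
    if \<chi>: "\<And>ys. \<chi> ys \<in> S" for \<chi>
  proof -
    obtain \<beta>s c where \<beta>s: "\<beta>s \<in> tuples G k" "\<And>\<beta>. \<beta> \<in> set \<beta>s \<Longrightarrow> \<beta> ` F1 \<subseteq> F2"
      and c: "\<And>ys. matches F1 ys xs \<Longrightarrow> \<chi> (map2 map \<beta>s ys) = c"
      using hom2[of \<chi>, OF \<chi>]
      by (elim bexE exE conjE) (rule that, assumption, erule bspec, assumption, elim allE impE)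
    obtain \<alpha>s where \<alpha>s: "\<alpha>s \<in> tuples G k" "\<And>\<alpha>. \<alpha> \<in> set \<alpha>s \<Longrightarrow> \<alpha> ` F \<subseteq> F1"
      and cT: "\<And>xs. xs \<in> T \<Longrightarrow>
        \<exists>c. \<forall>ys. matches F ys xs \<longrightarrow> \<chi> (map2 map \<beta>s (map2 map \<alpha>s ys)) = c"
      using hom1[of "\<lambda>ys. \<chi> (map2 map \<beta>s ys)", OF \<chi>]
      by (elim bexE conjE) (rule that, assumption, (erule bspec, assumption)+)
    define \<gamma>s where "\<gamma>s = map2 (compose D) \<beta>s \<alpha>s"
    have len: "length \<alpha>s = k" "length \<beta>s = k" using \<alpha>s \<beta>s by (auto simp: tuples_def)
    have nth: "\<alpha>s ! i \<in> G" "\<beta>s ! i \<in> G" if "i < k" for i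
      using \<alpha>s \<beta>s len that by (auto simp: tuples_def)
    have \<gamma>G: "\<gamma>s \<in> tuples G k"
      using nth len by (auto simp: tuples_def \<gamma>s_def in_set_conv_nth intro!: Aut_compose)
    have \<gamma>F: "\<gamma> ` F \<subseteq> F2" if \<gamma>: "\<gamma> \<in> set \<gamma>s" for \<gamma>
    proof -
      obtain i where i: "i < k" "\<gamma> = compose D (\<beta>s ! i) (\<alpha>s ! i)"
        using \<gamma> len by (auto simp: \<gamma>s_def in_set_conv_nth)
      have "\<alpha>s ! i ` F \<subseteq> F1" "\<beta>s ! i ` F1 \<subseteq> F2" using \<alpha>s(2) \<beta>s(2) i len by auto
      then show ?thesis using i(2) F by (auto simp: compose_def)
    qed
    have comp: "map2 map \<gamma>s ys = map2 map \<beta>s (map2 map \<alpha>s ys)" if "matches F ys zs" for ys zs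
    proof (rule nth_equalityI)
      fix i assume "i < length (map2 map \<gamma>s ys)"
      then have i: "i < length ys" "i < k" using len by (auto simp: \<gamma>s_def)
      then have "ys ! i \<in> lists F"
        using list_all2_nthD[OF that[unfolded matches_def] i(1)] by blast
      then have "ys ! i \<in> lists D" using F(2) by auto
      then show "map2 map \<gamma>s ys ! i = map2 map \<beta>s (map2 map \<alpha>s ys) ! i"
        using i len by (auto simp: \<gamma>s_def compose_def)
    qed (simp add: \<gamma>s_def)
    have "\<exists>c. \<forall>ys. matches F ys zs \<longrightarrow> \<chi> (map2 map \<gamma>s ys) = c" if zs: "zs \<in> insert xs T" for zs
    proof (cases "zs = xs")
      case True
      have "\<chi> (map2 map \<gamma>s ys) = c" if ys: "matches F ys xs" for ys
        using c[OF matches_map2[OF ys _ \<alpha>s(2) F(2)]] \<alpha>s(1) comp[OF ys] by (simp add: xs(2))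
      then show ?thesis using True by blast
    next
      case False
      then have "zs \<in> T" using zs by blast
      from cT[OF this] obtain c where
        "\<forall>ys. matches F ys zs \<longrightarrow> \<chi> (map2 map \<beta>s (map2 map \<alpha>s ys)) = c" ..
      then show ?thesis using comp[of _ zs] by (intro exI[of _ c]) simp
    qed
    then show ?thesis using \<gamma>G \<gamma>F by blast
  qed
  then show ?case using F2 by blast
qed

end


section \<open>Canonisation\<close>

abbreviation apply_tuple :: "('a \<Rightarrow> 'b) list \<Rightarrow> 'a list \<Rightarrow> 'b list" where
  "apply_tuple vs x \<equiv> map2 (\<lambda>v y. v y) vs x"

abbreviation column :: "nat \<Rightarrow> 'a list list \<Rightarrow> 'a list" where
  "column i xs \<equiv> map (\<lambda>t. t ! i) xs"

lemma tuplesD: "x \<in> tuples F k \<Longrightarrow> length x = k" "x \<in> tuples F k \<Longrightarrow> i < k \<Longrightarrow> x ! i \<in> F"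
  by (auto simp: tuples_def)

lemma tuplesI: "length x = k \<Longrightarrow> (\<And>i. i < k \<Longrightarrow> x ! i \<in> F) \<Longrightarrow> x \<in> tuples F k"
  by (auto simp: tuples_def in_set_conv_nth)

lemma finite_tuples: "finite F \<Longrightarrow> finite (tuples F k)"
  using finite_lists_length_eq[of F k] by (simp add: tuples_def conj_commute)

lemma tuples_mono: "F \<subseteq> F' \<Longrightarrow> tuples F k \<subseteq> tuples F' k"
  by (auto simp: tuples_def)

lemma apply_tuple_in:
  assumes "x \<in> tuples E k" "length vs = k" "\<And>i. i < k \<Longrightarrow> vs ! i ` E \<subseteq> F"
  shows "apply_tuple vs x \<in> tuples F k"
  by (rule tuplesI) (use assms tuplesD[OF assms(1)] in \<open>auto simp: image_subset_iff\<close>)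

lemma subst_unary_apply:
  "x \<in> tuples D k \<Longrightarrow> length vs = k \<Longrightarrow> subst_unary D f vs x = f (apply_tuple vs x)"
  by (simp add: subst_unary_def)

lemma subst_unary_PiE:
  assumes "f \<in> tuples D k \<rightarrow> D" "length vs = k" "\<And>i. i < k \<Longrightarrow> vs ! i ` D \<subseteq> D"
  shows "subst_unary D f vs \<in> tuples D k \<rightarrow>\<^sub>E D"
  using assms apply_tuple_in[OF _ assms(2,3)] by (auto simp: subst_unary_def)

lemma column_in: "xs \<in> lists (tuples F k) \<Longrightarrow> i < k \<Longrightarrow> column i xs \<in> lists F"
  using tuplesD(2)[of _ F k i] by auto

lemma column_apply:
  assumes "xs \<in> lists (tuples F k)" "length vs = k" "i < k"
  shows "column i (map (apply_tuple vs) xs) = map (vs ! i) (column i xs)"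
  using assms by (auto simp: tuplesD)

context fin_homogeneous
begin

text \<open>Canonicity restricted to arguments in \<open>F\<close> and to tuples of length at most \<open>N\<close>. Instead of \<open>k\<close>
  tuples of length \<open>n\<close> it uses the transposed list of \<open>n\<close> elements of \<open>F\<^sup>k\<close>, so that componentwise
  application is \<open>map\<close>.\<close>

definition canonical_on :: "nat \<Rightarrow> 'a set \<Rightarrow> nat \<Rightarrow> 'a opn \<Rightarrow> bool" where
  "canonical_on k F N p \<longleftrightarrow> (\<forall>xs\<in>lists (tuples F k). \<forall>ys\<in>lists (tuples F k).
     length xs \<le> N \<longrightarrow> (\<forall>i<k. tp A (column i xs) = tp A (column i ys)) \<longrightarrow>
     tp A (map p xs) = tp A (map p ys))"

text \<open>On finite \<open>F\<close> this is agreement up to an automorphism applied to the values.\<close>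

definition similar_on :: "nat \<Rightarrow> 'a set \<Rightarrow> 'a opn \<Rightarrow> 'a opn \<Rightarrow> bool" where
  "similar_on k F p q \<longleftrightarrow> (\<forall>xs\<in>lists (tuples F k). tp A (map p xs) = tp A (map q xs))"

lemma canonical_on_mono:
  assumes "canonical_on k F N p" "F' \<subseteq> F" "N' \<le> N"
  shows "canonical_on k F' N' p"
  unfolding canonical_on_def
proof (intro ballI impI)
  fix xs ys assume a: "xs \<in> lists (tuples F' k)" "ys \<in> lists (tuples F' k)" "length xs \<le> N'"
    "\<forall>i<k. tp A (column i xs) = tp A (column i ys)"
  have "xs \<in> lists (tuples F k)" "ys \<in> lists (tuples F k)"
    using a(1,2) tuples_mono[OF assms(2)] by auto
  then show "tp A (map p xs) = tp A (map p ys)"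
    using assms(1,3) a(3,4) unfolding canonical_on_def by (meson le_trans)
qed

lemma similar_on_mono: "similar_on k F p q \<Longrightarrow> F' \<subseteq> F \<Longrightarrow> similar_on k F' p q"
  using tuples_mono[of F' F k] unfolding similar_on_def by (meson lists_mono subsetD)

lemma similar_on_trans: "similar_on k F p q \<Longrightarrow> similar_on k F q r \<Longrightarrow> similar_on k F p r"
  unfolding similar_on_def by metis

lemma similar_on_sym: "similar_on k F p q \<Longrightarrow> similar_on k F q p"
  unfolding similar_on_def by metis

lemma similar_onI_eq: "(\<And>x. x \<in> tuples F k \<Longrightarrow> p x = q x) \<Longrightarrow> similar_on k F p q"
  unfolding similar_on_def by (metis (mono_tags, lifting) in_lists_conv_set map_eq_conv)

lemma canonical_on_similar:
  assumes "canonical_on k F N q" "similar_on k F p q"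
  shows "canonical_on k F N p"
  unfolding canonical_on_def
proof (intro ballI impI)
  fix xs ys assume a: "xs \<in> lists (tuples F k)" "ys \<in> lists (tuples F k)" "length xs \<le> N"
    "\<forall>i<k. tp A (column i xs) = tp A (column i ys)"
  have "tp A (map q xs) = tp A (map q ys)" using assms(1) a unfolding canonical_on_def by blast
  then show "tp A (map p xs) = tp A (map p ys)"
    using assms(2) a(1,2) unfolding similar_on_def by metis
qed

lemma similar_on_subst:
  assumes "similar_on k F' p q" "length vs = k" "\<And>i. i < k \<Longrightarrow> vs ! i ` F \<subseteq> F'" "F \<subseteq> D"
  shows "similar_on k F (subst_unary D p vs) (subst_unary D q vs)"
  unfolding similar_on_def
proof
  fix xs assume xs: "xs \<in> lists (tuples F k)"
  have "x \<in> tuples D k" if "x \<in> set xs" for x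
    using that xs tuples_mono[OF assms(4)] by blast
  then have m: "map (subst_unary D f vs) xs = map f (map (apply_tuple vs) xs)" for f
    using subst_unary_apply[OF _ assms(2)] by simp
  have "map (apply_tuple vs) xs \<in> lists (tuples F' k)"
    using xs apply_tuple_in[OF _ assms(2,3)] by auto
  then show "tp A (map (subst_unary D p vs) xs) = tp A (map (subst_unary D q vs) xs)"
    using assms(1) unfolding m similar_on_def by blast
qed

lemma componentwise_columns:
  assumes "\<And>t. t \<in> set xs \<Longrightarrow> length t = k"
  shows "componentwise f (length xs) (map (\<lambda>i. column i xs) [0..<k]) = map f xs"
proof (rule nth_equalityI)
  fix j assume "j < length (componentwise f (length xs) (map (\<lambda>i. column i xs) [0..<k]))"
  then have j: "j < length xs" by (simp add: componentwise_def)
  have "map (\<lambda>a. a ! j) (map (\<lambda>i. column i xs) [0..<k]) = xs ! j"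
    by (rule nth_equalityI) (use j assms in auto)
  then show "componentwise f (length xs) (map (\<lambda>i. column i xs) [0..<k]) ! j = map f xs ! j"
    using j by (simp add: componentwise_def)
qed (simp add: componentwise_def)

lemma canonical_iff:
  assumes k: "k > 0"
  shows "canonical A k f \<longleftrightarrow> (\<forall>F N. finite F \<longrightarrow> F \<subseteq> D \<longrightarrow> canonical_on k F N f)"
proof
  assume can: "canonical A k f"
  have "canonical_on k D N f" for N
    unfolding canonical_on_def
  proof (intro ballI impI)
    fix xs ys assume xs: "xs \<in> lists (tuples D k)" and ys: "ys \<in> lists (tuples D k)"
      and eq: "\<forall>i<k. tp A (column i xs) = tp A (column i ys)"
    have len: "length ys = length xs" using eq k tp_length by (metis length_map)
    let ?as = "map (\<lambda>i. column i xs) [0..<k]" and ?bs = "map (\<lambda>i. column i ys) [0..<k]"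
    have "?as \<in> tuples (tuples D (length xs)) k" "?bs \<in> tuples (tuples D (length xs)) k"
      by (rule tuplesI; use column_in[OF xs] column_in[OF ys] len
        in \<open>simp add: tuples_def in_lists_iff\<close>)+
    then have "tp A (componentwise f (length xs) ?as) = tp A (componentwise f (length xs) ?bs)"
      by (rule can[unfolded canonical_def, rule_format]) (use eq in simp)
    moreover have "componentwise f (length xs) ?as = map f xs"
      by (rule componentwise_columns) (use xs tuplesD in blast)
    moreover have "componentwise f (length ys) ?bs = map f ys"
      by (rule componentwise_columns) (use ys tuplesD in blast)
    ultimately show "tp A (map f xs) = tp A (map f ys)" unfolding len by (simp only:)
  qed
  then show "\<forall>F N. finite F \<longrightarrow> F \<subseteq> D \<longrightarrow> canonical_on k F N f"
    using canonical_on_mono by blast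
next
  assume can: "\<forall>F N. finite F \<longrightarrow> F \<subseteq> D \<longrightarrow> canonical_on k F N f"
  show "canonical A k f"
    unfolding canonical_def
  proof (intro allI ballI impI)
    fix n as bs assume as: "as \<in> tuples (tuples D n) k" and bs: "bs \<in> tuples (tuples D n) k"
      and eq: "\<forall>i<k. tp A (as ! i) = tp A (bs ! i)"
    define row where "row cs = map (\<lambda>j. map (\<lambda>a. a ! j) cs) [0..<n]" for cs :: "'a list list"
    define F where "F = \<Union> (set ` (set as \<union> set bs))"
    have F: "finite F" "F \<subseteq> D" using as bs by (auto simp: F_def tuples_def)
    have row: "row cs \<in> lists (tuples F k)" "length (row cs) = n" "\<And>i. i < k \<Longrightarrow> column i (row cs) = cs ! i"
      "map f (row cs) = componentwise f n cs"
      if cs: "cs \<in> tuples (tuples D n) k" "set cs \<subseteq> set as \<union> set bs" for cs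
    proof -
      have el: "length c = n \<and> set c \<subseteq> F" if "c \<in> set cs" for c
        using that cs by (force simp: F_def tuples_def)
      have len: "length cs = k" using cs by (simp add: tuples_def)
      have "map (\<lambda>a. a ! j) cs \<in> tuples F k" if j: "j < n" for j
        using el len j by (auto simp: tuples_def subset_iff)
      then show "row cs \<in> lists (tuples F k)" by (auto simp: row_def)
      show "length (row cs) = n" by (simp add: row_def)
      show "column i (row cs) = cs ! i" if "i < k" for i
        by (rule nth_equalityI) (use el len that in \<open>auto simp: row_def\<close>)
      show "map f (row cs) = componentwise f n cs" by (simp add: row_def componentwise_def)
    qed
    note a = row[OF as Un_upper1] and b = row[OF bs Un_upper2]
    have "canonical_on k F n f" using can F by blast
    moreover have "\<forall>i<k. tp A (column i (row as)) = tp A (column i (row bs))"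
      using eq a(3) b(3) by simp
    ultimately have "tp A (map f (row as)) = tp A (map f (row bs))"
      using a(1,2) b(1) unfolding canonical_on_def by blast
    then show "tp A (componentwise f n as) = tp A (componentwise f n bs)"
      unfolding a(4) b(4) .
  qed
qed

lemma canonical_tp:
  assumes "canonical A k f" "k > 0" "xs \<in> lists (tuples D k)" "ys \<in> lists (tuples D k)"
    "\<And>i. i < k \<Longrightarrow> tp A (column i xs) = tp A (column i ys)"
  shows "tp A (map f xs) = tp A (map f ys)"
proof -
  define F where "F = \<Union> (set ` (set xs \<union> set ys))"
  have "finite F" "F \<subseteq> D" using assms(3,4) by (auto simp: F_def tuples_def)
  then have "canonical_on k F (length xs) f" using canonical_iff[OF assms(2)] assms(1) by blast
  moreover have "xs \<in> lists (tuples F k)" "ys \<in> lists (tuples F k)"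
    using assms(3,4) by (auto simp: F_def tuples_def)
  ultimately show ?thesis using assms(5) unfolding canonical_on_def by blast
qed

lemma canonical_limit:
  assumes "k > 0" "\<And>F N. finite F \<Longrightarrow> F \<subseteq> D \<Longrightarrow> \<exists>q. similar_on k F p q \<and> canonical_on k F N q"
  shows "canonical A k p"
  unfolding canonical_iff[OF assms(1)] using assms(2) canonical_on_similar by blast

lemma canonical_similar:
  assumes "k > 0" "canonical A k q" "similar_on k D p q"
  shows "canonical A k p"
  using canonical_limit[OF assms(1), of p] assms canonical_iff[OF assms(1)] similar_on_mono by blast

text \<open>The arguments \<open>vs\<close> do not change types, so they do not change the type of the value of a
  canonical operation.\<close>

lemma canonical_subst_similar:
  assumes "k > 0" "canonical A k g" and vs: "vs \<in> tuples (Aut_closure A) k"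
  shows "similar_on k D (subst_unary D g vs) g"
  unfolding similar_on_def
proof
  fix xs assume xs: "xs \<in> lists (tuples D k)"
  have v: "length vs = k" "\<And>i. i < k \<Longrightarrow> vs ! i \<in> Aut_closure A" using tuplesD[OF vs] by auto
  have in': "map (apply_tuple vs) xs \<in> lists (tuples D k)"
  proof -
    have "vs ! i ` D \<subseteq> D" if "i < k" for i using closure_in[OF v(2)[OF that]] by blast
    then have "apply_tuple vs x \<in> tuples D k" if "x \<in> set xs" for x
      using apply_tuple_in[OF _ v(1)] that xs by blast
    then show ?thesis by auto
  qed
  have "map (subst_unary D g vs) xs = map g (map (apply_tuple vs) xs)"
    using xs v(1) by (auto simp: subst_unary_apply)
  moreover have "tp A (map g (map (apply_tuple vs) xs)) = tp A (map g xs)"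
    by (rule canonical_tp[OF assms(2,1) in' xs], unfold column_apply[OF xs v(1)])
      (use tp_closure[OF v(2)] column_in[OF xs] in blast)
  ultimately show "tp A (map (subst_unary D g vs) xs) = tp A (map g xs)" by metis
qed

lemma canonical_minor:
  assumes "canonical A n f" "n > 0" "k > 0" "\<alpha> \<in> {..<n} \<rightarrow> {..<k}"
  shows "canonical A k (minor D n k \<alpha> f)"
  unfolding canonical_iff[OF assms(3)] canonical_on_def
proof (intro allI impI ballI)
  fix F N xs ys assume F: "F \<subseteq> D" and xs: "xs \<in> lists (tuples F k)" and ys: "ys \<in> lists (tuples F k)"
    and eq: "\<forall>i<k. tp A (column i xs) = tp A (column i ys)"
  let ?m = "\<lambda>x. map (\<lambda>i. x ! \<alpha> i) [0..<n]"
  have *: "map (minor D n k \<alpha> f) zs = map f (map ?m zs) \<and> map ?m zs \<in> lists (tuples D n)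
      \<and> (\<forall>i<n. column i (map ?m zs) = column (\<alpha> i) zs)" if zs: "zs \<in> lists (tuples F k)" for zs
  proof -
    have zD: "z \<in> tuples D k" if "z \<in> set zs" for z using that zs tuples_mono[OF F] by auto
    have "\<alpha> i < k" if "i < n" for i using assms(4) that by auto
    then have "?m z \<in> tuples D n" if "z \<in> set zs" for z
      using tuplesD(2)[OF zD[OF that]] by (auto intro!: tuplesI)
    then show ?thesis using zD by (auto simp: minor_def)
  qed
  have "tp A (map f (map ?m xs)) = tp A (map f (map ?m ys))"
    by (rule canonical_tp[OF assms(1,2)]) (use *[OF xs] *[OF ys] eq assms(4) in \<open>auto simp: Pi_iff simp del: map_map\<close>)
  then show "tp A (map (minor D n k \<alpha> f) xs) = tp A (map (minor D n k \<alpha> f) ys)"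
    using *[OF xs] *[OF ys] by metis
qed

end

context ramsey_structure
begin

text \<open>Colour a \<open>k\<close>-tuple of tuples by the type of its image under \<open>f\<close>. There are only finitely many
  colours and only finitely many families of types to be treated, since lengths are at most \<open>N\<close>. The
  set \<open>F'\<close> depends on \<open>F\<close> and \<open>N\<close> but not on \<open>f\<close>, which allows \<open>f\<close> to be chosen in terms of \<open>F'\<close>.\<close>

lemma canonize:
  assumes k: "k > 0" and F: "finite F" "F \<subseteq> D"
  shows "\<exists>F'. finite F' \<and> F' \<subseteq> D \<and> (\<forall>f\<in>tuples D k \<rightarrow> D. \<exists>\<alpha>s\<in>tuples G k.
    (\<forall>\<alpha>\<in>set \<alpha>s. \<alpha> ` F \<subseteq> F') \<and> canonical_on k F N (subst_unary D f \<alpha>s))"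
proof -
  define T where "T = {cs. set cs \<subseteq> {c. set c \<subseteq> F \<and> length c \<le> N} \<and> length cs = k}"
  have T: "finite T" "T \<subseteq> tuples (lists D) k"
    using F unfolding T_def by (auto intro!: finite_lists_length_eq finite_lists_length_le simp: tuples_def)
  define S where "S = insert {} (\<Union>n\<le>N. tp A ` tuples D n)"
  have S: "finite S" using finite_types by (simp add: S_def)
  obtain F' where F': "finite F'" "F' \<subseteq> D"
    and hom: "\<And>\<chi>. (\<And>ys. \<chi> ys \<in> S) \<Longrightarrow> \<exists>\<alpha>s\<in>tuples G k. (\<forall>\<alpha>\<in>set \<alpha>s. \<alpha> ` F \<subseteq> F') \<and>
      (\<forall>xs\<in>T. \<exists>c. \<forall>ys. matches F ys xs \<longrightarrow> \<chi> (map2 map \<alpha>s ys) = c)"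
    using simultaneous_ramsey[OF T F S] by (elim exE conjE) (rule that, assumption+, blast)
  have "\<exists>\<alpha>s\<in>tuples G k. (\<forall>\<alpha>\<in>set \<alpha>s. \<alpha> ` F \<subseteq> F') \<and> canonical_on k F N (subst_unary D f \<alpha>s)"
    if f: "f \<in> tuples D k \<rightarrow> D" for f
  proof -
    \<comment> \<open>The empty set is a dummy colour for lists that do not come from \<open>k\<close>-tuples over \<open>F\<close>.\<close>
    define \<chi> where "\<chi> cs = (let \<theta> = tp A (componentwise f (length (hd cs)) cs) in
      if \<theta> \<in> S then \<theta> else {})" for cs
    have "\<chi> cs \<in> S" for cs by (simp add: \<chi>_def S_def Let_def)
    note hom = hom[of \<chi>, OF this]
    obtain \<alpha>s where \<alpha>s: "\<alpha>s \<in> tuples G k" "\<forall>\<alpha>\<in>set \<alpha>s. \<alpha> ` F \<subseteq> F'"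
      and cT: "\<And>xs. xs \<in> T \<Longrightarrow> \<exists>c. \<forall>ys. matches F ys xs \<longrightarrow> \<chi> (map2 map \<alpha>s ys) = c"
      using hom by (elim bexE conjE) (rule that, assumption, assumption, erule bspec, assumption)
    have len: "length \<alpha>s = k" and \<alpha>G: "\<And>i. i < k \<Longrightarrow> \<alpha>s ! i \<in> G" using tuplesD[OF \<alpha>s(1)] by auto
    let ?c = "\<lambda>xs. map (\<lambda>i. column i xs) [0..<k]"
    have val: "\<chi> (map2 map \<alpha>s (?c xs)) = tp A (map (subst_unary D f \<alpha>s) xs)"
      if xs: "xs \<in> lists (tuples F k)" "length xs \<le> N" for xs
    proof -
      have xD: "x \<in> tuples D k" if "x \<in> set xs" for x
        using that xs(1) tuples_mono[OF F(2)] by auto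
      have inD: "apply_tuple \<alpha>s x \<in> tuples D k" if "x \<in> set xs" for x
        by (rule apply_tuple_in[OF xD[OF that] len]) (use Aut_in[OF \<alpha>G] in blast)
      have cols: "map2 map \<alpha>s (?c xs) = ?c (map (apply_tuple \<alpha>s) xs)"
        by (rule nth_equalityI) (use len tuplesD(1)[OF xD] in auto)
      have "length (hd (?c (map (apply_tuple \<alpha>s) xs))) = length xs"
        using k by (simp add: hd_map)
      then have "componentwise f (length (hd (map2 map \<alpha>s (?c xs)))) (map2 map \<alpha>s (?c xs)) =
          componentwise f (length (map (apply_tuple \<alpha>s) xs)) (?c (map (apply_tuple \<alpha>s) xs))"
        unfolding cols by simp
      also have "\<dots> = map f (map (apply_tuple \<alpha>s) xs)"
        by (rule componentwise_columns) (use inD tuplesD in auto)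
      also have "\<dots> = map (subst_unary D f \<alpha>s) xs"
        using subst_unary_apply[OF xD len] by simp
      finally have eq: "componentwise f (length (hd (map2 map \<alpha>s (?c xs)))) (map2 map \<alpha>s (?c xs)) =
          map (subst_unary D f \<alpha>s) xs" .
      have "map (subst_unary D f \<alpha>s) xs \<in> tuples D (length xs)"
        using funcset_mem[OF f inD] subst_unary_apply[OF xD len] by (auto simp: tuples_def[of D "length xs"])
      then have "tp A (map (subst_unary D f \<alpha>s) xs) \<in> S" using xs(2) by (auto simp: S_def)
      then show ?thesis unfolding \<chi>_def eq Let_def by simp
    qed
    have "canonical_on k F N (subst_unary D f \<alpha>s)"
      unfolding canonical_on_def
    proof (intro ballI impI)
      fix xs ys assume xs: "xs \<in> lists (tuples F k)" and ys: "ys \<in> lists (tuples F k)"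
        and N: "length xs \<le> N" and eq: "\<forall>i<k. tp A (column i xs) = tp A (column i ys)"
      have leny: "length ys = length xs" using eq k tp_length by (metis length_map)
      have cxT: "?c xs \<in> T"
        using column_in[OF xs] N by (simp add: T_def in_lists_iff image_subset_iff)
      have "matches F (?c xs) (?c xs)" "matches F (?c ys) (?c xs)"
        unfolding matches_def list_all2_conv_all_nth
        using column_in[OF xs] column_in[OF ys] eq by simp_all
      then have "\<chi> (map2 map \<alpha>s (?c xs)) = \<chi> (map2 map \<alpha>s (?c ys))" using cT[OF cxT] by metis
      then show "tp A (map (subst_unary D f \<alpha>s) xs) = tp A (map (subst_unary D f \<alpha>s) ys)"
        using val[OF xs N] val[OF ys] N leny by simp
    qed
    then show ?thesis using \<alpha>s by blast
  qed
  then show ?thesis using F' by blast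
qed

end


section \<open>Polymorphisms of reducts\<close>

locale reduct_of_ramsey = ramsey_structure \<sigma> A
  for \<sigma> :: "'r signature" and A :: "('r, 'a) struct" +
  fixes \<tau> :: "'s signature" and C :: "('s, 'a) struct"
  assumes reduct: "reduct \<tau> C A"
begin

lemma univ_C: "univ C = D" using reduct by (simp add: reduct_def)

text \<open>The relations of a first-order reduct are definable, hence unions of types.\<close>

lemma rel_C_tp:
  assumes "tp A s = tp A t" "s \<in> lists D" "t \<in> lists D"
  shows "s \<in> rel C R \<longleftrightarrow> t \<in> rel C R"
proof (cases "\<tau> R")
  case None
  then have "rel C R = {}" using reduct unfolding reduct_def is_structure_def by force
  then show ?thesis by simp
next
  case (Some n)
  then obtain \<phi> :: "('r, 'a) fm" where \<phi>: "parameters \<phi> = {}" "free_vars \<phi> \<subseteq> {..<n}"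
    and C: "rel C R = {t \<in> tuples D n. sat A (\<lambda>i. t ! i) \<phi>}"
    using reduct unfolding reduct_def by blast
  have "z \<in> rel C R \<longleftrightarrow> length z = n \<and> \<phi> \<in> tp A z" if "z \<in> lists D" for z
    using \<phi> that unfolding C by (auto simp: tuples_def tp_def tp_over_def)
  then show ?thesis using assms tp_length[OF assms(1)] by simp
qed

lemma Pol_iff:
  "p \<in> Pol C k \<longleftrightarrow> k > 0 \<and> p \<in> tuples D k \<rightarrow>\<^sub>E D \<and>
    (\<forall>R. \<forall>T\<in>lists (tuples D k). (\<forall>i<k. column i T \<in> rel C R) \<longrightarrow> map p T \<in> rel C R)"
  by (auto simp: Pol_def homomorphisms_def power_struct_def univ_C simp del: in_lists_conv_set)

lemma Pol_in: "p \<in> Pol C k \<Longrightarrow> x \<in> tuples D k \<Longrightarrow> p x \<in> D"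
  by (auto simp: Pol_iff)

lemma Pol_limit:
  assumes "k > 0" "p \<in> tuples D k \<rightarrow>\<^sub>E D"
    and lim: "\<And>F. finite F \<Longrightarrow> F \<subseteq> D \<Longrightarrow> \<exists>q\<in>Pol C k. similar_on k F p q"
  shows "p \<in> Pol C k"
  unfolding Pol_iff
proof (intro conjI allI ballI impI assms)
  fix R T assume T: "T \<in> lists (tuples D k)" "\<forall>i<k. column i T \<in> rel C R"
  define F where "F = \<Union> (set ` set T)"
  have F: "finite F" "F \<subseteq> D" "T \<in> lists (tuples F k)" using T by (auto simp: F_def tuples_def)
  obtain q where q: "q \<in> Pol C k" "similar_on k F p q" using lim[OF F(1,2)] by blast
  have "map q T \<in> rel C R" using q(1) T unfolding Pol_iff by blast
  moreover have "tp A (map p T) = tp A (map q T)" using q(2) F(3) by (simp add: similar_on_def)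
  moreover have "map p T \<in> lists D" "map q T \<in> lists D"
    using map_in_lists[OF T(1)] PiE_mem[OF assms(2)] Pol_in[OF q(1)] by blast+
  ultimately show "map p T \<in> rel C R" using rel_C_tp by metis
qed

lemma Pol_subst:
  assumes f: "f \<in> Pol C k" and vs: "vs \<in> tuples (Aut_closure A) k"
  shows "subst_unary D f vs \<in> Pol C k"
  unfolding Pol_iff
proof (intro conjI allI ballI impI)
  have v: "length vs = k" "\<And>i. i < k \<Longrightarrow> vs ! i \<in> Aut_closure A" using tuplesD[OF vs] by auto
  have vD: "vs ! i ` D \<subseteq> D" if "i < k" for i using closure_in[OF v(2)[OF that]] by blast
  show "k > 0" using f by (simp add: Pol_iff)
  show "subst_unary D f vs \<in> tuples D k \<rightarrow>\<^sub>E D"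
    by (rule subst_unary_PiE[OF _ v(1) vD]) (use Pol_in[OF f] in auto)
  fix R T assume T: "T \<in> lists (tuples D k)" "\<forall>i<k. column i T \<in> rel C R"
  have ap: "apply_tuple vs x \<in> tuples D k" if "x \<in> set T" for x
    using apply_tuple_in[OF _ v(1) vD] that T(1) by blast
  have cols: "column i (map (apply_tuple vs) T) \<in> rel C R" if i: "i < k" for i
  proof -
    have c: "column i T \<in> lists D" using column_in[OF T(1) i] .
    have "map (vs ! i) (column i T) \<in> lists D" using c vD[OF i] by (auto simp: image_subset_iff)
    then show ?thesis
      unfolding column_apply[OF T(1) v(1) i]
      using rel_C_tp[OF tp_closure[OF v(2)[OF i] c] _ c] T(2) i by blast
  qed
  then have "map f (map (apply_tuple vs) T) \<in> rel C R"
  proof -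
    have "map (apply_tuple vs) T \<in> lists (tuples D k)" using ap by (simp add: in_lists_iff image_subset_iff)
    then show ?thesis using cols f unfolding Pol_iff by blast
  qed
  moreover have "map (subst_unary D f vs) T = map f (map (apply_tuple vs) T)"
    using subst_unary_apply[OF _ v(1)] T(1) by auto
  ultimately show "map (subst_unary D f vs) T \<in> rel C R" by (simp only:)
qed

lemma Pol_minor:
  assumes f: "f \<in> Pol C n" and k: "k > 0" and \<alpha>: "\<alpha> \<in> {..<n} \<rightarrow> {..<k}"
  shows "minor D n k \<alpha> f \<in> Pol C k"
  unfolding Pol_iff
proof (intro conjI allI ballI impI k)
  let ?m = "\<lambda>x. map (\<lambda>i. x ! \<alpha> i) [0..<n]"
  have \<alpha>k: "\<alpha> i < k" if "i < n" for i using \<alpha> that by auto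
  have m: "?m z \<in> tuples D n" if "z \<in> tuples D k" for z
    using tuplesD(2)[OF that \<alpha>k] by (auto intro!: tuplesI)
  show "minor D n k \<alpha> f \<in> tuples D k \<rightarrow>\<^sub>E D" using m Pol_in[OF f] by (auto simp: minor_def)
  fix R T assume T: "T \<in> lists (tuples D k)" "\<forall>i<k. column i T \<in> rel C R"
  have "map (minor D n k \<alpha> f) T = map f (map ?m T)" using T(1) by (auto simp: minor_def)
  moreover have "map ?m T \<in> lists (tuples D n)" using m T(1) by auto
  moreover have "column i (map ?m T) \<in> rel C R" if "i < n" for i
  proof -
    have "column i (map ?m T) = column (\<alpha> i) T" using that by simp
    then show ?thesis using T(2) \<alpha>k[OF that] by (simp only:)
  qed
  ultimately show "map (minor D n k \<alpha> f) T \<in> rel C R" using f unfolding Pol_iff by metis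
qed

text \<open>If a property can be satisfied on every finite part of \<open>A\<close> and is inherited by smaller parts,
  then a limit of witnesses is similar, on each finite part, to one that satisfies it there.\<close>

lemma local_to_global:
  fixes \<Phi> :: "'a set \<Rightarrow> nat \<Rightarrow> 'a opn \<Rightarrow> bool"
  assumes D: "D \<noteq> {}" and k: "k > 0"
    and ex: "\<And>F N. finite F \<Longrightarrow> F \<subseteq> D \<Longrightarrow> \<exists>q\<in>Pol C k. \<Phi> F N q"
    and mono: "\<And>F N F' N' q. \<Phi> F N q \<Longrightarrow> F' \<subseteq> F \<Longrightarrow> N' \<le> N \<Longrightarrow> \<Phi> F' N' q"
  shows "\<exists>p\<in>Pol C k. \<forall>F N. finite F \<longrightarrow> F \<subseteq> D \<longrightarrow> (\<exists>q. \<Phi> F N q \<and> similar_on k F p q)"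
proof -
  define E where "E n = from_nat_into D ` {..<n}" for n :: nat
  have "finite (E n)" "E n \<subseteq> D" for n using from_nat_into[OF D] by (auto simp: E_def)
  then have "\<forall>n. \<exists>q\<in>Pol C k. \<Phi> (E n) n q" using ex by blast
  then obtain q where q: "\<And>n. q n \<in> Pol C k" "\<And>n. \<Phi> (E n) n (q n)" by metis
  have qD: "q n \<in> tuples D k \<rightarrow> D" for n using Pol_in[OF q(1)] by auto
  have "countable (tuples D k)"
    by (rule countable_subset[OF _ countable_lists[OF countable]]) (auto simp: tuples_def)
  note lim = limit[OF this, of q, OF qD]
  obtain p where p: "p \<in> tuples D k \<rightarrow>\<^sub>E D"
    and lim: "\<And>H m. finite H \<Longrightarrow> H \<subseteq> tuples D k \<Longrightarrow>
      \<exists>n\<ge>m. \<forall>xs\<in>lists H. tp A (map p xs) = tp A (map (q n) xs)"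
    using lim by (elim bexE) (rule that, assumption, blast)
  have sim: "\<exists>n. \<Phi> F N (q n) \<and> similar_on k F p (q n)" if F: "finite F" "F \<subseteq> D" for F N
  proof -
    obtain M where M: "\<And>n. M \<le> n \<Longrightarrow> F \<subseteq> E n"
      using finite_subset_enum[OF countable F] unfolding E_def by blast
    obtain n where n: "n \<ge> max M N" "\<forall>xs\<in>lists (tuples F k). tp A (map p xs) = tp A (map (q n) xs)"
      using lim[OF finite_tuples[OF F(1)] tuples_mono[OF F(2)]] by blast
    then have "\<Phi> F N (q n)" using mono[OF q(2) M] by simp
    then show ?thesis using n(2) unfolding similar_on_def by blast
  qed
  then have "p \<in> Pol C k" using Pol_limit[OF k p] q(1) by blast
  then show ?thesis using sim by blast
qed

text \<open>After composition with suitable limits of automorphisms the two operations become equal.\<close>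

lemma zeta_similar:
  assumes inv: "invariant D (Aut_closure A) (canonical_Pol C A) \<zeta>"
    and p: "p \<in> canonical_Pol C A k" and q: "q \<in> canonical_Pol C A k"
    and sim: "similar_on k D p q"
  shows "\<zeta> k p = \<zeta> k q"
proof -
  let ?id = "\<lambda>x\<in>D. x"
  have id: "?id \<in> Aut_closure A" using Aut_subset_closure[OF Aut_id] .
  have ids: "replicate k ?id \<in> tuples (Aut_closure A) k" using id by (auto simp: tuples_def)
  have pq: "p \<in> tuples D k \<rightarrow>\<^sub>E D" "q \<in> tuples D k \<rightarrow>\<^sub>E D"
    using p q by (auto simp: canonical_Pol_def Pol_iff)
  have "countable (tuples D k)"
    by (rule countable_subset[OF _ countable_lists[OF countable]]) (auto simp: tuples_def)
  then have "\<exists>e\<in>Aut_closure A. \<exists>e'\<in>Aut_closure A. \<forall>x\<in>tuples D k. e (p x) = e' (q x)"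
    by (rule amalgamate) (use pq sim in \<open>auto simp: similar_on_def\<close>)
  then obtain e e' where e: "e \<in> Aut_closure A" "e' \<in> Aut_closure A"
    "\<And>x. x \<in> tuples D k \<Longrightarrow> e (p x) = e' (q x)"
    by blast
  have "apply_tuple (replicate k ?id) x = x" if "x \<in> tuples D k" for x
    by (rule nth_equalityI) (use tuplesD[OF that] in auto)
  then have "compose (tuples D k) e (subst_unary D p (replicate k ?id)) =
      compose (tuples D k) e' (subst_unary D q (replicate k ?id))"
    using e(3) by (auto simp: compose_def subst_unary_apply)
  then show ?thesis using inv p q e(1,2) ids unfolding invariant_def by metis
qed

text \<open>With the same arguments \<open>t \<circ> u1\<close> and \<open>t \<circ> u2\<close>, where \<open>t\<close> is an automorphism for each
  coordinate, \<open>f\<close> looks like \<open>g\<close> at the first position and like \<open>r\<close> at the second.\<close>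

definition realizes ::
  "('a \<Rightarrow> 'a) \<Rightarrow> ('a \<Rightarrow> 'a) \<Rightarrow> nat \<Rightarrow> 'a opn \<Rightarrow> 'a set \<Rightarrow> 'a opn \<Rightarrow> 'a opn \<Rightarrow> bool" where
  "realizes u1 u2 k f F g r \<longleftrightarrow> (\<exists>ts\<in>tuples G k.
     similar_on k F (subst_unary D f (map (\<lambda>t. t \<circ> u1) ts)) g \<and>
     similar_on k F (subst_unary D f (map (\<lambda>t. t \<circ> u2) ts)) r)"

lemma realizes_mono: "realizes u1 u2 k f F g r \<Longrightarrow> F' \<subseteq> F \<Longrightarrow> realizes u1 u2 k f F' g r"
  unfolding realizes_def using similar_on_mono by meson

lemma realizes_similar:
  "realizes u1 u2 k f F g r \<Longrightarrow> similar_on k F r' r \<Longrightarrow> realizes u1 u2 k f F g r'"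
  unfolding realizes_def using similar_on_trans similar_on_sym by meson

end

section \<open>Operations read at independent positions\<close>

locale independent_pair = reduct_of_ramsey \<sigma> A \<tau> C
  for \<sigma> :: "'r signature" and A :: "('r, 'a) struct"
    and \<tau> :: "'s signature" and C :: "('s, 'a) struct" +
  fixes A1 A2 :: "('r, 'a) struct" and u1 u2 :: "'a \<Rightarrow> 'a"
  assumes A1: "elementary_substructure A1 A" and A2: "elementary_substructure A2 A"
    and ind: "independent_substructures A A1 A2"
    and u1: "u1 \<in> Aut_closure A" "u1 ` D \<subseteq> univ A1"
    and u2: "u2 \<in> Aut_closure A" "u2 ` D \<subseteq> univ A2"
begin

text \<open>The independence of \<open>A1\<close> and \<open>A2\<close> in the form used below: a type-preserving map of \<open>u1 F\<close>
  into \<open>A1\<close> and one of \<open>u2 F\<close> into \<open>A2\<close> have a common extension to an automorphism.\<close>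

lemma independent_move:
  assumes F: "finite F" "F \<subseteq> D"
    and a: "a ` F \<subseteq> univ A1" "\<And>c. c \<in> lists F \<Longrightarrow> tp A (map a c) = tp A c"
    and b: "b ` F \<subseteq> univ A2" "\<And>c. c \<in> lists F \<Longrightarrow> tp A (map b c) = tp A c"
  shows "\<exists>t\<in>G. \<forall>x\<in>F. t (u1 x) = a x \<and> t (u2 x) = b x"
proof -
  note sub = elementary_subset[OF A1] elementary_subset[OF A2]
  obtain c where c: "set c = F" using finite_list[OF F(1)] by blast
  have cl: "c \<in> lists F" "c \<in> lists D" using c F by auto
  have m1: "map u1 c \<in> lists (univ A1)" "map a c \<in> lists (univ A1)"
    and m2: "map u2 c \<in> lists (univ A2)" "map b c \<in> lists (univ A2)"
    using c F u1(2) u2(2) a(1) b(1) by (auto simp: in_lists_iff image_subset_iff subset_iff)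
  have "tp A (map u1 c @ map u2 c) = tp A (map a c @ map b c)"
  proof (rule independent_tp[OF _ _ sub])
    show "independent_from A (univ A1) (univ A2)" "independent_from A (univ A2) (univ A1)"
      using ind by (auto simp: independent_substructures_def)
    show "tp A (map u1 c) = tp A (map a c)"
      using tp_closure[OF u1(1) cl(2)] a(2)[OF cl(1)] by metis
    show "tp A (map u2 c) = tp A (map b c)"
      using tp_closure[OF u2(1) cl(2)] b(2)[OF cl(1)] by metis
  qed (fact m1 m2)+
  moreover have "map u1 c @ map u2 c \<in> lists D" "map a c @ map b c \<in> lists D"
    using m1 m2 sub by auto
  ultimately obtain t where t: "t \<in> G" "map t (map u1 c @ map u2 c) = map a c @ map b c"
    using tp_eqE[OF hom] by metis
  then have "\<forall>x\<in>set c. t (u1 x) = a x \<and> t (u2 x) = b x" by auto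
  then show ?thesis using t(1) c by blast
qed

text \<open>The images of \<open>F'\<close> under \<open>v\<close> and \<open>w\<close> are arbitrary, but by elementarity an automorphism \<open>s\<close>
  carries a part of \<open>A1\<close> onto them. Then \<open>s\<close> carries \<open>A2\<close> to a place that is independent from both,
  and the movement there can be prescribed freely.\<close>

lemma independent_place:
  assumes v: "v \<in> G" and w: "w \<in> G" and F': "finite F'" "F' \<subseteq> D"
  shows "\<exists>s\<in>G. \<forall>v'\<in>{v, w}. \<forall>\<alpha>\<in>G. \<forall>F. finite F \<longrightarrow> F \<subseteq> D \<longrightarrow> \<alpha> ` F \<subseteq> F' \<longrightarrow>
    (\<exists>t\<in>G. \<forall>x\<in>F. t (u1 x) = v' (\<alpha> x) \<and> t (u2 x) = s (u2 (\<alpha> x)))"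
proof -
  obtain e where e: "set e = F'" using finite_list[OF F'(1)] by blast
  have eD: "map v e @ map w e \<in> lists D" 
    using e F' Aut_in[OF v] Aut_in[OF w] by (auto simp: in_lists_iff subset_iff)
  obtain z where z: "z \<in> lists (univ A1)" "tp A z = tp A (map v e @ map w e)"
    using elementary_realizes[OF A1 eD] by blast
  have zD: "z \<in> lists D" using z(1) elementary_subset[OF A1] by auto
  obtain s where s: "s \<in> G" "map s z = map v e @ map w e" using tp_eqE[OF hom zD eD z(2)] by blast
  have "\<exists>t\<in>G. \<forall>x\<in>F. t (u1 x) = v' (\<alpha> x) \<and> t (u2 x) = s (u2 (\<alpha> x))"
    if v': "v' \<in> {v, w}" and \<alpha>: "\<alpha> \<in> G" and F: "finite F" "F \<subseteq> D" "\<alpha> ` F \<subseteq> F'" for v' \<alpha> F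
  proof -
    have v'G: "v' \<in> G" using v' v w by blast
    have "\<exists>y\<in>univ A1. s y = v' x" if "x \<in> F'" for x
    proof -
      have "v' x \<in> set (map s z)" unfolding s(2) using v' that e by auto
      then show ?thesis using z(1) by auto
    qed
    then obtain a where a: "\<And>x. x \<in> F' \<Longrightarrow> a x \<in> univ A1 \<and> s (a x) = v' x" by metis
    have "\<exists>t\<in>G. \<forall>x\<in>F. t (u1 x) = (a \<circ> \<alpha>) x \<and> t (u2 x) = (u2 \<circ> \<alpha>) x"
    proof (rule independent_move[OF F(1,2)])
      show "(a \<circ> \<alpha>) ` F \<subseteq> univ A1" using a F(3) by auto
      show "(u2 \<circ> \<alpha>) ` F \<subseteq> univ A2" 
        using u2(2) F(2) Aut_in[OF \<alpha>] by (auto simp: image_subset_iff subset_iff)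
    next
      fix c assume c: "c \<in> lists F"
      then have cD: "c \<in> lists D" using F by auto
      have \<alpha>c: "map \<alpha> c \<in> lists D" using cD Aut_in[OF \<alpha>] by auto
      have \<alpha>F: "\<alpha> x \<in> F'" if "x \<in> set c" for x using that c F(3) by auto
      have "a (\<alpha> x) \<in> D" if "x \<in> set c" for x
        using a[OF \<alpha>F[OF that]] elementary_subset[OF A1] by blast
      then have "map (a \<circ> \<alpha>) c \<in> lists D" by auto
      then have "tp A (map (a \<circ> \<alpha>) c) = tp A (map s (map (a \<circ> \<alpha>) c))"
        using tp_automorphism[OF s(1)] by metis
      also have "map s (map (a \<circ> \<alpha>) c) = map v' (map \<alpha> c)" using \<alpha>F a by auto
      also have "tp A (map v' (map \<alpha> c)) = tp A c"
        using tp_automorphism[OF v'G \<alpha>c] tp_automorphism[OF \<alpha> cD] by metis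
      finally show "tp A (map (a \<circ> \<alpha>) c) = tp A c" .
      show "tp A (map (u2 \<circ> \<alpha>) c) = tp A c"
        using tp_closure[OF u2(1) \<alpha>c] tp_automorphism[OF \<alpha> cD] by (metis map_map)
    qed
    then obtain t where t: "t \<in> G" "\<And>x. x \<in> F \<Longrightarrow> t (u1 x) = a (\<alpha> x) \<and> t (u2 x) = u2 (\<alpha> x)"
      by auto
    have "\<forall>x\<in>F. compose D s t (u1 x) = v' (\<alpha> x) \<and> compose D s t (u2 x) = s (u2 (\<alpha> x))"
    proof
      fix x assume x: "x \<in> F"
      have "u1 x \<in> D" "u2 x \<in> D" using x F closure_in u1 u2 by auto
      moreover have "s (a (\<alpha> x)) = v' (\<alpha> x)" using a F(3) x by auto
      ultimately show "compose D s t (u1 x) = v' (\<alpha> x) \<and> compose D s t (u2 x) = s (u2 (\<alpha> x))"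
        using t(2)[OF x] by (simp add: compose_def)
    qed
    then show ?thesis using Aut_compose[OF s(1) t(1)] by blast
  qed
  then show ?thesis using s(1) by blast
qed

lemma independent_shift:
  assumes \<alpha>: "\<alpha> \<in> G" and F: "finite F" "F \<subseteq> D"
  shows "\<exists>t\<in>G. \<forall>x\<in>F. t (u1 x) = u1 (\<alpha> x) \<and> t (u2 x) = u2 (\<alpha> x)"
proof -
  have "\<exists>t\<in>G. \<forall>x\<in>F. t (u1 x) = (u1 \<circ> \<alpha>) x \<and> t (u2 x) = (u2 \<circ> \<alpha>) x"
  proof (rule independent_move[OF F])
    show "(u1 \<circ> \<alpha>) ` F \<subseteq> univ A1" "(u2 \<circ> \<alpha>) ` F \<subseteq> univ A2"
      using u1(2) u2(2) F(2) Aut_in[OF \<alpha>] by (auto simp: image_subset_iff subset_iff)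
    fix c assume "c \<in> lists F"
    then have cD: "c \<in> lists D" using F by auto
    have \<alpha>c: "map \<alpha> c \<in> lists D" using cD Aut_in[OF \<alpha>] by auto
    show "tp A (map (u1 \<circ> \<alpha>) c) = tp A c"
      using tp_closure[OF u1(1) \<alpha>c] tp_automorphism[OF \<alpha> cD] by (metis map_map)
    show "tp A (map (u2 \<circ> \<alpha>) c) = tp A c"
      using tp_closure[OF u2(1) \<alpha>c] tp_automorphism[OF \<alpha> cD] by (metis map_map)
  qed
  then show ?thesis by simp
qed

end


lemma subst_subst:
  assumes x: "x \<in> tuples D k" and vs: "length vs = k" and ws: "length ws = k"
    and in': "\<And>i. i < k \<Longrightarrow> (ws ! i) (x ! i) \<in> D"
  shows "subst_unary D (subst_unary D f vs) ws x = subst_unary D f (map2 (\<circ>) vs ws) x"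
proof -
  have "apply_tuple ws x \<in> tuples D k"
    using in' ws tuplesD(1)[OF x] by (intro tuplesI) auto
  moreover have "apply_tuple vs (apply_tuple ws x) = apply_tuple (map2 (\<circ>) vs ws) x"
    using vs ws tuplesD(1)[OF x] by (intro nth_equalityI) auto
  ultimately show ?thesis using x vs ws by (simp add: subst_unary_apply)
qed

lemma subst_cong:
  assumes x: "x \<in> tuples D k" and vs: "length vs = k" and ws: "length ws = k"
    and eq: "\<And>i. i < k \<Longrightarrow> (vs ! i) (x ! i) = (ws ! i) (x ! i)"
  shows "subst_unary D f vs x = subst_unary D f ws x"
proof -
  have "apply_tuple vs x = apply_tuple ws x"
    using vs ws eq tuplesD(1)[OF x] by (intro nth_equalityI) auto
  then show ?thesis using x vs ws by (simp add: subst_unary_apply)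
qed

context independent_pair
begin

lemma G_closure: "ts \<in> tuples G k \<Longrightarrow> ts \<in> tuples (Aut_closure A) k"
  using Aut_subset_closure by (auto simp: tuples_def)

text \<open>The outer automorphism of an interpolation disappears when values are compared by type.\<close>

lemma interpolates_similar:
  assumes f: "f \<in> Pol C k" and int: "interpolates D G k f g"
    and F: "finite F" "F \<subseteq> D"
  shows "\<exists>vs\<in>tuples G k. similar_on k F (subst_unary D f vs) g"
proof -
  obtain u vs where u: "u \<in> G" and vs: "vs \<in> tuples G k"
    and eq: "\<And>x. x \<in> tuples F k \<Longrightarrow> g x = u (subst_unary D f vs x)"
    using int[unfolded interpolates_def, rule_format, OF conjI[OF F]]
    by (elim bexE) (rule that, assumption+, erule bspec)
  have "similar_on k F (subst_unary D f vs) g"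
    unfolding similar_on_def
  proof
    fix xs assume xs: "xs \<in> lists (tuples F k)"
    have "map (subst_unary D f vs) xs \<in> lists D"
      using map_in_lists[OF xs] Pol_in[OF Pol_subst[OF f G_closure[OF vs]]]
        subsetD[OF tuples_mono[OF F(2)]] by (metis (no_types, lifting))
    moreover have "map g xs = map u (map (subst_unary D f vs) xs)" using xs eq by auto
    ultimately show "tp A (map (subst_unary D f vs) xs) = tp A (map g xs)"
      using tp_automorphism[OF u] by metis
  qed
  then show ?thesis using vs by blast
qed

lemma similar_shift:
  assumes k: "k > 0" and g: "canonical A k g" and \<alpha>s: "\<alpha>s \<in> tuples G k"
    and \<alpha>F: "\<And>i. i < k \<Longrightarrow> \<alpha>s ! i ` F \<subseteq> F'" and F: "F \<subseteq> D" "F' \<subseteq> D"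
    and sim: "similar_on k F' p g"
  shows "similar_on k F (subst_unary D p \<alpha>s) g"
  using similar_on_trans[OF similar_on_subst[OF sim tuplesD(1)[OF \<alpha>s] \<alpha>F F(1)]
      similar_on_mono[OF canonical_subst_similar[OF k g G_closure[OF \<alpha>s]] F(1)]] .

text \<open>The arguments at which \<open>f\<close> looks like \<open>g\<close> and those at which it looks like \<open>h\<close> can be entangled
  with each other in any way. In each coordinate there is a third place, given by
  \<open>s i \<circ> u2\<close>, which is independent from both. Canonisation of \<open>f\<close> at that place produces \<open>q\<close>. The same
  automorphisms \<open>\<alpha>s\<close> are applied to the arguments of \<open>g\<close> and \<open>h\<close>, which is harmless by canonicity.\<close>

lemma common_partner_local:
  assumes k: "k > 0" and f: "f \<in> Pol C k"
    and g: "canonical A k g" "interpolates D G k f g"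
    and h: "canonical A k h" "interpolates D G k f h"
    and F: "finite F" "F \<subseteq> D"
  shows "\<exists>q\<in>Pol C k. canonical_on k F N q \<and>
    realizes u1 u2 k f F g q \<and> realizes u1 u2 k f F h q"
proof -
  obtain F' where F': "finite F'" "F' \<subseteq> D"
    and can: "\<And>f. f \<in> tuples D k \<rightarrow> D \<Longrightarrow> \<exists>\<alpha>s\<in>tuples G k. (\<forall>\<alpha>\<in>set \<alpha>s. \<alpha> ` F \<subseteq> F') \<and>
      canonical_on k F N (subst_unary D f \<alpha>s)"
    using canonize[OF k F, of N] by (elim exE conjE) (rule that, assumption+, erule bspec, assumption)
  obtain vs where vs: "vs \<in> tuples G k" "similar_on k F' (subst_unary D f vs) g"
    using interpolates_similar[OF f g(2) F'] by blast
  obtain ws where ws: "ws \<in> tuples G k" "similar_on k F' (subst_unary D f ws) h"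
    using interpolates_similar[OF f h(2) F'] by blast
  define good where "good i s \<longleftrightarrow> s \<in> G \<and> (\<forall>v'\<in>{vs ! i, ws ! i}. \<forall>\<alpha>\<in>G. \<forall>F. finite F \<longrightarrow> F \<subseteq> D \<longrightarrow>
    \<alpha> ` F \<subseteq> F' \<longrightarrow> (\<exists>t\<in>G. \<forall>x\<in>F. t (u1 x) = v' (\<alpha> x) \<and> t (u2 x) = s (u2 (\<alpha> x))))" for i s
  have "\<exists>s. good i s" if "i < k" for i
    using independent_place[OF tuplesD(2)[OF vs(1) that] tuplesD(2)[OF ws(1) that] F']
    unfolding good_def by (elim bexE) (intro exI conjI)
  then obtain s where s: "\<And>i. i < k \<Longrightarrow> good i (s i)" by metis
  define us where "us = map (\<lambda>i. s i \<circ> u2) [0..<k]"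
  have us: "length us = k" "\<And>i. i < k \<Longrightarrow> us ! i = s i \<circ> u2" by (simp_all add: us_def)
  have sG: "s i \<in> G" if "i < k" for i using s[OF that] by (simp add: good_def)
  have usD: "us ! i ` D \<subseteq> D" if "i < k" for i
    using Aut_in[OF sG[OF that]] closure_in[OF u2(1)] us(2)[OF that] by auto
  have f0: "subst_unary D f us \<in> tuples D k \<rightarrow> D"
    using subst_unary_PiE[OF _ us(1) usD, of f] Pol_in[OF f] by (auto simp: PiE_iff)
  obtain \<alpha>s where \<alpha>s: "\<alpha>s \<in> tuples G k" "\<And>\<alpha>. \<alpha> \<in> set \<alpha>s \<Longrightarrow> \<alpha> ` F \<subseteq> F'"
    and q: "canonical_on k F N (subst_unary D (subst_unary D f us) \<alpha>s)"
    using can[OF f0] by blast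
  define q where "q = subst_unary D (subst_unary D f us) \<alpha>s"
  have len: "length \<alpha>s = k" "length vs = k" "length ws = k" using \<alpha>s vs ws by (auto simp: tuples_def)
  have \<alpha>G: "\<alpha>s ! i \<in> G" if "i < k" for i using tuplesD(2)[OF \<alpha>s(1) that] .
  have \<alpha>F: "\<alpha>s ! i ` F \<subseteq> F'" if "i < k" for i using \<alpha>s(2) len that by simp
  have real: "realizes u1 u2 k f F g' q"
    if zs: "zs \<in> {vs, ws}" and g': "canonical A k g'" "similar_on k F' (subst_unary D f zs) g'" for zs g'
  proof -
    have zlen: "length zs = k" using zs len by auto
    have "\<exists>t\<in>G. \<forall>x\<in>F. t (u1 x) = (zs ! i) ((\<alpha>s ! i) x) \<and> t (u2 x) = s i (u2 ((\<alpha>s ! i) x))"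
      if "i < k" for i
    proof -
      have "zs ! i \<in> {vs ! i, ws ! i}" using zs by auto
      then show ?thesis using s[OF that] \<alpha>G[OF that] \<alpha>F[OF that] F unfolding good_def by blast
    qed
    then obtain t where t: "\<And>i. i < k \<Longrightarrow> t i \<in> G"
      "\<And>i x. i < k \<Longrightarrow> x \<in> F \<Longrightarrow> t i (u1 x) = (zs ! i) ((\<alpha>s ! i) x)"
      "\<And>i x. i < k \<Longrightarrow> x \<in> F \<Longrightarrow> t i (u2 x) = s i (u2 ((\<alpha>s ! i) x))"
      by metis
    define ts where "ts = map t [0..<k]"
    have ts: "ts \<in> tuples G k" using t(1) by (auto simp: ts_def tuples_def)
    have nth: "length ts = k" "\<And>i. i < k \<Longrightarrow> ts ! i = t i" by (simp_all add: ts_def)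
    have xF: "x ! i \<in> F" "(\<alpha>s ! i) (x ! i) \<in> D" if "x \<in> tuples F k" "i < k" for x i
      using tuplesD(2)[OF that] Aut_in[OF \<alpha>G[OF that(2)]] F by auto
    have xD: "x \<in> tuples D k" if "x \<in> tuples F k" for x using that tuples_mono[OF F(2)] by blast
    have "similar_on k F (subst_unary D f (map (\<lambda>t. t \<circ> u1) ts)) g'"
    proof (rule similar_on_trans)
      show "similar_on k F (subst_unary D (subst_unary D f zs) \<alpha>s) g'"
        by (rule similar_shift[OF k g'(1) \<alpha>s(1) \<alpha>F F(2) F'(2) g'(2)])
      show "similar_on k F (subst_unary D f (map (\<lambda>t. t \<circ> u1) ts)) (subst_unary D (subst_unary D f zs) \<alpha>s)"
      proof (rule similar_onI_eq)
        fix x assume x: "x \<in> tuples F k"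
        have "subst_unary D (subst_unary D f zs) \<alpha>s x = subst_unary D f (map2 (\<circ>) zs \<alpha>s) x"
          by (rule subst_subst[OF xD[OF x] zlen len(1) xF(2)[OF x]])
        also have "\<dots> = subst_unary D f (map (\<lambda>t. t \<circ> u1) ts) x"
          by (rule subst_cong[OF xD[OF x]]) (use zlen len nth t(2) xF(1)[OF x] in auto)
        finally show "subst_unary D f (map (\<lambda>t. t \<circ> u1) ts) x =
            subst_unary D (subst_unary D f zs) \<alpha>s x" ..
      qed
    qed
    moreover have "similar_on k F (subst_unary D f (map (\<lambda>t. t \<circ> u2) ts)) q"
    proof (rule similar_onI_eq)
      fix x assume x: "x \<in> tuples F k"
      have "q x = subst_unary D f (map2 (\<circ>) us \<alpha>s) x"
        unfolding q_def by (rule subst_subst[OF xD[OF x] us(1) len(1) xF(2)[OF x]])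
      also have "\<dots> = subst_unary D f (map (\<lambda>t. t \<circ> u2) ts) x"
        by (rule subst_cong[OF xD[OF x]]) (use us len nth t(3) xF(1)[OF x] in auto)
      finally show "subst_unary D f (map (\<lambda>t. t \<circ> u2) ts) x = q x" ..
    qed
    ultimately show ?thesis using ts unfolding realizes_def by blast
  qed
  have "q \<in> Pol C k"
  proof -
    have "subst_unary D f us = subst_unary D (subst_unary D f (map s [0..<k])) (replicate k u2)"
    proof (rule ext)
      fix x
      show "subst_unary D f us x = subst_unary D (subst_unary D f (map s [0..<k])) (replicate k u2) x"
      proof (cases "x \<in> tuples D k")
        case True
        have "subst_unary D (subst_unary D f (map s [0..<k])) (replicate k u2) x =
            subst_unary D f (map2 (\<circ>) (map s [0..<k]) (replicate k u2)) x"
          by (rule subst_subst[OF True]) (use tuplesD(2)[OF True] closure_in[OF u2(1)] in auto)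
        also have "\<dots> = subst_unary D f us x"
          by (rule subst_cong[OF True]) (use us in auto)
        finally show ?thesis ..
      next
        case False
        then show ?thesis using us(1) by (simp add: subst_unary_def)
      qed
    qed
    moreover have "map s [0..<k] \<in> tuples (Aut_closure A) k" "replicate k u2 \<in> tuples (Aut_closure A) k"
      using sG Aut_subset_closure u2(1) by (auto simp: tuples_def)
    ultimately have "subst_unary D f us \<in> Pol C k" using Pol_subst[OF Pol_subst[OF f]] by metis
    then show ?thesis unfolding q_def using Pol_subst G_closure[OF \<alpha>s(1)] by blast
  qed
  moreover have "canonical_on k F N q" using q by (simp add: q_def)
  moreover have "realizes u1 u2 k f F g q" using real[of vs g] g(1) vs(2) by blast
  moreover have "realizes u1 u2 k f F h q" using real[of ws h] h(1) ws(2) by blast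
  ultimately show ?thesis by blast
qed

text \<open>A limit, modulo automorphisms, of the operations found on the finite parts of \<open>A\<close> is canonical and
  serves all finite parts at once.\<close>

lemma common_partner:
  assumes D: "D \<noteq> {}" and k: "k > 0" and f: "f \<in> Pol C k"
    and g: "canonical A k g" "interpolates D G k f g"
    and h: "canonical A k h" "interpolates D G k f h"
  shows "\<exists>r\<in>canonical_Pol C A k. \<forall>F. finite F \<longrightarrow> F \<subseteq> D \<longrightarrow>
    realizes u1 u2 k f F g r \<and> realizes u1 u2 k f F h r"
proof -
  define \<Phi> where "\<Phi> F N q \<longleftrightarrow> canonical_on k F N q \<and>
    realizes u1 u2 k f F g q \<and> realizes u1 u2 k f F h q" for F N q
  have "\<exists>p\<in>Pol C k. \<forall>F N. finite F \<longrightarrow> F \<subseteq> D \<longrightarrow> (\<exists>q. \<Phi> F N q \<and> similar_on k F p q)"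
  proof (rule local_to_global[OF D k])
    show "\<exists>q\<in>Pol C k. \<Phi> F N q" if "finite F" "F \<subseteq> D" for F N
      unfolding \<Phi>_def using common_partner_local[OF k f g h that] .
    show "\<Phi> F' N' q" if "\<Phi> F N q" "F' \<subseteq> F" "N' \<le> N" for F N F' N' q
      using that(1) canonical_on_mono[OF _ that(2,3), of k q] realizes_mono[OF _ that(2)]
      unfolding \<Phi>_def by blast
  qed
  then obtain r where r: "r \<in> Pol C k"
    "\<And>F N. finite F \<Longrightarrow> F \<subseteq> D \<Longrightarrow> \<exists>q. \<Phi> F N q \<and> similar_on k F r q" by blast
  have "canonical A k r"
    by (rule canonical_limit[OF k]) (use r(2) in \<open>unfold \<Phi>_def, blast\<close>)
  moreover have "realizes u1 u2 k f F g r \<and> realizes u1 u2 k f F h r" if "finite F" "F \<subseteq> D" for F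
    using r(2)[OF that, of 0] realizes_similar[of u1 u2 k f F] unfolding \<Phi>_def by blast
  ultimately show ?thesis using r(1) by (auto simp: canonical_Pol_def)
qed

text \<open>Canonise \<open>f\<close> at the mixed arguments \<open>t \<circ> \<epsilon>\<close>. The automorphisms needed for this can be moved from
  the arguments of \<open>u1\<close> and \<open>u2\<close> to the outside because they act on both ranges at the same time
  (\<open>independent_shift\<close>), and they do not affect the canonical operations \<open>g\<close> and \<open>r\<close>.\<close>

lemma mixed_canonical_local:
  assumes k: "k > 0" and f: "f \<in> Pol C k"
    and g: "canonical A k g" and r: "canonical A k r"
    and real: "\<And>F. finite F \<Longrightarrow> F \<subseteq> D \<Longrightarrow> realizes u1 u2 k f F g r"
    and \<epsilon>: "\<epsilon> \<in> tuples {u1, u2} k" and F: "finite F" "F \<subseteq> D"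
  shows "\<exists>q\<in>Pol C k. similar_on k F (subst_unary D q (replicate k u1)) g \<and>
    similar_on k F (subst_unary D q (replicate k u2)) r \<and>
    canonical_on k F N (subst_unary D q \<epsilon>)"
proof -
  obtain F' where F': "finite F'" "F' \<subseteq> D"
    and can: "\<And>f. f \<in> tuples D k \<rightarrow> D \<Longrightarrow> \<exists>\<alpha>s\<in>tuples G k. (\<forall>\<alpha>\<in>set \<alpha>s. \<alpha> ` F \<subseteq> F') \<and>
      canonical_on k F N (subst_unary D f \<alpha>s)"
    using canonize[OF k F, of N] by (elim exE conjE) (rule that, assumption+, erule bspec, assumption)
  obtain ts where ts: "ts \<in> tuples G k"
    and tg: "similar_on k F' (subst_unary D f (map (\<lambda>t. t \<circ> u1) ts)) g"
    and tr: "similar_on k F' (subst_unary D f (map (\<lambda>t. t \<circ> u2) ts)) r"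
    using real[OF F'] unfolding realizes_def by blast
  have cl: "u \<in> Aut_closure A" if "u \<in> {u1, u2}" for u using that u1 u2 by blast
  have \<epsilon>i: "length \<epsilon> = k" "\<And>i. i < k \<Longrightarrow> \<epsilon> ! i \<in> {u1, u2}" using tuplesD[OF \<epsilon>] by blast+
  define f0 where "f0 = subst_unary D f (map2 (\<circ>) ts \<epsilon>)"
  have tlen: "length ts = k" using ts by (simp add: tuples_def)
  have tG: "ts ! i \<in> G" if "i < k" for i using tuplesD(2)[OF ts that] .
  have "f0 \<in> tuples D k \<rightarrow>\<^sub>E D"
    unfolding f0_def
  proof (rule subst_unary_PiE)
    show "f \<in> tuples D k \<rightarrow> D" using Pol_in[OF f] by blast
    show "map2 (\<circ>) ts \<epsilon> ! i ` D \<subseteq> D" if "i < k" for i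
      using Aut_in[OF tG[OF that]] closure_in[OF cl[OF \<epsilon>i(2)[OF that]]] tlen \<epsilon>i(1) that by auto
  qed (simp add: tlen \<epsilon>i)
  then have f0: "f0 \<in> tuples D k \<rightarrow> D" by (simp add: PiE_iff Pi_iff)
  obtain \<alpha>s where \<alpha>s: "\<alpha>s \<in> tuples G k" "\<And>\<alpha>. \<alpha> \<in> set \<alpha>s \<Longrightarrow> \<alpha> ` F \<subseteq> F'"
    and c: "canonical_on k F N (subst_unary D f0 \<alpha>s)"
    using can[OF f0] by blast
  have len: "length \<alpha>s = k" using \<alpha>s by (simp add: tuples_def)
  have \<alpha>G: "\<alpha>s ! i \<in> G" if "i < k" for i using tuplesD(2)[OF \<alpha>s(1) that] .
  have \<alpha>F: "\<alpha>s ! i ` F \<subseteq> F'" if "i < k" for i using \<alpha>s(2) len that by simp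
  have "\<exists>b\<in>G. \<forall>x\<in>F. b (u1 x) = u1 ((\<alpha>s ! i) x) \<and> b (u2 x) = u2 ((\<alpha>s ! i) x)" if "i < k" for i
    using independent_shift[OF \<alpha>G[OF that] F] .
  then obtain b where b: "\<And>i. i < k \<Longrightarrow> b i \<in> G"
    "\<And>i x. i < k \<Longrightarrow> x \<in> F \<Longrightarrow> b i (u1 x) = u1 ((\<alpha>s ! i) x)"
    "\<And>i x. i < k \<Longrightarrow> x \<in> F \<Longrightarrow> b i (u2 x) = u2 ((\<alpha>s ! i) x)" by metis
  define ss where "ss = map2 (compose D) ts (map b [0..<k])"
  have ss: "length ss = k" "\<And>i. i < k \<Longrightarrow> ss ! i = compose D (ts ! i) (b i)"
    using tlen by (simp_all add: ss_def)
  have ssG: "ss \<in> tuples G k"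
    by (rule tuplesI) (use ss Aut_compose[OF tG b(1)] in auto)
  define q where "q = subst_unary D f ss"
  have q: "q \<in> Pol C k" unfolding q_def using Pol_subst[OF f G_closure[OF ssG]] .
  have key: "subst_unary D q us x = subst_unary D (subst_unary D f (map2 (\<circ>) ts us)) \<alpha>s x"
    if us: "us \<in> tuples {u1, u2} k" and x: "x \<in> tuples F k" for us x
  proof -
    have xD: "x \<in> tuples D k" using x tuples_mono[OF F(2)] by blast
    have ui: "length us = k" "\<And>i. i < k \<Longrightarrow> us ! i \<in> {u1, u2}" using tuplesD[OF us] by blast+
    have xi: "x ! i \<in> F" "x ! i \<in> D" if "i < k" for i
      using tuplesD(2)[OF x that] tuplesD(2)[OF xD that] .
    have uD: "(us ! i) (x ! i) \<in> D" if "i < k" for i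
      using closure_in[OF cl[OF ui(2)[OF that]] xi(2)[OF that]] .
    have sh: "b i ((us ! i) (x ! i)) = (us ! i) ((\<alpha>s ! i) (x ! i))" if "i < k" for i
      using ui(2)[OF that] b(2,3)[OF that xi(1)[OF that]] by auto
    have "subst_unary D q us x = subst_unary D f (map2 (\<circ>) ss us) x"
      unfolding q_def by (rule subst_subst[OF xD ss(1) ui(1) uD])
    also have "\<dots> = subst_unary D f (map2 (\<circ>) (map2 (\<circ>) ts us) \<alpha>s) x"
      by (rule subst_cong[OF xD]) (use ss ui tlen len uD sh in \<open>auto simp: compose_def\<close>)
    also have "\<dots> = subst_unary D (subst_unary D f (map2 (\<circ>) ts us)) \<alpha>s x"
      by (rule subst_subst[OF xD _ len, symmetric])
        (use ui tlen Aut_in[OF \<alpha>G xi(2)] in auto)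
    finally show ?thesis .
  qed
  have rep: "map2 (\<circ>) ts (replicate k u) = map (\<lambda>t. t \<circ> u) ts" for u :: "'a \<Rightarrow> 'a"
    by (rule nth_equalityI) (use tlen in auto)
  have rep_in: "replicate k u \<in> tuples {u1, u2} k" if "u \<in> {u1, u2}" for u
    using that by (auto simp: tuples_def)
  have sim: "similar_on k F (subst_unary D q (replicate k u))
      (subst_unary D (subst_unary D f (map (\<lambda>t. t \<circ> u) ts)) \<alpha>s)" if "u \<in> {u1, u2}" for u
    using similar_onI_eq[OF key[OF rep_in[OF that]], of F] unfolding rep .
  have "similar_on k F (subst_unary D q (replicate k u1)) g"
    by (rule similar_on_trans[OF sim similar_shift[OF k g \<alpha>s(1) \<alpha>F F(2) F'(2) tg]]) simp_all
  moreover have "similar_on k F (subst_unary D q (replicate k u2)) r"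
    by (rule similar_on_trans[OF sim similar_shift[OF k r \<alpha>s(1) \<alpha>F F(2) F'(2) tr]]) simp_all
  moreover have "canonical_on k F N (subst_unary D q \<epsilon>)"
    by (rule canonical_on_similar[OF c]) (rule similar_onI_eq, unfold f0_def, rule key[OF \<epsilon>])
  ultimately show ?thesis using q by blast
qed

lemma mixed_canonical:
  assumes D: "D \<noteq> {}" and k: "k > 0" and f: "f \<in> Pol C k"
    and g: "canonical A k g" and r: "canonical A k r"
    and real: "\<And>F. finite F \<Longrightarrow> F \<subseteq> D \<Longrightarrow> realizes u1 u2 k f F g r"
    and \<epsilon>: "\<epsilon> \<in> tuples {u1, u2} k"
  shows "\<exists>p\<in>Pol C k. similar_on k D (subst_unary D p (replicate k u1)) g \<and>
    similar_on k D (subst_unary D p (replicate k u2)) r \<and>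
    canonical A k (subst_unary D p \<epsilon>)"
proof -
  define \<Phi> where "\<Phi> F N q \<longleftrightarrow> similar_on k F (subst_unary D q (replicate k u1)) g \<and>
    similar_on k F (subst_unary D q (replicate k u2)) r \<and>
    canonical_on k F N (subst_unary D q \<epsilon>)" for F N q
  have "\<exists>p\<in>Pol C k. \<forall>F N. finite F \<longrightarrow> F \<subseteq> D \<longrightarrow> (\<exists>q. \<Phi> F N q \<and> similar_on k F p q)"
  proof (rule local_to_global[OF D k])
    show "\<exists>q\<in>Pol C k. \<Phi> F N q" if "finite F" "F \<subseteq> D" for F N
      unfolding \<Phi>_def using mixed_canonical_local[OF k f g r real \<epsilon> that] .
    show "\<Phi> F' N' q" if "\<Phi> F N q" "F' \<subseteq> F" "N' \<le> N" for F N F' N' q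
      using that(1) canonical_on_mono[OF _ that(2,3)] similar_on_mono[OF _ that(2)]
      unfolding \<Phi>_def by blast
  qed
  then obtain p where p: "p \<in> Pol C k"
    "\<And>F N. finite F \<Longrightarrow> F \<subseteq> D \<Longrightarrow> \<exists>q. \<Phi> F N q \<and> similar_on k F p q" by blast
  have lim: "\<exists>q. \<Phi> F N q \<and> (\<forall>us\<in>tuples {u1, u2} k. similar_on k F (subst_unary D p us) (subst_unary D q us))"
    if F: "finite F" "F \<subseteq> D" for F N
  proof -
    define F' where "F' = F \<union> u1 ` F \<union> u2 ` F"
    have F': "finite F'" "F' \<subseteq> D" "F \<subseteq> F'"
      using F closure_in[OF u1(1)] closure_in[OF u2(1)] by (auto simp: F'_def)
    obtain q where q: "\<Phi> F' N q" "similar_on k F' p q" using p(2)[OF F'(1,2)] by blast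
    have "similar_on k F (subst_unary D p us) (subst_unary D q us)"
      if us: "us \<in> tuples {u1, u2} k" for us
    proof (rule similar_on_subst[OF q(2) tuplesD(1)[OF us] _ F(2)])
      fix i assume "i < k"
      then have "us ! i \<in> {u1, u2}" using tuplesD(2)[OF us] by blast
      then show "us ! i ` F \<subseteq> F'" by (auto simp: F'_def)
    qed
    moreover have "\<Phi> F N q"
      using q(1) canonical_on_mono[OF _ F'(3) order_refl] similar_on_mono[OF _ F'(3)]
      unfolding \<Phi>_def by blast
    ultimately show ?thesis by blast
  qed
  have rep_in: "replicate k u \<in> tuples {u1, u2} k" if "u \<in> {u1, u2}" for u
    using that by (auto simp: tuples_def)
  have glob: "similar_on k D p' q'"
    if "\<And>F. finite F \<Longrightarrow> F \<subseteq> D \<Longrightarrow> similar_on k F p' q'" for p' q' :: "'a opn"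
    unfolding similar_on_def
  proof
    fix xs assume xs: "xs \<in> lists (tuples D k)"
    define F where "F = \<Union> (set ` set xs)"
    have "finite F" "F \<subseteq> D" "xs \<in> lists (tuples F k)" using xs by (auto simp: F_def tuples_def)
    then show "tp A (map p' xs) = tp A (map q' xs)" using that unfolding similar_on_def by blast
  qed
  have lim': "similar_on k F (subst_unary D p (replicate k u1)) g \<and>
      similar_on k F (subst_unary D p (replicate k u2)) r \<and>
      (\<exists>q. similar_on k F (subst_unary D p \<epsilon>) q \<and> canonical_on k F N q)"
    if F: "finite F" "F \<subseteq> D" for F N
  proof -
    obtain q where q: "\<Phi> F N q"
      and sim: "\<And>us. us \<in> tuples {u1, u2} k \<Longrightarrow> similar_on k F (subst_unary D p us) (subst_unary D q us)"
      using lim[OF F, of N] by (elim exE conjE) (rule that, assumption, erule bspec, assumption)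
    note \<Phi> = q[unfolded \<Phi>_def]
    have "similar_on k F (subst_unary D p (replicate k u1)) g"
      by (rule similar_on_trans[OF sim[OF rep_in]]) (use \<Phi> in simp_all)
    moreover have "similar_on k F (subst_unary D p (replicate k u2)) r"
      by (rule similar_on_trans[OF sim[OF rep_in]]) (use \<Phi> in simp_all)
    ultimately show ?thesis using sim[OF \<epsilon>] \<Phi> by blast
  qed
  have "similar_on k D (subst_unary D p (replicate k u1)) g"
    by (rule glob) (use lim' in blast)
  moreover have "similar_on k D (subst_unary D p (replicate k u2)) r"
    by (rule glob) (use lim' in blast)
  moreover have "canonical A k (subst_unary D p \<epsilon>)"
    by (rule canonical_limit[OF k]) (use lim' in blast)
  ultimately show ?thesis using p(1) by blast
qed

text \<open>Seen as functions of \<open>(x, y)\<close>: the coordinates with \<open>\<beta> i = 1\<close> receive \<open>y\<close>, on the left through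
  \<open>u\<close> in the second argument of the binary operation, on the right through \<open>u\<close> in the coordinate.\<close>

lemma minor_subst:
  assumes vs: "length vs = k" and ws: "length ws = k" and vD: "\<And>i. i < k \<Longrightarrow> vs ! i ` D \<subseteq> D"
    and u: "u ` D \<subseteq> D"
    and \<beta>: "\<And>i. i < k \<Longrightarrow> \<beta> i = 0 \<and> ws ! i = vs ! i \<or> \<beta> i = 1 \<and> vs ! i = (\<lambda>x\<in>D. x) \<and> ws ! i = u"
  shows "subst_unary D (minor D k 2 \<beta> (subst_unary D f vs)) [id, u] =
    minor D k 2 \<beta> (subst_unary D f ws)"
proof
  fix x
  show "subst_unary D (minor D k 2 \<beta> (subst_unary D f vs)) [id, u] x =
    minor D k 2 \<beta> (subst_unary D f ws) x"
  proof (cases "x \<in> tuples D 2")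
    case False
    then show ?thesis by (simp add: subst_unary_def minor_def flip: numeral_2_eq_2)
  next
    case True
    then obtain a b where x: "x = [a, b]" "a \<in> D" "b \<in> D"
      by (auto simp: tuples_def numeral_2_eq_2 length_Suc_conv)
    let ?y = "[a, u b]" and ?m = "\<lambda>x. map (\<lambda>i. x ! \<beta> i) [0..<k]"
    have y: "?y \<in> tuples D 2" using x u by (auto simp: tuples_def)
    have my: "?m z \<in> tuples D k" if "z \<in> tuples D 2" for z
    proof (rule tuplesI)
      fix i assume i: "i < k"
      have "z ! 0 \<in> D" "z ! 1 \<in> D" using tuplesD(2)[OF that] by simp_all
      then show "?m z ! i \<in> D" using \<beta>[OF i] i by auto
    qed simp
    have "apply_tuple vs (?m ?y) = apply_tuple ws (?m x)"
    proof (rule nth_equalityI)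
      fix i assume "i < length (apply_tuple vs (?m ?y))"
      then have i: "i < k" by simp
      then show "apply_tuple vs (?m ?y) ! i = apply_tuple ws (?m x) ! i"
        using \<beta>[OF i] x u vs ws by auto
    qed (use vs ws in simp)
    then have "subst_unary D f vs (?m ?y) = subst_unary D f ws (?m x)"
      using my[OF y] my[OF True] vs ws by (simp add: subst_unary_apply)
    moreover have "subst_unary D (minor D k 2 \<beta> (subst_unary D f vs)) [id, u] x =
        minor D k 2 \<beta> (subst_unary D f vs) ?y"
      using True x by (simp add: subst_unary_def flip: numeral_2_eq_2)
    ultimately show ?thesis using y True by (simp add: minor_def)
  qed
qed

end


section \<open>The unique interpolation property\<close>

context reduct_of_ramsey
begin

text \<open>As a map on the whole type, \<open>id\<close> need not be an element of the closure of the automorphisms;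
  on \<open>D\<close> it acts like the identity automorphism, to which the closure properties apply.\<close>

lemma subst_id_eq: "subst_unary D f [id, u] = subst_unary D f [\<lambda>x\<in>D. x, u]"
proof
  fix x
  show "subst_unary D f [id, u] x = subst_unary D f [\<lambda>x\<in>D. x, u] x"
  proof (cases "x \<in> tuples D 2")
    case True
    show ?thesis
      by (rule subst_cong[OF True])
        (use tuplesD(2)[OF True] in \<open>auto simp: less_2_cases_iff numeral_2_eq_2 less_Suc_eq\<close>)
  next
    case False
    then show ?thesis by (simp add: subst_unary_def flip: numeral_2_eq_2)
  qed
qed

lemma Pol_subst_id:
  assumes "f \<in> Pol C 2" "u \<in> Aut_closure A"
  shows "subst_unary D f [id, u] \<in> Pol C 2"
  unfolding subst_id_eq
  by (rule Pol_subst[OF assms(1)]) (use assms(2) Aut_subset_closure[OF Aut_id] in \<open>auto simp: tuples_def\<close>)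

text \<open>On a finite set \<open>u\<close> agrees with an automorphism.\<close>

lemma interpolates_subst_id:
  assumes f: "f \<in> Pol C 2" and u: "u \<in> Aut_closure A"
  shows "interpolates D G 2 f (subst_unary D f [id, u])"
  unfolding interpolates_def
proof (intro allI impI)
  fix F assume F: "finite F \<and> F \<subseteq> D"
  let ?id = "\<lambda>x\<in>D. x"
  obtain g where g: "g \<in> G" "\<forall>x\<in>F. g x = u x" using u F unfolding Aut_closure_iff by blast
  have vs: "[?id, g] \<in> tuples G 2" using g Aut_id by (auto simp: tuples_def)
  have "subst_unary D f [id, u] x = ?id (subst_unary D f [?id, g] x)" if x: "x \<in> tuples F 2" for x
  proof -
    have xD: "x \<in> tuples D 2" using x F tuples_mono by blast
    have "[?id, g] \<in> tuples (Aut_closure A) 2" using vs Aut_subset_closure by (auto simp: tuples_def)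
    then have "subst_unary D f [?id, g] x \<in> D" using Pol_in[OF Pol_subst[OF f]] xD by blast
    moreover have "subst_unary D f [id, u] x = subst_unary D f [?id, g] x"
    proof (rule subst_cong[OF xD])
      fix i :: nat assume "i < 2"
      then show "([id, u] ! i) (x ! i) = ([?id, g] ! i) (x ! i)"
        using tuplesD(2)[OF x, of 0] tuplesD(2)[OF x, of 1] tuplesD(2)[OF xD, of 0] g(2)
        by (auto simp: less_2_cases_iff)
    qed simp_all
    ultimately show ?thesis by simp
  qed
  then show "\<exists>w\<in>G. \<exists>vs\<in>tuples G 2. \<forall>x\<in>tuples F 2. subst_unary D f [id, u] x = w (subst_unary D f vs x)"
    using Aut_id vs by blast
qed

end

abbreviation proj :: "nat \<Rightarrow> nat \<Rightarrow> nat opn" where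
  "proj k i \<equiv> \<lambda>x\<in>tuples {0, 1} k. x ! i"

lemma minor_proj:
  assumes "i < n" "\<beta> \<in> {..<n} \<rightarrow> {..<k}"
  shows "minor {0, 1} n k \<beta> (proj n i) = proj k (\<beta> i)"
proof
  fix x :: "nat list"
  have "map (\<lambda>i. x ! \<beta> i) [0..<n] \<in> tuples {0, 1} n" if "x \<in> tuples {0, 1} k"
    by (rule tuplesI) (use tuplesD(2)[OF that] assms(2) in auto)
  then show "minor {0, 1} n k \<beta> (proj n i) x = proj k (\<beta> i) x"
    using assms(1) by (simp add: minor_def)
qed

lemma proj_distinct: "proj 2 0 \<noteq> proj 2 1"
proof
  assume "proj 2 0 = proj 2 1"
  then have "proj 2 0 [0, 1] = proj 2 1 [0, 1]" by (rule fun_cong)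
  then show False by (simp add: tuples_def)
qed

context independent_pair
begin

text \<open>Let \<open>\<zeta>\<close> send \<open>g\<close> to the projection to \<open>a\<close> and \<open>r\<close> to the projection to \<open>b \<noteq> a\<close>, and take \<open>p\<close> such
  that \<open>p(u1, \<dots>, u1)\<close> behaves like \<open>g\<close>, \<open>p(u2, \<dots>, u2)\<close> behaves like \<open>r\<close>, and the operation with \<open>u1\<close> in
  coordinate \<open>a\<close> and \<open>u2\<close> elsewhere is canonical. If \<open>\<zeta>\<close> sends the mixed operation to the projection
  to \<open>a\<close>, compare it with \<open>p(u2, \<dots>, u2)\<close>: they differ in coordinate \<open>a\<close> only. Otherwise compare it with
  \<open>p(u1, \<dots>, u1)\<close>: they differ in all coordinates but \<open>a\<close>. In both cases put \<open>y\<close> into the coordinates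
  where \<open>u1\<close> and \<open>u2\<close> are exchanged and \<open>x\<close> into the others. Of the two binary operations obtained, one
  is sent to the projection to \<open>x\<close> and the other one to the projection to \<open>y\<close>.\<close>

lemma image_eq_if_realized:
  assumes mp: "minor_preserving D (canonical_Pol C A) {0, 1} Proj \<zeta>"
    and inv: "invariant D (Aut_closure A) (canonical_Pol C A) \<zeta>"
    and bin: "\<And>p. p \<in> Pol C 2 \<Longrightarrow> canonical A 2 (subst_unary D p [id, u1]) \<Longrightarrow>
      canonical A 2 (subst_unary D p [id, u2]) \<Longrightarrow>
      \<zeta> 2 (subst_unary D p [id, u1]) = \<zeta> 2 (subst_unary D p [id, u2])"
    and D: "D \<noteq> {}" and f: "f \<in> Pol C k"
    and g: "g \<in> canonical_Pol C A k" and r: "r \<in> canonical_Pol C A k"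
    and real: "\<And>F. finite F \<Longrightarrow> F \<subseteq> D \<Longrightarrow> realizes u1 u2 k f F g r"
  shows "\<zeta> k g = \<zeta> k r"
proof (rule ccontr)
  assume neq: "\<zeta> k g \<noteq> \<zeta> k r"
  have k: "k > 0" using f by (simp add: Pol_iff)
  have proj: "\<exists>i<k. \<zeta> k q = proj k i" if "q \<in> canonical_Pol C A k" for q
    using mp that unfolding minor_preserving_def Proj_def projections_def by blast
  obtain a b where a: "a < k" "\<zeta> k g = proj k a" and b: "b < k" "\<zeta> k r = proj k b"
    using proj g r by blast
  have "a \<noteq> b" using neq a b by auto
  define \<epsilon> where "\<epsilon> = (replicate k u2)[a := u1]"
  have \<epsilon>: "\<epsilon> \<in> tuples {u1, u2} k" by (rule tuplesI) (use a(1) in \<open>auto simp: \<epsilon>_def nth_list_update\<close>)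
  have can: "canonical A k g" "canonical A k r" using g r by (auto simp: canonical_Pol_def)
  obtain p where p: "p \<in> Pol C k"
    and p1: "similar_on k D (subst_unary D p (replicate k u1)) g"
    and p2: "similar_on k D (subst_unary D p (replicate k u2)) r"
    and p3: "canonical A k (subst_unary D p \<epsilon>)"
    using mixed_canonical[OF D k f can real \<epsilon>] by blast
  let ?r1 = "subst_unary D p (replicate k u1)" and ?r2 = "subst_unary D p (replicate k u2)"
    and ?r3 = "subst_unary D p \<epsilon>"
  let ?id = "\<lambda>x\<in>D. x"
  have cl: "u1 \<in> Aut_closure A" "u2 \<in> Aut_closure A" "?id \<in> Aut_closure A"
    using u1 u2 Aut_subset_closure[OF Aut_id] by blast+
  have clt: "replicate k u \<in> tuples (Aut_closure A) k" "(replicate k u)[a := v] \<in> tuples (Aut_closure A) k"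
    if "u \<in> Aut_closure A" "v \<in> Aut_closure A" for u v
    by (rule tuplesI; use that a(1) in \<open>simp add: nth_list_update\<close>)+
  have r1: "?r1 \<in> canonical_Pol C A k"
    using Pol_subst[OF p clt(1)[OF cl(1) cl(1)]] canonical_similar[OF k can(1) p1]
    by (simp add: canonical_Pol_def)
  have r2: "?r2 \<in> canonical_Pol C A k"
    using Pol_subst[OF p clt(1)[OF cl(2) cl(2)]] canonical_similar[OF k can(2) p2]
    by (simp add: canonical_Pol_def)
  have r3: "?r3 \<in> canonical_Pol C A k"
    using Pol_subst[OF p clt(2)[OF cl(2) cl(1)]] p3 by (simp add: canonical_Pol_def \<epsilon>_def)
  have \<zeta>1: "\<zeta> k ?r1 = proj k a" using zeta_similar[OF inv r1 g p1] a by simp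
  have \<zeta>2: "\<zeta> k ?r2 = proj k b" using zeta_similar[OF inv r2 r p2] b by simp
  obtain c where c: "c < k" "\<zeta> k ?r3 = proj k c" using proj[OF r3] by blast
  have \<zeta>minor: "\<zeta> 2 (minor D k 2 \<beta> q) = proj 2 (\<beta> i)"
    if "q \<in> canonical_Pol C A k" "\<zeta> k q = proj k i" "i < k" "\<beta> \<in> {..<k} \<rightarrow> {..<2}" for q i \<beta>
    using mp that minor_proj[OF that(3,4)] unfolding minor_preserving_def by simp
  have can_minor: "canonical A 2 (minor D k 2 \<beta> q)"
    if "q \<in> canonical_Pol C A k" "\<beta> \<in> {..<k} \<rightarrow> {..<2}" for q \<beta>
    using canonical_minor[OF _ k _ that(2), of q] that(1) by (simp add: canonical_Pol_def)
  have binary: "proj 2 (\<beta> i) = proj 2 (\<beta> j)"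
    if vs: "vs \<in> tuples (Aut_closure A) k" and \<beta>: "\<beta> \<in> {..<k} \<rightarrow> {..<2}"
      and ws1: "length ws1 = k" "subst_unary D p ws1 \<in> canonical_Pol C A k"
        "\<zeta> k (subst_unary D p ws1) = proj k i" "i < k"
      and ws2: "length ws2 = k" "subst_unary D p ws2 \<in> canonical_Pol C A k"
        "\<zeta> k (subst_unary D p ws2) = proj k j" "j < k"
      and \<beta>1: "\<And>i. i < k \<Longrightarrow> \<beta> i = 0 \<and> ws1 ! i = vs ! i \<or> \<beta> i = 1 \<and> vs ! i = ?id \<and> ws1 ! i = u1"
      and \<beta>2: "\<And>i. i < k \<Longrightarrow> \<beta> i = 0 \<and> ws2 ! i = vs ! i \<or> \<beta> i = 1 \<and> vs ! i = ?id \<and> ws2 ! i = u2"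
    for vs \<beta> ws1 ws2 i j
  proof -
    let ?P = "minor D k 2 \<beta> (subst_unary D p vs)"
    have vD: "vs ! i ` D \<subseteq> D" if "i < k" for i
      using closure_in[OF tuplesD(2)[OF vs that]] by blast
    have uD: "u1 ` D \<subseteq> D" "u2 ` D \<subseteq> D" using closure_in cl by blast+
    have e1: "subst_unary D ?P [id, u1] = minor D k 2 \<beta> (subst_unary D p ws1)"
      by (rule minor_subst[OF tuplesD(1)[OF vs] ws1(1) vD uD(1) \<beta>1])
    have e2: "subst_unary D ?P [id, u2] = minor D k 2 \<beta> (subst_unary D p ws2)"
      by (rule minor_subst[OF tuplesD(1)[OF vs] ws2(1) vD uD(2) \<beta>2])
    have "?P \<in> Pol C 2" using Pol_minor[OF Pol_subst[OF p vs] _ \<beta>] by simp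
    from bin[OF this] have "\<zeta> 2 (minor D k 2 \<beta> (subst_unary D p ws1)) =
        \<zeta> 2 (minor D k 2 \<beta> (subst_unary D p ws2))"
      unfolding e1 e2 using can_minor[OF ws1(2) \<beta>] can_minor[OF ws2(2) \<beta>] by blast
    then show ?thesis using \<zeta>minor[OF ws1(2-4) \<beta>] \<zeta>minor[OF ws2(2-4) \<beta>] by simp
  qed
  show False
  proof (cases "c = a")
    case True
    \<comment> \<open>\<open>(x, y) \<mapsto> p(u2 x, \<dots>, y, \<dots>, u2 x)\<close> with \<open>y\<close> in coordinate \<open>a\<close>\<close>
    define \<beta> :: "nat \<Rightarrow> nat" where "\<beta> i = (if i = a then 1 else 0)" for i
    have "proj 2 (\<beta> c) = proj 2 (\<beta> b)"
    proof (rule binary[of "(replicate k u2)[a := ?id]" \<beta> \<epsilon> c "replicate k u2" b])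
      show "\<beta> \<in> {..<k} \<rightarrow> {..<2}" by (auto simp: \<beta>_def)
    qed (use clt cl r3 c r2 \<zeta>2 b a(1) in \<open>auto simp: \<beta>_def \<epsilon>_def nth_list_update\<close>)
    then show False using True \<open>a \<noteq> b\<close> proj_distinct by (simp add: \<beta>_def)
  next
    case False
    \<comment> \<open>\<open>(x, y) \<mapsto> p(y, \<dots>, u1 x, \<dots>, y)\<close> with \<open>u1 x\<close> in coordinate \<open>a\<close>\<close>
    define \<beta> :: "nat \<Rightarrow> nat" where "\<beta> i = (if i = a then 0 else 1)" for i
    have "proj 2 (\<beta> a) = proj 2 (\<beta> c)"
    proof (rule binary[of "(replicate k ?id)[a := u1]" \<beta> "replicate k u1" a \<epsilon> c])
      show "\<beta> \<in> {..<k} \<rightarrow> {..<2}" by (auto simp: \<beta>_def)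
    qed (use clt cl r3 c r1 \<zeta>1 a in \<open>auto simp: \<beta>_def \<epsilon>_def nth_list_update\<close>)
    then show False using False proj_distinct by (simp add: \<beta>_def)
  qed
qed

end

theorem theorem6p4:
  fixes \<sigma> :: "'r signature" and A :: "('r, 'a) struct"
    and \<tau> :: "'s signature" and C :: "('s, 'a) struct"
    and \<zeta> :: "nat \<Rightarrow> 'a opn \<Rightarrow> nat opn"
    and A1 A2 :: "('r, 'a) struct"
  assumes "countable (univ A)"
    and "finitely_homogeneous \<sigma> A"
    and "ramsey \<sigma> A"
    and "reduct \<tau> C A"
    and "minor_preserving (univ A) (canonical_Pol C A) {0, 1} Proj \<zeta>"
    and "invariant (univ A) (Aut_closure A) (canonical_Pol C A) \<zeta>"
    and "elementary_substructure A1 A"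
    and "elementary_substructure A2 A"
    and "independent_substructures A A1 A2"
  shows "UIP A (Pol C) (canonical_Pol C A) \<zeta> \<longleftrightarrow>
    (\<forall>f \<in> Pol C 2. \<forall>u1 \<in> Aut_closure A. \<forall>u2 \<in> Aut_closure A.
       u1 ` univ A \<subseteq> univ A1 \<and> u2 ` univ A \<subseteq> univ A2 \<and>
       canonical A 2 (subst_unary (univ A) f [id, u1]) \<and>
       canonical A 2 (subst_unary (univ A) f [id, u2]) \<longrightarrow>
       \<zeta> 2 (subst_unary (univ A) f [id, u1]) = \<zeta> 2 (subst_unary (univ A) f [id, u2]))"
  (is "?UIP \<longleftrightarrow> ?bin")
proof -
  interpret reduct_of_ramsey \<sigma> A \<tau> C
    by unfold_locales (use assms in auto)
  show ?thesis
  proof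
    assume uip: ?UIP
    show ?bin
    proof (intro ballI impI, elim conjE)
      fix f u1 u2 assume f: "f \<in> Pol C 2" and u: "u1 \<in> Aut_closure A" "u2 \<in> Aut_closure A"
        and can: "canonical A 2 (subst_unary D f [id, u1])" "canonical A 2 (subst_unary D f [id, u2])"
      have "subst_unary D f [id, v] \<in> canonical_Pol C A 2"
        if "v \<in> Aut_closure A" "canonical A 2 (subst_unary D f [id, v])" for v
        using Pol_subst_id[OF f that(1)] that(2) by (simp add: canonical_Pol_def)
      then show "\<zeta> 2 (subst_unary D f [id, u1]) = \<zeta> 2 (subst_unary D f [id, u2])"
        using uip[unfolded UIP_def, rule_format, of _ 2 _ f] f can u interpolates_subst_id[OF f] by blast
    qed
  next
    assume bin: ?bin
    obtain u1 where u1: "u1 \<in> Aut_closure A" "u1 ` D \<subseteq> univ A1"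
      using elementary_embedding[OF assms(7)] by blast
    obtain u2 where u2: "u2 \<in> Aut_closure A" "u2 ` D \<subseteq> univ A2"
      using elementary_embedding[OF assms(8)] by blast
    interpret independent_pair \<sigma> A \<tau> C A1 A2 u1 u2
      by unfold_locales (use assms u1 u2 in auto)
    show ?UIP
      unfolding UIP_def
    proof (intro allI ballI impI, elim conjE)
      fix k g h f assume g: "g \<in> canonical_Pol C A k" and h: "h \<in> canonical_Pol C A k"
        and f: "f \<in> Pol C k" and int: "interpolates D G k f g" "interpolates D G k f h"
      show "\<zeta> k g = \<zeta> k h"
      proof (cases "D = {}")
        \<comment> \<open>The limits over finite parts need a point; without one, both operations are empty.\<close>
        case True
        have "k > 0" using f by (simp add: Pol_iff)
        then have "tuples D k = {}" using True by (auto simp: tuples_def)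
        then have "g = h" using g h by (auto simp: canonical_Pol_def Pol_iff)
        then show ?thesis by simp
      next
        case False
        have k: "k > 0" using f by (simp add: Pol_iff)
        have can: "canonical A k g" "canonical A k h" using g h by (auto simp: canonical_Pol_def)
        obtain r where r: "r \<in> canonical_Pol C A k"
          and real: "\<And>F. finite F \<Longrightarrow> F \<subseteq> D \<Longrightarrow> realizes u1 u2 k f F g r"
            "\<And>F. finite F \<Longrightarrow> F \<subseteq> D \<Longrightarrow> realizes u1 u2 k f F h r"
          using common_partner[OF False k f can(1) int(1) can(2) int(2)] by blast
        have bin': "\<zeta> 2 (subst_unary D p [id, u1]) = \<zeta> 2 (subst_unary D p [id, u2])"
          if "p \<in> Pol C 2" "canonical A 2 (subst_unary D p [id, u1])"
            "canonical A 2 (subst_unary D p [id, u2])" for p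
          using bin that u1 u2 by blast
        have "\<zeta> k g = \<zeta> k r"
          by (rule image_eq_if_realized[OF assms(5,6) bin' False f g r real(1)])
        moreover have "\<zeta> k h = \<zeta> k r"
          by (rule image_eq_if_realized[OF assms(5,6) bin' False f h r real(2)])
        ultimately show ?thesis by simp
      qed
    qed
  qed
qed

end
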